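(* Let $f\in C^2(\mathbb{R})$ with $f''>0$ on $\mathbb{R}$, and let $\overline{u}_l<\overline{u}_r$ be real constants. Let $w_{0l},w_{0r}\in L^\infty(\mathbb{R})$ be arbitrary periodic functions with periods $p_l>0$ and $p_r>0$ respectively, satisfying $$\frac{1}{p_l}\int_0^{p_l}w_{0l}(x)\,dx=\frac{1}{p_r}\int_0^{p_r}w_{0r}(x)\,dx=0.$$ Let $N>0$ and let $u_0\in L^\infty(\mathbb{R})$ satisfy $u_0(x)=\overline{u}_l+w_{0l}(x)$ for $x<-N$ and $u_0(x)=\overline{u}_r+w_{0r}(x)$ for $x>N$. Let $u$ be the entropy solution of $\partial_t u+\partial_x f(u)=0$ on $\mathbb{R}\times(0,\infty)$ with $u(\cdot,0)=u_0$, and let $$u^R(x,t):=\begin{cases}\overline{u}_l,& x\le f'(\overline{u}_l)t,\\ (f')^{-1}\!\left(\frac{x}{t}\right),& f'(\overline{u}_l)t<x\le f'(\overline{u}_r)t,\\ \overline{u}_r,& x>f'(\overline{u}_r)t.\end{cases}$$ Then there exists a constant $C>0$, independent of $t$, such that $$\sup_{x\in\mathbb{R}}|u(x,t)-u^R(x,t)|\le\frac{C}{\sqrt{t}}\qquad\text{for all }t>0.$$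
   Context: For initial data $u_0\in L^\infty(\mathbb{R})$, the entropy solution of $\partial_t u+\partial_x f(u)=0$, $u(\cdot,0)=u_0$, is the unique bounded weak (distributional) solution satisfying, for some constant $E>0$ depending only on $f$ and $u_0$, $u(x+a,t)-u(x,t)\le \frac{Ea}{t}$ for a.e. $x\in\mathbb{R}$ and all $t>0$, $a>0$. For each $t>0$, $u(\cdot,t)$ has one-sided limits at every point; suprema in $x$ are understood as essential suprema (equivalently, for one-sided limits). *)

theory Defs
  imports "HOL-Analysis.Analysis" "HOL-Probability.Essential_Supremum"
begin

definition Linfty :: "'a measure \<Rightarrow> ('a \<Rightarrow> real) \<Rightarrow> bool" where
  "Linfty M g \<longleftrightarrow> g \<in> borel_measurable M \<and> esssup M (\<lambda>z. ereal \<bar>g z\<bar>) < \<infinity>"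

primrec Ck :: "nat \<Rightarrow> (real \<times> real \<Rightarrow> real) \<Rightarrow> bool" where
  "Ck 0 \<phi> \<longleftrightarrow> continuous_on UNIV \<phi>"
| "Ck (Suc k) \<phi> \<longleftrightarrow> (\<exists>\<phi>x \<phi>t.
     (\<forall>z. (\<phi> has_derivative (\<lambda>h. \<phi>x z * fst h + \<phi>t z * snd h)) (at z)) \<and> Ck k \<phi>x \<and> Ck k \<phi>t)"

text \<open>Test functions live on the whole plane; their restrictions to \<open>t \<ge> 0\<close> need not vanish at
  \<open>t = 0\<close>.\<close>

definition test_function :: "(real \<times> real \<Rightarrow> real) \<Rightarrow> bool" where
  "test_function \<phi> \<longleftrightarrow> (\<forall>k. Ck k \<phi>) \<and> compact (closure {z. \<phi> z \<noteq> 0})"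

definition dx :: "(real \<times> real \<Rightarrow> real) \<Rightarrow> real \<times> real \<Rightarrow> real" where
  "dx \<phi> z = deriv (\<lambda>x. \<phi> (x, snd z)) (fst z)"

definition dt :: "(real \<times> real \<Rightarrow> real) \<Rightarrow> real \<times> real \<Rightarrow> real" where
  "dt \<phi> z = deriv (\<lambda>t. \<phi> (fst z, t)) (snd z)"

abbreviation half_plane :: "(real \<times> real) set" where
  "half_plane \<equiv> UNIV \<times> {0<..}"

text \<open>Solutions are written \<open>u x t\<close>. The initial condition is imposed through the boundary term at
  \<open>t = 0\<close>, so the values \<open>u x 0\<close> are irrelevant.\<close>

definition weak_solution :: "(real \<Rightarrow> real) \<Rightarrow> (real \<Rightarrow> real) \<Rightarrow> (real \<Rightarrow> real \<Rightarrow> real) \<Rightarrow> bool" where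
  "weak_solution f u0 u \<longleftrightarrow> (\<forall>\<phi>. test_function \<phi> \<longrightarrow>
     (LINT z:half_plane|lebesgue.
        u (fst z) (snd z) * dt \<phi> z + f (u (fst z) (snd z)) * dx \<phi> z)
     + (LINT x|lebesgue. u0 x * \<phi> (x, 0)) = 0)"

definition oleinik_condition :: "(real \<Rightarrow> real \<Rightarrow> real) \<Rightarrow> bool" where
  "oleinik_condition u \<longleftrightarrow> (\<exists>E>0. \<forall>t>0. \<forall>a>0.
     AE x in lebesgue. u (x + a) t - u x t \<le> E * a / t)"

text \<open>Membership in \<open>C((0,\<infinity>); L\<^sup>1\<^sub>l\<^sub>o\<^sub>c(\<real>))\<close>. An element of \<open>L\<^sup>\<infinity>\<close> of the half plane does not determine
  its slice at a given time; this selects the representative whose slices \<open>u(\<cdot>,t)\<close>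
  are meaningful for every \<open>t > 0\<close>.\<close>

definition time_continuous :: "(real \<Rightarrow> real \<Rightarrow> real) \<Rightarrow> bool" where
  "time_continuous u \<longleftrightarrow>
     (\<forall>t>0. \<forall>R. set_integrable lebesgue {-R..R} (\<lambda>x. u x t)) \<and>
     (\<forall>t>0. \<forall>R. ((\<lambda>s. LINT x:{-R..R}|lebesgue. \<bar>u x s - u x t\<bar>) \<longlongrightarrow> 0) (at t))"

definition entropy_solution :: "(real \<Rightarrow> real) \<Rightarrow> (real \<Rightarrow> real) \<Rightarrow> (real \<Rightarrow> real \<Rightarrow> real) \<Rightarrow> bool" where
  "entropy_solution f u0 u \<longleftrightarrow>
     Linfty (lebesgue_on half_plane) (\<lambda>z. u (fst z) (snd z)) \<and>
     time_continuous u \<and> weak_solution f u0 u \<and> oleinik_condition u"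

text \<open>The first argument is the derivative of the flux. It need not be surjective, but by the
  intermediate value theorem \<open>x / t\<close> lies in its range wherever the inverse is used.\<close>

definition rarefaction :: "(real \<Rightarrow> real) \<Rightarrow> real \<Rightarrow> real \<Rightarrow> real \<Rightarrow> real \<Rightarrow> real" where
  "rarefaction f' ul ur x t =
     (if x \<le> f' ul * t then ul else if x \<le> f' ur * t then inv f' (x / t) else ur)"

text \<open>As for any element of \<open>L\<^sup>\<infinity>\<close>, periodicity is understood almost everywhere.\<close>

definition periodic_ae :: "real \<Rightarrow> (real \<Rightarrow> real) \<Rightarrow> bool" where
  "periodic_ae p w \<longleftrightarrow> (AE x in lebesgue. w (x + p) = w x)"

end

theory Submission
  imports Defs
begin

text \<open>
  A weak solution has a Lipschitz potential \<open>U\<close> with \<open>U\<^sub>x = u\<close> and \<open>U\<^sub>t = - f u\<close>, and the potential of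
  the rarefaction wave is \<open>R(x,t) = max {v x - f v t | ul \<le> v \<le> ur}\<close>. Since the perturbations are periodic
  with mean zero, \<open>\<bar>U - R\<bar> \<le> C\<close> initially, and this bound persists for all times. Above, convexity gives
  \<open>f u \<ge> f v + f' v (u - v)\<close>, which is integrated along the line of speed \<open>f' v\<close>. Below, it suffices to compare
  \<open>U\<close> with each plane wave \<open>v x - f v t\<close>: near a point where \<open>U(\<cdot>,t) - v x\<close> is almost minimal, the one-sided
  Lipschitz condition (semiconcavity of \<open>U\<close>) forces \<open>u\<close> to be close to \<open>v\<close>, hence \<open>U\<^sub>t\<close> to be close to \<open>- f v\<close>.
  Finally, semiconcavity gives \<open>U(y) \<le> U(x) + u(x) (y - x) + E (y - x)\<^sup>2 / (2 t)\<close> for all \<open>y\<close>, while \<open>R\<close> lies above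
  its tangent at \<open>x\<close>; optimizing over \<open>y\<close> yields \<open>(u - u\<^sup>R)\<^sup>2 \<le> 4 C E / t\<close>.
\<close>

section \<open>Smooth cutoffs as test functions\<close>

text \<open>Convexity controls the potential from one side only. The tangent inequality bounds
  \<open>U\<close> from above for every bounded weak solution, whereas a shock that violates the
  one-sided condition may let \<open>U\<close> fall too fast; so the lower bound has to use that
  condition, and the final optimization uses it again, with \<open>E / t\<close> supplying the rate.
  Its constant blows up as t tends to 0, so the lower bound is iterated from a positive time
  \<open>s0\<close> and \<open>s0\<close> is sent to 0 afterwards. The other obstacle is regularity:
  \<open>u\<close> is defined almost everywhere and has no values along a line. Each identity is
  proved for averages over a short window of length \<delta> and carried over to \<open>U\<close>,
  which is Lipschitz, at a cost of order \<delta>. The potential of the rarefaction wave needs no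
  definition of its own: \<open>U\<close> is bounded below by every plane wave with state in
  \<open>[ul, ur]\<close>, and above at (x,t) by the single plane wave with the state of the
  rarefaction wave there. That plane wave is the tangent used at the end.\<close>

definition flat_exp :: "nat \<Rightarrow> real \<Rightarrow> real" where
  "flat_exp m x = (if x > 0 then exp (- (1 / x)) / x ^ m else 0)"

lemma flat_exp_tendsto_0: "(flat_exp m \<longlongrightarrow> 0) (at_right 0)"
proof -
  have "((\<lambda>x::real. (inverse x) ^ m / exp (inverse x)) \<longlongrightarrow> 0) (at_right 0)"
    by (rule filterlim_compose[OF tendsto_power_div_exp_0 filterlim_inverse_at_top_right])
  moreover have "\<forall>\<^sub>F x::real in at_right 0. (inverse x) ^ m / exp (inverse x) = flat_exp m x"
    by (rule eventually_at_rightI[of 0 1])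
      (auto simp: flat_exp_def exp_minus field_simps power_inverse)
  ultimately show ?thesis
    by (rule Lim_transform_eventually)
qed

text \<open>The exponent \<open>m\<close> is carried along because it closes the family under
  differentiation: the derivative is again a combination of members, and smoothness becomes an
  induction over \<open>k\<close> with \<open>m\<close> arbitrary.\<close>

lemma flat_exp_has_derivative:
  "(flat_exp m has_real_derivative flat_exp (m + 2) x - real m * flat_exp (m + 1) x) (at x)"
proof -
  consider "x > 0" | "x < 0" | "x = 0" by linarith
  then show ?thesis
  proof cases
    case 1
    have "((\<lambda>x. exp (- (1 / x)) / x ^ m) has_real_derivative
        flat_exp (m + 2) x - real m * flat_exp (m + 1) x) (at x)"
      using 1
      apply (auto intro!: derivative_eq_intros simp: flat_exp_def)
      apply (cases m)
       apply (auto simp: field_simps power2_eq_square)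
      done
    moreover have "\<forall>\<^sub>F y in nhds x. flat_exp m y = exp (- (1 / y)) / y ^ m"
      using eventually_nhds_in_open[of "{0<..}" x] 1
      by (auto simp: flat_exp_def elim!: eventually_mono)
    ultimately show ?thesis
      by (subst DERIV_cong_ev[OF refl _ refl])
  next
    case 2
    have "\<forall>\<^sub>F y in nhds x. flat_exp m y = 0"
      using eventually_nhds_in_open[of "{..<0}" x] 2
      by (auto simp: flat_exp_def elim!: eventually_mono)
    then show ?thesis
      using 2 by (subst DERIV_cong_ev[OF refl _ refl, where g = "\<lambda>_. 0"]) (auto simp: flat_exp_def)
  next
    case 3
    \<comment> \<open>To the right of 0 the difference quotient is \<open>flat_exp (Suc m)\<close>
      itself.\<close>
    have "((\<lambda>h. (flat_exp m (0 + h) - flat_exp m 0) / h) \<longlongrightarrow> 0) (at_right 0)"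
      by (rule Lim_transform_eventually[OF flat_exp_tendsto_0[of "Suc m"]],
          rule eventually_at_rightI[of 0 1])
        (auto simp: flat_exp_def field_simps)
    moreover have "((\<lambda>h. (flat_exp m (0 + h) - flat_exp m 0) / h) \<longlongrightarrow> 0) (at_left 0)"
      by (rule tendsto_eventually, rule eventually_at_leftI[of "-1" 0])
        (auto simp: flat_exp_def)
    ultimately show ?thesis
      using 3 by (simp add: DERIV_def filterlim_at_split flat_exp_def)
  qed
qed

section \<open>Calculus of k times continuously differentiable functions on the plane\<close>

lemma Ck_SucI:
  assumes "\<And>z. (g has_derivative (\<lambda>v. gx z * fst v + gt z * snd v)) (at z)"
    and "Ck k gx" "Ck k gt"
  shows "Ck (Suc k) g"
  unfolding Ck.simps using assms by (intro exI[of _ gx] exI[of _ gt]) blast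

lemma Ck_add: "Ck k g \<Longrightarrow> Ck k h \<Longrightarrow> Ck k (\<lambda>z. g z + h z)"
proof (induction k arbitrary: g h)
  case 0
  then show ?case by (auto intro: continuous_on_add)
next
  case (Suc k)
  from Suc.prems obtain gx gt hx ht where
    g: "\<And>z. (g has_derivative (\<lambda>v. gx z * fst v + gt z * snd v)) (at z)" "Ck k gx" "Ck k gt" and
    h: "\<And>z. (h has_derivative (\<lambda>v. hx z * fst v + ht z * snd v)) (at z)" "Ck k hx" "Ck k ht"
    by auto
  have "((\<lambda>z. g z + h z) has_derivative
      (\<lambda>v. (gx z + hx z) * fst v + (gt z + ht z) * snd v)) (at z)" for z
    by (rule has_derivative_eq_rhs[OF has_derivative_add[OF g(1) h(1)]]) (auto simp: algebra_simps)
  then show ?case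
    using Suc.IH[OF g(2) h(2)] Suc.IH[OF g(3) h(3)] by (rule Ck_SucI)
qed

lemma Ck_const: "Ck k (\<lambda>z. c)"
proof (induction k arbitrary: c)
  case (Suc k)
  show ?case
    using Suc.IH[of 0] by (auto intro!: exI[of _ "\<lambda>z. 0"])
qed auto

lemma Ck_Suc_imp: "Ck (Suc k) g \<Longrightarrow> Ck k g"
proof (induction k arbitrary: g)
  case 0
  then show ?case
    by (auto intro!: continuous_at_imp_continuous_on dest: has_derivative_continuous)
next
  case (Suc k)
  from Suc.prems obtain gx gt where
    g: "\<And>z. (g has_derivative (\<lambda>v. gx z * fst v + gt z * snd v)) (at z)"
       "Ck (Suc k) gx" "Ck (Suc k) gt"
    by auto
  show ?case
    using g(1) Suc.IH[OF g(2)] Suc.IH[OF g(3)] by auto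
qed

text \<open>The partial derivatives of a product contain \<open>g\<close> and \<open>h\<close>
  themselves, so the induction also needs both factors at level \<open>k\<close>;
  \<open>Ck_Suc_imp\<close> lowers them.\<close>

lemma Ck_mult: "Ck k g \<Longrightarrow> Ck k h \<Longrightarrow> Ck k (\<lambda>z. g z * h z)"
proof (induction k arbitrary: g h)
  case 0
  then show ?case by (auto intro: continuous_on_mult)
next
  case (Suc k)
  from Suc.prems obtain gx gt hx ht where
    g: "\<And>z. (g has_derivative (\<lambda>v. gx z * fst v + gt z * snd v)) (at z)" "Ck k gx" "Ck k gt" and
    h: "\<And>z. (h has_derivative (\<lambda>v. hx z * fst v + ht z * snd v)) (at z)" "Ck k hx" "Ck k ht"
    by auto
  have gh: "Ck k g" "Ck k h" using Suc.prems by (blast dest: Ck_Suc_imp)+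
  have "((\<lambda>z. g z * h z) has_derivative
      (\<lambda>v. (g z * hx z + gx z * h z) * fst v + (g z * ht z + gt z * h z) * snd v)) (at z)" for z
    by (rule has_derivative_eq_rhs[OF has_derivative_mult[OF g(1) h(1)]]) (auto simp: algebra_simps)
  moreover have "Ck k (\<lambda>z. g z * hx z + gx z * h z)" "Ck k (\<lambda>z. g z * ht z + gt z * h z)"
    using g h gh Suc.IH by (auto intro!: Ck_add)
  ultimately show ?case by (rule Ck_SucI)
qed

lemma Ck_cmult: "Ck k g \<Longrightarrow> Ck k (\<lambda>z. c * g z)"
  using Ck_mult[OF Ck_const] .

text \<open>All test functions below are assembled from one-variable profiles with affine arguments,
  so this chain rule, which passes one derivative on to the profile, suffices.\<close>

lemma Ck_Suc_affine:
  assumes d: "\<And>y. (g has_real_derivative g' y) (at y)"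
    and "Ck k (\<lambda>z. g' (\<alpha> * fst z + \<beta> * snd z + \<gamma>))"
  shows "Ck (Suc k) (\<lambda>z. g (\<alpha> * fst z + \<beta> * snd z + \<gamma>))"
proof -
  have "((\<lambda>z. g (\<alpha> * fst z + \<beta> * snd z + \<gamma>)) has_derivative
     (\<lambda>v. (\<alpha> * g' (\<alpha> * fst z + \<beta> * snd z + \<gamma>)) * fst v
       + (\<beta> * g' (\<alpha> * fst z + \<beta> * snd z + \<gamma>)) * snd v)) (at z)" for z :: "real \<times> real"
  proof -
    have "((\<lambda>z. \<alpha> * fst z + \<beta> * snd z + \<gamma>) has_derivative (\<lambda>v. \<alpha> * fst v + \<beta> * snd v)) (at z)"
      by (auto intro!: derivative_eq_intros)
    from has_derivative_compose[OF this d[unfolded has_field_derivative_def]]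
    show ?thesis by (rule has_derivative_eq_rhs) (auto simp: algebra_simps)
  qed
  then show ?thesis
    by (rule Ck_SucI) (intro Ck_cmult assms(2))+
qed

lemma Ck_flat_exp: "Ck k (\<lambda>z. flat_exp m (\<alpha> * fst z + \<beta> * snd z + \<gamma>))"
proof (induction k arbitrary: m)
  case 0
  have "continuous_on UNIV (flat_exp m)"
    using flat_exp_has_derivative by (meson DERIV_isCont continuous_at_imp_continuous_on)
  then show ?case
    by (auto intro!: continuous_on_compose2[of UNIV "flat_exp m"] continuous_intros)
next
  case (Suc k)
  have "Ck k (\<lambda>z. flat_exp (m + 2) (\<alpha> * fst z + \<beta> * snd z + \<gamma>)
      + (- real m) * flat_exp (m + 1) (\<alpha> * fst z + \<beta> * snd z + \<gamma>))"
    by (intro Ck_add Ck_cmult Suc.IH)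
  then show ?case
    by (intro Ck_Suc_affine[OF flat_exp_has_derivative]) (simp add: algebra_simps)
qed

section \<open>A bump of integral one and its primitive\<close>

definition bump_mass :: real where
  "bump_mass = integral {0..1} (\<lambda>x. flat_exp 0 x * flat_exp 0 (1 - x))"

definition bump :: "real \<Rightarrow> real" where
  "bump x = flat_exp 0 x * flat_exp 0 (1 - x) / bump_mass"

definition step :: "real \<Rightarrow> real" where
  "step x = integral {0..x} bump"

lemma continuous_flat_exp [continuous_intros]: "continuous_on S g \<Longrightarrow> continuous_on S (\<lambda>x. flat_exp m (g x))"
proof -
  have "continuous_on UNIV (flat_exp m)"
    using flat_exp_has_derivative by (meson DERIV_isCont continuous_at_imp_continuous_on)
  then show "continuous_on S g \<Longrightarrow> continuous_on S (\<lambda>x. flat_exp m (g x))"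
    by (auto intro: continuous_on_compose2)
qed

lemma bump_mass_pos: "bump_mass > 0"
proof -
  let ?h = "\<lambda>x. flat_exp 0 x * flat_exp 0 (1 - x)"
  have cont: "continuous_on {0..1} ?h"
    by (intro continuous_intros)
  have int: "(?h has_integral bump_mass) {0..1}"
    unfolding bump_mass_def by (intro integrable_integral integrable_continuous_real cont)
  have nn: "?h x \<ge> 0" for x by (auto simp: flat_exp_def)
  have "bump_mass \<ge> 0"
    using int nn by (rule has_integral_nonneg)
  moreover have "bump_mass \<noteq> 0"
  proof
    assume "bump_mass = 0"
    with has_integral_0_cbox_imp_0[of 0 1 ?h "1/2"] int cont nn
    show False by (auto simp: flat_exp_def)
  qed
  ultimately show ?thesis by simp
qed

lemma continuous_bump [continuous_intros]: "continuous_on S g \<Longrightarrow> continuous_on S (\<lambda>x. bump (g x))"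
  unfolding bump_def using bump_mass_pos by (intro continuous_intros) auto

lemma bump_nonneg: "bump x \<ge> 0"
  using bump_mass_pos by (auto simp: bump_def flat_exp_def)

lemma bump_eq_0: "x \<le> 0 \<or> x \<ge> 1 \<Longrightarrow> bump x = 0"
  by (auto simp: bump_def flat_exp_def)

lemma bump_has_integral: "(bump has_integral 1) {0..1}"
proof -
  have "((\<lambda>x. flat_exp 0 x * flat_exp 0 (1 - x)) has_integral bump_mass) {0..1}"
    unfolding bump_mass_def by (intro integrable_integral integrable_continuous_real continuous_intros)
  from has_integral_divide[OF this, of bump_mass] show ?thesis
    using bump_mass_pos by (simp add: bump_def[abs_def])
qed

lemma bump_has_integral_UNIV: "(bump has_integral 1) UNIV"
  by (rule has_integral_on_superset[OF bump_has_integral]) (use bump_eq_0 in force)+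

lemma bump_integrable_on: "bump integrable_on {a..b}"
  by (intro integrable_continuous_real continuous_intros)

lemma step_eq_0: "x \<le> 0 \<Longrightarrow> step x = 0"
  unfolding step_def by (rule integral_unique) (use has_integral_null_real in \<open>cases "x = 0"; force\<close>)

lemma step_eq_1: assumes "x \<ge> 1" shows "step x = 1"
  unfolding step_def
  by (rule integral_unique, rule has_integral_on_superset[OF bump_has_integral])
    (use assms bump_eq_0 in force)+

lemma step_bounds: "0 \<le> step x" "step x \<le> 1"
proof -
  show "0 \<le> step x"
    unfolding step_def by (rule integral_nonneg) (auto simp: bump_integrable_on bump_nonneg)
  have "step x \<le> integral UNIV bump"
    unfolding step_def using bump_has_integral_UNIV
    by (intro integral_subset_le) (auto simp: bump_integrable_on bump_nonneg)
  then show "step x \<le> 1" using bump_has_integral_UNIV by (simp add: integral_unique)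
qed

lemma step_has_derivative: "(step has_real_derivative bump x) (at x)"
proof -
  \<comment> \<open>The base point moves to the left of both 0 and \<open>x\<close>, which makes
    \<open>x\<close> interior; the bump vanishes left of 0, so the integral keeps its value.\<close>
  define a b where "a = min 0 x - 1" and "b = x + 1"
  have eq: "step y = integral {a..y} bump" if "y \<in> {a<..<b}" for y
  proof (cases "y \<ge> 0")
    case True
    have "integral {a..0} bump + integral {0..y} bump = integral {a..y} bump"
      using True by (intro Henstock_Kurzweil_Integration.integral_combine bump_integrable_on) (auto simp: a_def)
    moreover have "integral {a..0} bump = 0"
      by (rule integral_unique, rule has_integral_is_0) (auto simp: bump_eq_0)
    ultimately show ?thesis by (simp add: step_def)
  next
    case False
    have "integral {a..y} bump = 0"
      by (rule integral_unique, rule has_integral_is_0) (use False in \<open>auto simp: bump_eq_0\<close>)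
    then show ?thesis using False by (simp add: step_eq_0)
  qed
  have "((\<lambda>y. integral {a..y} bump) has_vector_derivative bump x) (at x within {a..b})"
    by (rule integral_has_vector_derivative) (auto intro!: continuous_intros simp: a_def b_def)
  then have "((\<lambda>y. integral {a..y} bump) has_real_derivative bump x) (at x)"
    by (subst (asm) at_within_interior) (auto simp: has_real_derivative_iff_has_vector_derivative a_def b_def)
  moreover have "\<forall>\<^sub>F y in nhds x. step y = integral {a..y} bump"
    by (rule eventually_mono[OF eventually_nhds_in_open[of "{a<..<b}" x]])
      (auto simp: eq a_def b_def)
  ultimately show ?thesis
    by (subst DERIV_cong_ev[OF refl _ refl])
qed

lemma Ck_bump: "Ck k (\<lambda>z. bump (\<alpha> * fst z + \<beta> * snd z + \<gamma>))"
proof -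
  have "Ck k (\<lambda>z. (1 / bump_mass) * (flat_exp 0 (\<alpha> * fst z + \<beta> * snd z + \<gamma>)
      * flat_exp 0 ((-\<alpha>) * fst z + (-\<beta>) * snd z + (1 - \<gamma>))))"
    by (intro Ck_cmult Ck_mult Ck_flat_exp)
  then show ?thesis by (simp add: bump_def algebra_simps)
qed

lemma Ck_step: "Ck k (\<lambda>z. step (\<alpha> * fst z + \<beta> * snd z + \<gamma>))"
  using Ck_Suc_affine[OF step_has_derivative Ck_bump] by (blast dest: Ck_Suc_imp)

lemma continuous_step [continuous_intros]: "continuous_on S g \<Longrightarrow> continuous_on S (\<lambda>x. step (g x))"
proof -
  have "continuous_on UNIV step"
    using step_has_derivative by (meson DERIV_isCont continuous_at_imp_continuous_on)
  then show "continuous_on S g \<Longrightarrow> continuous_on S (\<lambda>x. step (g x))"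
    by (auto intro: continuous_on_compose2)
qed

text \<open>A one-sided approximate identity, with unit mass on \<open>{a..a+\<delta>}\<close>;
  \<open>step_at\<close> is its primitive, a smoothed jump at \<open>a\<close>.\<close>

definition bump_at :: "real \<Rightarrow> real \<Rightarrow> real \<Rightarrow> real" where
  "bump_at a \<delta> x = bump ((x - a) / \<delta>) / \<delta>"

definition step_at :: "real \<Rightarrow> real \<Rightarrow> real \<Rightarrow> real" where
  "step_at a \<delta> x = step ((x - a) / \<delta>)"

lemma bump_at_nonneg: "\<delta> > 0 \<Longrightarrow> bump_at a \<delta> x \<ge> 0"
  by (simp add: bump_at_def bump_nonneg)

lemma bump_at_eq_0: "\<delta> > 0 \<Longrightarrow> x \<notin> {a..a+\<delta>} \<Longrightarrow> bump_at a \<delta> x = 0"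
  by (auto simp: bump_at_def field_simps intro!: bump_eq_0)

lemma step_at_eq_0: "\<delta> > 0 \<Longrightarrow> x \<le> a \<Longrightarrow> step_at a \<delta> x = 0"
  by (auto simp: step_at_def intro!: step_eq_0 divide_nonpos_pos)

lemma step_at_eq_1: "\<delta> > 0 \<Longrightarrow> x \<ge> a + \<delta> \<Longrightarrow> step_at a \<delta> x = 1"
  by (auto simp: step_at_def field_simps intro!: step_eq_1)

lemma step_at_bounds: "0 \<le> step_at a \<delta> x" "step_at a \<delta> x \<le> 1"
  by (auto simp: step_at_def step_bounds)

lemma continuous_bump_at [continuous_intros]:
  "\<delta> > 0 \<Longrightarrow> continuous_on S g \<Longrightarrow> continuous_on S b \<Longrightarrow> continuous_on S (\<lambda>x. bump_at (b x) \<delta> (g x))"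
  unfolding bump_at_def by (intro continuous_intros) auto

lemma continuous_step_at [continuous_intros]:
  "\<delta> > 0 \<Longrightarrow> continuous_on S g \<Longrightarrow> continuous_on S b \<Longrightarrow> continuous_on S (\<lambda>x. step_at (b x) \<delta> (g x))"
  unfolding step_at_def by (intro continuous_intros) auto

lemma measurable_bump_at [measurable]: "\<delta> > 0 \<Longrightarrow> bump_at a \<delta> \<in> borel_measurable lebesgue"
  using continuous_bump_at[of \<delta> UNIV "\<lambda>x. x" "\<lambda>_. a"]
  by (auto intro!: measurable_completion borel_measurable_continuous_onI)

lemma measurable_step_at [measurable]: "\<delta> > 0 \<Longrightarrow> step_at a \<delta> \<in> borel_measurable lebesgue"
  using continuous_step_at[of \<delta> UNIV "\<lambda>x. x" "\<lambda>_. a"]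
  by (auto intro!: measurable_completion borel_measurable_continuous_onI)

lemma step_at_has_derivative: "\<delta> > 0 \<Longrightarrow> (step_at a \<delta> has_real_derivative bump_at a \<delta> x) (at x)"
proof -
  assume "\<delta> > 0"
  then have "((\<lambda>x. (x - a) / \<delta>) has_real_derivative 1 / \<delta>) (at x)"
    by (auto intro!: derivative_eq_intros)
  from DERIV_chain2[OF step_has_derivative this] show ?thesis
    by (simp add: step_at_def[abs_def] bump_at_def)
qed

text \<open>Seen as a statement about \<open>x\<close>, averaging the sharp edges
  \<open>indicator {y..} x\<close> over \<open>y\<close> gives the smooth edge
  \<open>step_at a \<delta> x\<close>. This is how bump averages of a primitive turn into integrals
  against smooth windows.\<close>

lemma has_bochner_integral_bump_at_Iic:
  assumes "\<delta> > 0"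
  shows "has_bochner_integral lborel (\<lambda>y. bump_at a \<delta> y * indicator {..x} y) (step_at a \<delta> x)"
proof (cases "x \<ge> a")
  case True
  have "continuous_on UNIV (bump_at a \<delta>)"
    using continuous_bump_at[of \<delta> UNIV "\<lambda>x. x" "\<lambda>_. a"] assms by auto
  then have "has_bochner_integral lborel (\<lambda>y. bump_at a \<delta> y * indicator {a..x} y)
      (step_at a \<delta> x - step_at a \<delta> a)"
    using True assms
    by (intro has_bochner_integral_FTC_Icc_real step_at_has_derivative)
      (auto simp: continuous_on_eq_continuous_at)
  moreover have "bump_at a \<delta> y * indicator {a..x} y = bump_at a \<delta> y * indicator {..x} y" for y
    using bump_at_eq_0[of \<delta> y a] assms by (auto simp: indicator_def)
  ultimately show ?thesis using assms by (simp add: step_at_eq_0)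
next
  case False
  then have "bump_at a \<delta> y * indicator {..x} y = 0" for y
    using bump_at_eq_0[of \<delta> y a] assms by (auto simp: indicator_def)
  with False assms show ?thesis
    by (simp only: step_at_eq_0 has_bochner_integral_zero less_imp_le not_le)
qed

lemma has_bochner_integral_bump_at:
  assumes "\<delta> > 0"
  shows "has_bochner_integral lborel (bump_at a \<delta>) 1"
proof -
  have "bump_at a \<delta> y * indicator {..a+\<delta>} y = bump_at a \<delta> y" for y
    using bump_at_eq_0[of \<delta> y a] assms by (auto simp: indicator_def)
  with has_bochner_integral_bump_at_Iic[OF assms, of a "a + \<delta>"] assms show ?thesis
    by (simp add: step_at_eq_1)
qed

lemma bump_bounded: "\<exists>B. \<forall>x. bump x \<le> B"
proof -
  have "compact (bump ` {0..1})"
    by (intro compact_continuous_image continuous_intros) auto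
  then have "bounded (bump ` {0..1})" by (rule compact_imp_bounded)
  then obtain B where B: "\<forall>x\<in>{0..1}. \<bar>bump x\<bar> \<le> B"
    by (auto simp: bounded_iff)
  from B[rule_format, of 0] have "B \<ge> 0" by (simp add: bump_eq_0)
  have "bump x \<le> B" for x
    using bump_eq_0[of x] B \<open>B \<ge> 0\<close> by (cases "x \<in> {0..1}") (auto simp: abs_le_iff)
  then show ?thesis by blast
qed

text \<open>The window has smooth edges at \<open>a + c t\<close> and at \<open>0\<close>; it tests the equation in a frame moving with
  speed \<open>c\<close> against the fixed reference edge.\<close>

definition moving_window :: "real \<Rightarrow> real \<Rightarrow> real \<Rightarrow> real \<Rightarrow> real \<Rightarrow> real" where
  "moving_window a \<delta> c x t = step_at (a + c * t) \<delta> x - step_at 0 1 x"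

text \<open>For positive times this is 1 up to \<tau> and descends to 0 during
  \<open>[\<tau>, \<tau> + \<epsilon>]\<close>. The second factor is 1 from time -1 on and 0 before
  time -2: it makes the support compact and leaves the half plane, including t = 0,
  unaffected.\<close>

definition cutoff :: "real \<Rightarrow> real \<Rightarrow> real \<Rightarrow> real" where
  "cutoff \<tau> \<epsilon> t = (1 - step_at \<tau> \<epsilon> t) * step (t + 2)"

lemma moving_window_eq_0:
  assumes "\<delta> > 0" "\<bar>a + c * t\<bar> + \<delta> + 1 \<le> R" "x \<notin> {-R..R}"
  shows "moving_window a \<delta> c x t = 0"
proof -
  consider "x \<le> min 0 (a + c * t)" | "x \<ge> max 1 (a + c * t + \<delta>)"
    using assms by (auto simp: abs_if split: if_splits)
  then show ?thesis
    using assms(1) by cases (auto simp: moving_window_def step_at_eq_0 step_at_eq_1)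
qed

lemma test_function_window:
  assumes "\<delta> > 0" "\<epsilon> > 0"
  shows "test_function (\<lambda>z. moving_window a \<delta> c (fst z) (snd z) * cutoff \<tau> \<epsilon> (snd z))"
proof -
  let ?\<phi> = "\<lambda>z. moving_window a \<delta> c (fst z) (snd z) * cutoff \<tau> \<epsilon> (snd z)"
  have "Ck k (\<lambda>z. (step ((1/\<delta>) * fst z + (-c/\<delta>) * snd z + (-a/\<delta>)) + (-1) * step (1 * fst z + 0 * snd z + 0))
     * ((1 + (-1) * step (0 * fst z + (1/\<epsilon>) * snd z + (-\<tau>/\<epsilon>))) * step (0 * fst z + 1 * snd z + 2)))" for k
    by (intro Ck_mult Ck_add Ck_cmult Ck_step Ck_const)
  moreover have "(\<lambda>z. (step ((1/\<delta>) * fst z + (-c/\<delta>) * snd z + (-a/\<delta>)) + (-1) * step (1 * fst z + 0 * snd z + 0))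
     * ((1 + (-1) * step (0 * fst z + (1/\<epsilon>) * snd z + (-\<tau>/\<epsilon>))) * step (0 * fst z + 1 * snd z + 2))) = ?\<phi>"
    using assms
    by (auto simp: fun_eq_iff moving_window_def cutoff_def step_at_def diff_divide_distrib add_divide_distrib algebra_simps)
  ultimately have "Ck k ?\<phi>" for k by simp
  moreover have "compact (closure {z. ?\<phi> z \<noteq> 0})"
  proof -
    \<comment> \<open>\<open>T\<close> covers the times from -2 to
      \<open>\<tau> + \<epsilon>\<close>, and \<open>R\<close> contains both edges of the window at
      all times of modulus at most \<open>T\<close>.\<close>
    define T where "T = \<bar>\<tau>\<bar> + \<epsilon> + 2"
    define R where "R = \<bar>a\<bar> + \<bar>c\<bar> * T + \<delta> + 1"
    have "z \<in> {-R..R} \<times> {-T..T}" if z: "?\<phi> z \<noteq> 0" for z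
    proof -
      have "cutoff \<tau> \<epsilon> (snd z) = 0" if "snd z \<notin> {-T..T}"
      proof -
        consider "snd z \<le> -2" | "snd z \<ge> \<tau> + \<epsilon>"
          using \<open>snd z \<notin> {-T..T}\<close> assms by (auto simp: T_def abs_if split: if_splits)
        then show ?thesis
          using assms by cases (auto simp: cutoff_def step_eq_0 step_at_eq_1)
      qed
      with z have t: "snd z \<in> {-T..T}" by auto
      then have "\<bar>c * snd z\<bar> \<le> \<bar>c\<bar> * T" by (auto simp: abs_mult intro!: mult_left_mono)
      then have "\<bar>a + c * snd z\<bar> + \<delta> + 1 \<le> R" by (simp add: R_def)
      with moving_window_eq_0[OF assms(1) this, of "fst z"] z t show ?thesis
        by (auto simp: mem_Times_iff)
    qed
    then have "{z. ?\<phi> z \<noteq> 0} \<subseteq> {-R..R} \<times> {-T..T}" by blast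
    moreover have "bounded ({-R..R} \<times> {-T..T})" by (intro bounded_Times) auto
    ultimately have "bounded {z. ?\<phi> z \<noteq> 0}" by (rule bounded_subset[rotated])
    then show ?thesis by (simp add: compact_closure)
  qed
  ultimately show ?thesis unfolding test_function_def by blast
qed

lemma dx_window:
  assumes "\<delta> > 0"
  shows "dx (\<lambda>z. moving_window a \<delta> c (fst z) (snd z) * cutoff \<tau> \<epsilon> (snd z)) (x, t)
    = (bump_at (a + c * t) \<delta> x - bump_at 0 1 x) * cutoff \<tau> \<epsilon> t"
proof -
  have "((\<lambda>x. moving_window a \<delta> c x t * cutoff \<tau> \<epsilon> t) has_real_derivative
     (bump_at (a + c * t) \<delta> x - bump_at 0 1 x) * cutoff \<tau> \<epsilon> t) (at x)"
    unfolding moving_window_def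
    by (rule DERIV_cmult_right DERIV_diff step_at_has_derivative assms zero_less_one)+
  then show ?thesis unfolding dx_def fst_conv snd_conv by (rule DERIV_imp_deriv)
qed

lemma dt_window:
  assumes "\<delta> > 0" "\<epsilon> > 0" "t > 0"
  shows "dt (\<lambda>z. moving_window a \<delta> c (fst z) (snd z) * cutoff \<tau> \<epsilon> (snd z)) (x, t)
    = - c * bump_at (a + c * t) \<delta> x * cutoff \<tau> \<epsilon> t - moving_window a \<delta> c x t * bump_at \<tau> \<epsilon> t"
proof -
  have eq: "moving_window a \<delta> c x t = step ((x - a - c * t) / \<delta>) - step_at 0 1 x" for t
    by (simp add: moving_window_def step_at_def algebra_simps)
  have "((\<lambda>t. (x - a - c * t) / \<delta>) has_real_derivative - c / \<delta>) (at t)"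
    using assms by (auto intro!: derivative_eq_intros)
  from DERIV_chain2[OF step_has_derivative this]
  have 1: "((\<lambda>t. moving_window a \<delta> c x t) has_real_derivative - c * bump_at (a + c * t) \<delta> x) (at t)"
    unfolding eq by (auto intro!: derivative_eq_intros simp: bump_at_def algebra_simps)
  \<comment> \<open>For positive \<open>t\<close> the argument lies beyond the support of the bump,
    so the lower cutoff contributes no derivative.\<close>
  have "((\<lambda>t. step (t + 2)) has_real_derivative bump (t + 2) * 1) (at t)"
    by (rule DERIV_chain2[OF step_has_derivative]) (auto intro!: derivative_eq_intros)
  then have "((\<lambda>t. step (t + 2)) has_real_derivative 0) (at t)"
    using assms by (simp add: bump_eq_0)
  then have 2: "((\<lambda>t. cutoff \<tau> \<epsilon> t) has_real_derivative - bump_at \<tau> \<epsilon> t) (at t)"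
    unfolding cutoff_def using assms
    by (auto intro!: derivative_eq_intros step_at_has_derivative simp: step_eq_1)
  show ?thesis
    unfolding dt_def fst_conv snd_conv
    by (rule DERIV_imp_deriv, rule DERIV_cong[OF DERIV_mult[OF 1 2]]) (simp add: algebra_simps)
qed

section \<open>Lebesgue integration\<close>

lemma integrable_lebesgue_bounded_support:
  fixes h :: "'a::euclidean_space \<Rightarrow> real"
  assumes [measurable]: "h \<in> borel_measurable lebesgue"
    and "AE x in lebesgue. \<bar>h x\<bar> \<le> B" and S: "compact S" and "\<And>x. x \<notin> S \<Longrightarrow> h x = 0"
  shows "integrable lebesgue h"
proof -
  have "S \<in> sets lborel" using S by (simp add: borel_compact)
  then have "integrable lebesgue (\<lambda>x. indicator S x * B)"
    using emeasure_bounded_finite[OF compact_imp_bounded[OF S]]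
    by (intro integrable_mult_left integrable_real_indicator) auto
  then show ?thesis
    by (rule Bochner_Integration.integrable_bound)
      (use assms in \<open>auto simp: indicator_def elim!: eventually_mono\<close>)
qed

lemma AE_interval_ex:
  fixes a b :: real
  assumes "AE x in lborel. P x" "a < b"
  shows "\<exists>x\<in>{a<..<b}. P x"
proof (rule ccontr)
  assume "\<not> ?thesis"
  then have "AE x in lborel. x \<notin> {a<..<b}"
    using assms(1) by (auto elim!: eventually_mono)
  then have "emeasure lborel {a<..<b} = 0"
    by (subst (asm) AE_iff_measurable[OF _ refl]) (auto simp: greaterThanLessThan_def greaterThan_def lessThan_def Int_def)
  with assms(2) show False by simp
qed

text \<open>Tonelli applied to a Borel null set that covers the exceptional points; the second
  coordinate is the one frozen because it plays the role of time.\<close>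

lemma AE_pair_snd:
  assumes "AE z in (lborel :: (real \<times> real) measure). P z"
  shows "AE t in lborel. AE x in lborel. P (x, t)"
proof -
  obtain N where N: "N \<in> null_sets (lborel :: (real \<times> real) measure)" "{z. \<not> P z} \<subseteq> N"
    using assms by (auto simp: eventually_ae_filter)
  then have [measurable]: "N \<in> sets (lborel \<Otimes>\<^sub>M lborel)"
    unfolding lborel_prod by auto
  have "(\<integral>\<^sup>+ t. \<integral>\<^sup>+ x. indicator N (x, t) \<partial>lborel \<partial>lborel) = 0"
    using N(1) by (subst lborel_pair.nn_integral_snd) (auto simp: lborel_prod null_sets_def)
  then have "AE t in lborel. (\<integral>\<^sup>+ x. indicator N (x, t) \<partial>lborel) = 0"
    by (subst (asm) nn_integral_0_iff_AE) auto
  then show ?thesis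
  proof eventually_elim
    case (elim t)
    then have "AE x in lborel. indicator N (x, t) = (0::ennreal)"
      by (subst (asm) nn_integral_0_iff_AE) auto
    then show ?case
      by (rule eventually_mono) (use N(2) in \<open>auto simp: indicator_def split: if_splits\<close>)
  qed
qed

text \<open>Lebesgue measure on the plane is the completion of a product rather than a product, so
  Fubini is applied to a Borel representative \<open>g'\<close> and the result is carried back along
  almost every slice.\<close>

lemma integral_lebesgue_iterated:
  fixes g :: "real \<times> real \<Rightarrow> real"
  assumes g: "integrable lebesgue g"
    and slice: "\<And>t. (\<lambda>x. g (x, t)) \<in> borel_measurable lebesgue"
    and outer: "(\<lambda>t. LINT x|lebesgue. g (x, t)) \<in> borel_measurable lebesgue"
  shows "(LINT z|lebesgue. g z) = (LINT t|lebesgue. LINT x|lebesgue. g (x, t))"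
proof -
  from g have gm: "g \<in> borel_measurable lebesgue" by simp
  from completion_ex_borel_measurable_real[OF this]
  obtain g' where g'[measurable]: "g' \<in> borel_measurable lborel" and ae: "AE z in lborel. g z = g' z"
    by auto
  have g'l: "g' \<in> borel_measurable lebesgue" by (rule measurable_completion[OF g'])
  have "integrable lebesgue g'"
    using g gm g'l ae by (subst integrable_cong_AE[of g' lebesgue g])
      (auto dest!: AE_completion elim!: eventually_mono)
  then have int: "integrable (lborel \<Otimes>\<^sub>M lborel) (case_prod (\<lambda>x t. g' (x, t)))"
    using g' by (simp add: integrable_completion lborel_prod)
  have "(LINT z|lebesgue. g z) = (LINT z|lebesgue. g' z)"
    using AE_completion[OF ae] by (intro integral_cong_AE gm g'l)
  also have "\<dots> = (LINT z|lborel. g' z)" by (simp add: integral_completion)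
  also have "\<dots> = (LINT t|lborel. LINT x|lborel. g' (x, t))"
    using lborel_pair.integral_snd[OF int] by (simp add: lborel_prod)
  also have "\<dots> = (LINT t|lebesgue. LINT x|lborel. g' (x, t))"
    by (subst integral_completion) auto
  also have "\<dots> = (LINT t|lebesgue. LINT x|lebesgue. g (x, t))"
  proof (rule integral_cong_AE)
    have m: "(\<lambda>t. LINT x|lborel. g' (x, t)) \<in> borel_measurable lborel" by measurable
    then show "(\<lambda>t. LINT x|lborel. g' (x, t)) \<in> borel_measurable lebesgue"
      by (rule measurable_completion)
    show "AE t in lebesgue. (LINT x|lborel. g' (x, t)) = (LINT x|lebesgue. g (x, t))"
    proof (rule AE_completion, use AE_pair_snd[OF ae] in eventually_elim)
      case (elim t)
      have "(\<lambda>x. g' (x, t)) \<in> borel_measurable lborel" by measurable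
      then have "(LINT x|lborel. g' (x, t)) = (LINT x|lebesgue. g' (x, t))"
        by (simp add: integral_completion)
      also have "\<dots> = (LINT x|lebesgue. g (x, t))"
        using AE_completion[OF elim] \<open>(\<lambda>x. g' (x, t)) \<in> borel_measurable lborel\<close>
        by (intro integral_cong_AE slice measurable_completion) (auto elim!: eventually_mono)
      finally show ?case .
    qed
  qed (rule outer)
  finally show ?thesis .
qed

lemma integral_lebesgue_translate:
  fixes h :: "real \<Rightarrow> real"
  assumes [measurable]: "h \<in> borel_measurable lebesgue"
  shows "(\<lambda>x. h (x + p)) \<in> borel_measurable lebesgue"
    and "(LINT x|lebesgue. h (x + p)) = (LINT x|lebesgue. h x)"
    and "AE x in lebesgue. P x \<Longrightarrow> AE x in lebesgue. P (x + p)"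
proof -
  have T[measurable]: "(\<lambda>x. p + x) \<in> lebesgue \<rightarrow>\<^sub>M (lebesgue :: real measure)"
    using lebesgue_affine_measurable[of "\<lambda>_. 1" p] by simp
  have eq: "distr lebesgue lebesgue (\<lambda>x. p + x) = (lebesgue :: real measure)"
    using lebesgue_real_affine[of 1 p] by (simp add: density_1)
  show "(\<lambda>x. h (x + p)) \<in> borel_measurable lebesgue"
    by (subst add.commute) measurable
  have "(LINT x|lebesgue. h x) = (LINT x|distr lebesgue lebesgue (\<lambda>x. p + x). h x)"
    by (simp add: eq)
  also have "\<dots> = (LINT x|lebesgue. h (x + p))"
    by (subst integral_distr) (auto simp: add.commute)
  finally show "(LINT x|lebesgue. h (x + p)) = (LINT x|lebesgue. h x)" ..
  show "AE x in lebesgue. P (x + p)" if "AE x in lebesgue. P x"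
    using AE_distrD[OF T, unfolded eq, OF that] by (simp add: add.commute)
qed

text \<open>A substitute for the value of \<open>h\<close> at \<open>b\<close>, which a function
  known almost everywhere does not have. Bounds that hold almost everywhere on
  \<open>{b..b+\<delta>}\<close> pass to it.\<close>

definition bump_avg :: "real \<Rightarrow> real \<Rightarrow> (real \<Rightarrow> real) \<Rightarrow> real" where
  "bump_avg b \<delta> h = (LINT x|lebesgue. bump_at b \<delta> x * h x)"

lemma integrable_bump_at_mult:
  assumes \<delta>: "\<delta> > 0" and [measurable]: "h \<in> borel_measurable lebesgue"
    and h: "AE x in lebesgue. x \<in> {b..b+\<delta>} \<longrightarrow> \<bar>h x\<bar> \<le> B"
  shows "integrable lebesgue (\<lambda>x. bump_at b \<delta> x * h x)"
proof -
  have [measurable]: "bump_at b \<delta> \<in> borel_measurable lebesgue" using \<delta> by simp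
  obtain C where C: "\<And>x. bump x \<le> C" using bump_bounded by blast
  have "AE x in lebesgue. \<bar>bump_at b \<delta> x * h x\<bar> \<le> C / \<delta> * \<bar>B\<bar>"
    using h
  proof eventually_elim
    case (elim x)
    show ?case
    proof (cases "x \<in> {b..b+\<delta>}")
      case True
      have "\<bar>bump_at b \<delta> x\<bar> \<le> C / \<delta>"
        using C \<delta> bump_nonneg by (simp add: bump_at_def divide_right_mono)
      then show ?thesis using elim True unfolding abs_mult by (intro mult_mono) auto
    next
      case False
      moreover have "C \<ge> 0" using C[of 0] by (simp add: bump_eq_0)
      ultimately show ?thesis using \<delta> by (simp add: bump_at_eq_0)
    qed
  qed
  then show ?thesis
    by (rule integrable_lebesgue_bounded_support[where S = "{b..b+\<delta>}", rotated])
      (use \<delta> in \<open>auto simp: bump_at_eq_0\<close>)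
qed

lemma bump_avg_const:
  assumes "\<delta> > 0" shows "bump_avg b \<delta> (\<lambda>x. v) = v"
proof -
  have "(LINT x|lebesgue. bump_at b \<delta> x) = (LINT x|lborel. bump_at b \<delta> x)"
    using has_bochner_integral_bump_at[OF assms, of b]
    by (intro integral_completion) (auto simp: has_bochner_integral_iff)
  then show ?thesis
    using has_bochner_integral_bump_at[OF assms, of b]
    by (simp add: bump_avg_def has_bochner_integral_iff)
qed

lemma bump_avg_mono:
  assumes \<delta>: "\<delta> > 0" and [measurable]: "g \<in> borel_measurable lebesgue" "h \<in> borel_measurable lebesgue"
    and "AE x in lebesgue. x \<in> {b..b+\<delta>} \<longrightarrow> \<bar>g x\<bar> \<le> B" "AE x in lebesgue. x \<in> {b..b+\<delta>} \<longrightarrow> \<bar>h x\<bar> \<le> B"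
    and le: "AE x in lebesgue. x \<in> {b..b+\<delta>} \<longrightarrow> g x \<le> h x"
  shows "bump_avg b \<delta> g \<le> bump_avg b \<delta> h"
  unfolding bump_avg_def
proof (rule integral_mono_AE)
  show "AE x in lebesgue. bump_at b \<delta> x * g x \<le> bump_at b \<delta> x * h x"
    using le
  proof eventually_elim
    case (elim x)
    then show ?case
      using bump_at_eq_0[OF \<delta>, of x b] bump_at_nonneg[OF \<delta>, of b x]
      by (cases "x \<in> {b..b+\<delta>}") (auto intro!: mult_left_mono)
  qed
qed (use assms in \<open>auto intro!: integrable_bump_at_mult\<close>)

lemma bump_avg_bounds:
  assumes \<delta>: "\<delta> > 0" and [measurable]: "h \<in> borel_measurable lebesgue"
    and h: "AE x in lebesgue. x \<in> {b..b+\<delta>} \<longrightarrow> lo \<le> h x \<and> h x \<le> hi"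
  shows "lo \<le> bump_avg b \<delta> h" "bump_avg b \<delta> h \<le> hi"
proof -
  let ?B = "\<bar>lo\<bar> + \<bar>hi\<bar>"
  have B: "AE x in lebesgue. x \<in> {b..b+\<delta>} \<longrightarrow> \<bar>h x\<bar> \<le> ?B"
    using h by eventually_elim auto
  have "bump_avg b \<delta> (\<lambda>_. lo) \<le> bump_avg b \<delta> h"
    by (rule bump_avg_mono[OF \<delta> _ _ _ B]) (use h in \<open>auto elim!: eventually_mono\<close>)
  then show "lo \<le> bump_avg b \<delta> h" by (simp add: bump_avg_const \<delta>)
  have "bump_avg b \<delta> h \<le> bump_avg b \<delta> (\<lambda>_. hi)"
    by (rule bump_avg_mono[OF \<delta> _ _ B]) (use h in \<open>auto elim!: eventually_mono\<close>)
  then show "bump_avg b \<delta> h \<le> hi" by (simp add: bump_avg_const \<delta>)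
qed

section \<open>Bounded weak solutions\<close>

text \<open>Collects what the construction of the potential uses. \<open>M\<close> bounds the
  solution and the data, and \<open>K\<close> is a Lipschitz constant of the flux on that range. The
  one-sided condition enters later as an explicit premise, convexity in the final theorem.\<close>

locale bounded_weak_solution =
  fixes f u0 :: "real \<Rightarrow> real" and u :: "real \<Rightarrow> real \<Rightarrow> real" and M K :: real
  assumes f_cont: "continuous_on UNIV f"
    and f_lip: "\<And>v w. \<bar>v\<bar> \<le> M \<Longrightarrow> \<bar>w\<bar> \<le> M \<Longrightarrow> \<bar>f v - f w\<bar> \<le> K * \<bar>v - w\<bar>"
    and M_pos: "M > 0" and K_pos: "K > 0"
    and u_meas: "(\<lambda>z. u (fst z) (snd z)) \<in> borel_measurable (lebesgue_on half_plane)"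
    and u_bdd: "AE z in lebesgue_on half_plane. \<bar>u (fst z) (snd z)\<bar> \<le> M"
    and u0_meas [measurable]: "u0 \<in> borel_measurable lebesgue"
    and u0_bdd: "AE x in lebesgue. \<bar>u0 x\<bar> \<le> M"
    and u_time: "time_continuous u"
    and u_weak: "weak_solution f u0 u"
begin

text \<open>Joint measurability would give this for almost every time only. Local integrability, a
  part of \<open>time_continuous\<close>, gives it for every time, as a limit of truncations to
  growing intervals.\<close>

lemma slice_measurable [measurable]:
  assumes "t > 0" shows "(\<lambda>x. u x t) \<in> borel_measurable lebesgue"
proof (rule borel_measurable_LIMSEQ_real)
  show "(\<lambda>x. indicator {-real n..real n} x * u x t) \<in> borel_measurable lebesgue" for n
    using u_time assms unfolding time_continuous_def set_integrable_def by auto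
  show "(\<lambda>n. indicator {-real n..real n} x * u x t) \<longlonglongrightarrow> u x t" for x
  proof (rule tendsto_eventually)
    obtain N where "real N \<ge> \<bar>x\<bar>" using real_arch_simple by blast
    then have "\<forall>n\<ge>N. indicator {-real n..real n} x * u x t = u x t"
      by (auto simp: indicator_def abs_le_iff intro: order_trans)
    then show "\<forall>\<^sub>F n in sequentially. indicator {-real n..real n} x * u x t = u x t"
      unfolding eventually_sequentially by blast
  qed
qed

lemma f_slice_measurable [measurable]:
  assumes "t > 0" shows "(\<lambda>x. f (u x t)) \<in> borel_measurable lebesgue"
  using measurable_compose[OF slice_measurable[OF assms] borel_measurable_continuous_onI[OF f_cont]] .

lemma slice_bounded_AE_time: "AE t in lborel. t > 0 \<longrightarrow> (AE x in lebesgue. \<bar>u x t\<bar> \<le> M)"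
proof -
  have "half_plane \<in> sets (lebesgue :: (real \<times> real) measure)"
    by (intro sets_completionI_sets) (simp add: borel_Times)
  then have "AE z in lebesgue. z \<in> half_plane \<longrightarrow> \<bar>u (fst z) (snd z)\<bar> \<le> M"
    using u_bdd by (subst (asm) AE_restrict_space_iff) (auto elim!: eventually_mono)
  then have "AE z in lborel. z \<in> half_plane \<longrightarrow> \<bar>u (fst z) (snd z)\<bar> \<le> M"
    by (simp only: AE_completion_iff)
  from AE_pair_snd[OF this] show ?thesis
    by eventually_elim (auto simp: AE_completion_iff)
qed

lemma slice_difference_tendsto:
  assumes "t > 0"
  shows "((\<lambda>s. LINT x:{-R..R}|lebesgue. \<bar>u x s - u x t\<bar>) \<longlongrightarrow> 0) (at t)"
  using u_time assms unfolding time_continuous_def by blast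

lemma slice_integrable:
  assumes "t > 0" shows "set_integrable lebesgue {-R..R} (\<lambda>x. u x t)"
  using u_time assms unfolding time_continuous_def by blast

text \<open>The bound is known at almost every time and passes to every time by continuity in
  \<open>L^1\<close>: if \<open>s\<close> is a good time, the excess of
  \<open>\<bar>u x t\<bar>\<close> over \<open>M\<close> is at most
  \<open>\<bar>u x s - u x t\<bar>\<close>, whose integral is small for \<open>s\<close> near
  \<open>t\<close>.\<close>

lemma slice_bounded:
  assumes t: "t > 0" shows "AE x in lebesgue. \<bar>u x t\<bar> \<le> M"
proof -
  have *: "AE x in lebesgue. x \<in> {-R..R} \<longrightarrow> \<bar>u x t\<bar> \<le> M" for R
  proof -
    define e where "e x = indicator {-R..R} x * max 0 (\<bar>u x t\<bar> - M)" for x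
    have e_int: "integrable lebesgue e"
    proof (rule Bochner_Integration.integrable_bound)
      show "integrable lebesgue (\<lambda>x. indicator {-R..R} x * u x t)"
        using slice_integrable[OF t] by (simp add: set_integrable_def)
      have "(\<lambda>x. max 0 (\<bar>u x t\<bar> - M)) \<in> borel_measurable lebesgue"
        using slice_measurable[OF t] by (intro borel_measurable_max) auto
      then show "e \<in> borel_measurable lebesgue"
        unfolding e_def by (intro borel_measurable_times borel_measurable_indicator) auto
      show "AE x in lebesgue. norm (e x) \<le> norm (indicator {-R..R} x * u x t)"
        using M_pos by (auto simp: e_def indicator_def)
    qed
    have "(LINT x|lebesgue. e x) \<le> \<epsilon>" if "\<epsilon> > 0" for \<epsilon>
    proof -
      have "\<forall>\<^sub>F s in at t. (LINT x:{-R..R}|lebesgue. \<bar>u x s - u x t\<bar>) < \<epsilon>"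
        by (rule order_tendstoD(2)[OF slice_difference_tendsto[OF t] that])
      then obtain d where d: "d > 0"
        "\<And>s. s \<noteq> t \<Longrightarrow> dist s t < d \<Longrightarrow> (LINT x:{-R..R}|lebesgue. \<bar>u x s - u x t\<bar>) < \<epsilon>"
        by (auto simp: eventually_at)
      \<comment> \<open>A good time within the distance \<open>d\<close>: the bad times are null, so
        they cannot fill an interval.\<close>
      obtain s where s: "s \<in> {t<..<t+d}" "s > 0 \<longrightarrow> (AE x in lebesgue. \<bar>u x s\<bar> \<le> M)"
        using AE_interval_ex[OF slice_bounded_AE_time, of t "t + d"] d(1) by auto
      have s0: "s > 0" using s t by auto
      have "(LINT x|lebesgue. e x) \<le> (LINT x:{-R..R}|lebesgue. \<bar>u x s - u x t\<bar>)"
        unfolding set_lebesgue_integral_def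
      proof (rule integral_mono_AE[OF e_int])
        show "integrable lebesgue (\<lambda>x. indicator {-R..R} x *\<^sub>R \<bar>u x s - u x t\<bar>)"
          using set_integrable_abs[OF set_integral_diff(1)[OF slice_integrable[OF s0] slice_integrable[OF t]]]
          by (simp add: set_integrable_def)
        show "AE x in lebesgue. e x \<le> indicator {-R..R} x *\<^sub>R \<bar>u x s - u x t\<bar>"
          using s(2)[rule_format, OF s0] by eventually_elim (auto simp: e_def indicator_def)
      qed
      also have "\<dots> \<le> \<epsilon>" using d(2)[of s] s(1) by (auto simp: dist_real_def)
      finally show ?thesis .
    qed
    then have "(LINT x|lebesgue. e x) \<le> 0" by (rule field_le_epsilon[of _ 0, simplified])
    moreover have "(LINT x|lebesgue. e x) \<ge> 0" by (intro integral_nonneg_AE) (auto simp: e_def)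
    ultimately have "(LINT x|lebesgue. e x) = 0" by simp
    moreover have "AE x in lebesgue. 0 \<le> e x" by (simp add: e_def)
    ultimately have "AE x in lebesgue. e x = 0"
      using integral_nonneg_eq_0_iff_AE[OF e_int] by blast
    then show ?thesis by eventually_elim (auto simp: e_def indicator_def max_def split: if_splits)
  qed
  have "AE x in lebesgue. \<forall>n. x \<in> {-real n..real n} \<longrightarrow> \<bar>u x t\<bar> \<le> M"
    using * by (subst AE_all_countable) blast
  then show ?thesis
  proof eventually_elim
    case (elim x)
    obtain n where "real n \<ge> \<bar>x\<bar>" using real_arch_simple by blast
    with elim show ?case by (auto simp: abs_le_iff)
  qed
qed

text \<open>The difference of two integrands splits into \<open>G (u x s) * (h x s - h x t)\<close>,
  controlled by the continuity of the weight, and \<open>h x t * (G (u x s) - G (u x t))\<close>,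
  controlled by the Lipschitz bound and the \<open>L^1\<close> continuity of the slices. The weight
  may depend on time because the edges of the windows move.\<close>

lemma slice_integral_continuous:
  fixes h :: "real \<Rightarrow> real \<Rightarrow> real"
  assumes t: "t > 0" and h: "continuous_on UNIV (\<lambda>z. h (fst z) (snd z))"
    and supp: "\<And>x s. \<bar>s - t\<bar> \<le> 1 \<Longrightarrow> x \<notin> {-R..R} \<Longrightarrow> h x s = 0"
    and G: "continuous_on UNIV G" "\<And>v w. \<bar>v\<bar> \<le> M \<Longrightarrow> \<bar>w\<bar> \<le> M \<Longrightarrow> \<bar>G v - G w\<bar> \<le> L * \<bar>v - w\<bar>"
  shows "isCont (\<lambda>s. LINT x|lebesgue. h x s * G (u x s)) t"
proof -
  have "compact ((\<lambda>z. h (fst z) (snd z)) ` ({-R..R} \<times> {t-1..t+1}))"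
    by (intro compact_continuous_image compact_Times continuous_on_subset[OF h]) auto
  then have "bounded ((\<lambda>z. h (fst z) (snd z)) ` ({-R..R} \<times> {t-1..t+1}))" by (rule compact_imp_bounded)
  then obtain H where H: "\<And>x s. x \<in> {-R..R} \<Longrightarrow> s \<in> {t-1..t+1} \<Longrightarrow> \<bar>h x s\<bar> \<le> H"
    by (fastforce simp: bounded_iff)
  have "bounded (G ` {-M..M})"
    by (intro compact_imp_bounded compact_continuous_image continuous_on_subset[OF G(1)]) auto
  then obtain B where B: "\<And>v. \<bar>v\<bar> \<le> M \<Longrightarrow> \<bar>G v\<bar> \<le> B"
    by (force simp: bounded_iff abs_le_iff)
  have B0: "B \<ge> 0" using B[of 0] M_pos by auto
  have hs: "continuous_on S (\<lambda>x. h x s)" for s S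
  proof -
    have "continuous_on S (\<lambda>x. (x, s))" by (intro continuous_intros)
    from continuous_on_compose2[OF h this] show ?thesis by simp
  qed
  have [measurable]: "(\<lambda>x. h x s) \<in> borel_measurable lebesgue" for s
    using hs by (intro measurable_completion) (auto intro!: borel_measurable_continuous_onI)
  have Gm: "(\<lambda>x. G (u x s)) \<in> borel_measurable lebesgue" if "s > 0" for s
    using measurable_compose[OF slice_measurable[OF that] borel_measurable_continuous_onI[OF G(1)]] .
  define D where "D s = (LINT x:{-R..R}|lebesgue. \<bar>u x s - u x t\<bar>)" for s
  define d where "d s = integral {-R..R} (\<lambda>x. \<bar>h x s - h x t\<bar>)" for s
  have int: "integrable lebesgue (\<lambda>x. h x s * G (u x s'))" if "\<bar>s - t\<bar> \<le> 1" "s' > 0" for s s'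
  proof (rule integrable_lebesgue_bounded_support[where S = "{-R..R}" and B = "\<bar>H\<bar> * B"])
    show "AE x in lebesgue. \<bar>h x s * G (u x s')\<bar> \<le> \<bar>H\<bar> * B"
      using slice_bounded[OF that(2)]
    proof eventually_elim
      case (elim x)
      show ?case
      proof (cases "x \<in> {-R..R}")
        case True
        moreover have "s \<in> {t-1..t+1}" using that(1) by (auto simp: abs_if split: if_splits)
          ultimately have "\<bar>h x s\<bar> \<le> \<bar>H\<bar>" using H[of x s] by linarith
        then show ?thesis using B[OF elim] by (auto simp: abs_mult intro!: mult_mono)
      qed (use supp that B0 in auto)
    qed
  qed (use supp that Gm in auto)
  have dint: "set_integrable lebesgue {-R..R} (\<lambda>x. \<bar>h x s - h x t\<bar>)" for s
    by (rule set_integrable_subset[OF absolutely_integrable_continuous_real[of "-R" R]])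
      (auto intro!: continuous_intros hs)
  have "\<forall>\<^sub>F s in at t. s \<in> {max 0 (t-1)<..<t+1}"
    using t by (intro eventually_at_in_open' open_greaterThanLessThan) auto
  then have bound: "\<forall>\<^sub>F s in at t. norm ((LINT x|lebesgue. h x s * G (u x s)) - (LINT x|lebesgue. h x t * G (u x t)))
     \<le> B * d s + \<bar>H\<bar> * \<bar>L\<bar> * D s"
  proof eventually_elim
    case (elim s)
    then have s: "s > 0" "\<bar>s - t\<bar> \<le> 1" by auto
    have Dint: "set_integrable lebesgue {-R..R} (\<lambda>x. \<bar>u x s - u x t\<bar>)"
      by (intro set_integrable_abs set_integral_diff slice_integrable s t)
    have "norm ((LINT x|lebesgue. h x s * G (u x s)) - (LINT x|lebesgue. h x t * G (u x t)))
      = norm (LINT x|lebesgue. h x s * G (u x s) - h x t * G (u x t))"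
      using int[OF s(2) s(1)] int[of t t] t by simp
    also have "\<dots> \<le> (LINT x|lebesgue. B * (indicator {-R..R} x *\<^sub>R \<bar>h x s - h x t\<bar>)
        + \<bar>H\<bar> * \<bar>L\<bar> * (indicator {-R..R} x *\<^sub>R \<bar>u x s - u x t\<bar>))"
    proof (rule order_trans[OF integral_norm_bound integral_mono_AE])
      show "integrable lebesgue (\<lambda>x. norm (h x s * G (u x s) - h x t * G (u x t)))"
        using int[OF s(2) s(1)] int[of t t] t by simp
      show "integrable lebesgue (\<lambda>x. B * (indicator {-R..R} x *\<^sub>R \<bar>h x s - h x t\<bar>)
        + \<bar>H\<bar> * \<bar>L\<bar> * (indicator {-R..R} x *\<^sub>R \<bar>u x s - u x t\<bar>))"
        using dint Dint unfolding set_integrable_def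
        by (intro Bochner_Integration.integrable_add integrable_mult_right)
      show "AE x in lebesgue. norm (h x s * G (u x s) - h x t * G (u x t))
         \<le> B * (indicator {-R..R} x *\<^sub>R \<bar>h x s - h x t\<bar>)
        + \<bar>H\<bar> * \<bar>L\<bar> * (indicator {-R..R} x *\<^sub>R \<bar>u x s - u x t\<bar>)"
        using slice_bounded[OF s(1)] slice_bounded[OF t]
      proof eventually_elim
        case (elim x)
        show ?case
        proof (cases "x \<in> {-R..R}")
          case True
          have "\<bar>h x s * G (u x s) - h x t * G (u x t)\<bar>
            = \<bar>G (u x s) * (h x s - h x t) + h x t * (G (u x s) - G (u x t))\<bar>"
            by (simp add: algebra_simps)
          also have "\<dots> \<le> \<bar>G (u x s)\<bar> * \<bar>h x s - h x t\<bar> + \<bar>h x t\<bar> * \<bar>G (u x s) - G (u x t)\<bar>"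
            by (metis abs_mult abs_triangle_ineq)
          also have "\<dots> \<le> B * \<bar>h x s - h x t\<bar> + \<bar>H\<bar> * (\<bar>L\<bar> * \<bar>u x s - u x t\<bar>)"
          proof (intro add_mono mult_mono)
            show "\<bar>h x t\<bar> \<le> \<bar>H\<bar>" using H[OF True, of t] by auto
            have "L * \<bar>u x s - u x t\<bar> \<le> \<bar>L\<bar> * \<bar>u x s - u x t\<bar>" by (intro mult_right_mono) auto
            then show "\<bar>G (u x s) - G (u x t)\<bar> \<le> \<bar>L\<bar> * \<bar>u x s - u x t\<bar>"
              using G(2)[OF elim] by linarith
          qed (use B elim B0 in auto)
          finally show ?thesis using True by simp
        qed (use supp s in auto)
      qed
    qed
    also have "\<dots> = B * (LINT x:{-R..R}|lebesgue. \<bar>h x s - h x t\<bar>) + \<bar>H\<bar> * \<bar>L\<bar> * D s"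
      using dint[of s] Dint unfolding set_integrable_def D_def set_lebesgue_integral_def
      by (subst Bochner_Integration.integral_add) auto
    also have "(LINT x:{-R..R}|lebesgue. \<bar>h x s - h x t\<bar>) = d s"
      unfolding d_def by (rule set_lebesgue_integral_eq_integral(2)[OF dint])
    finally show ?case .
  qed
  have "((\<lambda>s. B * d s + \<bar>H\<bar> * \<bar>L\<bar> * D s) \<longlongrightarrow> B * 0 + \<bar>H\<bar> * \<bar>L\<bar> * 0) (at t)"
  proof (intro tendsto_intros)
    show "(D \<longlongrightarrow> 0) (at t)" unfolding D_def by (rule slice_difference_tendsto[OF t])
    have swap: "continuous_on A (\<lambda>z. (snd z, fst z))" for A :: "(real \<times> real) set"
      by (intro continuous_intros)
    \<comment> \<open>The change of the weight is a parameter integral of a continuous function over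
      a compact interval.\<close>
    have "continuous_on UNIV (\<lambda>s. integral (cbox (-R) R) (\<lambda>x. \<bar>h x s - h x t\<bar>))"
      by (rule integral_continuous_on_param)
        (use continuous_on_compose2[OF h swap] in
          \<open>auto simp: case_prod_unfold intro!: continuous_intros continuous_on_compose2[OF hs[of UNIV]]\<close>)
    then have "continuous_on UNIV d" by (simp add: d_def[abs_def])
    then have "isCont d t" by (simp add: continuous_on_eq_continuous_at)
    then show "(d \<longlongrightarrow> 0) (at t)" by (simp add: isCont_def d_def)
  qed
  then have "((\<lambda>s. B * d s + \<bar>H\<bar> * \<bar>L\<bar> * D s) \<longlongrightarrow> 0) (at t)" by simp
  with bound have "((\<lambda>s. (LINT x|lebesgue. h x s * G (u x s)) - (LINT x|lebesgue. h x t * G (u x t))) \<longlongrightarrow> 0) (at t)"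
    by (rule Lim_null_comparison)
  then show ?thesis unfolding isCont_def by (rule LIM_zero_cancel)
qed

lemma f_bounded: "\<exists>F>0. \<forall>v. \<bar>v\<bar> \<le> M \<longrightarrow> \<bar>f v\<bar> \<le> F"
proof -
  have "bounded (f ` {-M..M})"
    by (intro compact_imp_bounded compact_continuous_image continuous_on_subset[OF f_cont]) auto
  then obtain B where B: "\<forall>v\<in>{-M..M}. \<bar>f v\<bar> \<le> B" by (auto simp: bounded_iff)
  have "\<bar>f v\<bar> \<le> \<bar>B\<bar> + 1" if "\<bar>v\<bar> \<le> M" for v
    using bspec[OF B, of v] that by (simp add: abs_le_iff)
  then show ?thesis by (intro exI[of _ "\<bar>B\<bar> + 1"]) auto
qed

section \<open>Mass balance in a moving window\<close>

definition window_mass :: "real \<Rightarrow> real \<Rightarrow> real \<Rightarrow> real \<Rightarrow> real" where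
  "window_mass a \<delta> c t = (LINT x|lebesgue. moving_window a \<delta> c x t * u x t)"

text \<open>The rate of change of \<open>window_mass\<close>. If the moving edge is to the right of
  the reference edge, the window is minus a smoothed indicator of the stretch between them. This
  explains the signs: plus for the flux relative to speed \<open>c\<close> through the moving edge,
  minus for the flux through the reference edge.\<close>

definition window_flux :: "real \<Rightarrow> real \<Rightarrow> real \<Rightarrow> real \<Rightarrow> real" where
  "window_flux a \<delta> c t = bump_avg (a + c * t) \<delta> (\<lambda>x. f (u x t) - c * u x t) - bump_avg 0 1 (\<lambda>x. f (u x t))"

lemma bump_avg_slice_continuous:
  assumes "\<delta> > 0" "t > 0" "continuous_on UNIV G"
    and "\<And>v w. \<bar>v\<bar> \<le> M \<Longrightarrow> \<bar>w\<bar> \<le> M \<Longrightarrow> \<bar>G v - G w\<bar> \<le> L * \<bar>v - w\<bar>"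
  shows "isCont (\<lambda>s. bump_avg (a + c * s) \<delta> (\<lambda>x. G (u x s))) t"
  unfolding bump_avg_def
proof (rule slice_integral_continuous[OF assms(2) _ _ assms(3,4)])
  show "continuous_on UNIV (\<lambda>z. bump_at (a + c * snd z) \<delta> (fst z))"
    using assms(1) by (intro continuous_intros)
  fix x s :: real assume s: "\<bar>s - t\<bar> \<le> 1" and x: "x \<notin> {-(\<bar>a\<bar> + \<bar>c\<bar> * (t + 1) + \<delta>)..\<bar>a\<bar> + \<bar>c\<bar> * (t + 1) + \<delta>}"
  have "\<bar>c * s\<bar> \<le> \<bar>c\<bar> * (t + 1)" using s assms(2) by (auto simp: abs_mult intro!: mult_left_mono)
  moreover have "\<bar>x\<bar> \<le> \<bar>a\<bar> + \<bar>c * s\<bar> + \<delta>" if "x \<in> {a + c * s..a + c * s + \<delta>}"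
    using that assms(1) unfolding atLeastAtMost_iff by arith
  ultimately have "x \<notin> {a + c * s..a + c * s + \<delta>}"
    using x by (fastforce simp: abs_le_iff)
  then show "bump_at (a + c * s) \<delta> x = 0" by (rule bump_at_eq_0[OF assms(1)])
qed

lemma window_mass_continuous:
  assumes "\<delta> > 0" "t > 0"
  shows "isCont (window_mass a \<delta> c) t"
  unfolding window_mass_def[abs_def]
proof (rule slice_integral_continuous[OF assms(2), where G = "\<lambda>v. v" and L = 1])
  show "continuous_on UNIV (\<lambda>z. moving_window a \<delta> c (fst z) (snd z))"
    unfolding moving_window_def using assms(1) by (intro continuous_intros) auto
  fix x s :: real assume s: "\<bar>s - t\<bar> \<le> 1" and x: "x \<notin> {-(\<bar>a\<bar> + \<bar>c\<bar> * (t + 1) + \<delta> + 1)..\<bar>a\<bar> + \<bar>c\<bar> * (t + 1) + \<delta> + 1}"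
  have "\<bar>c * s\<bar> \<le> \<bar>c\<bar> * (t + 1)" using s assms(2) by (auto simp: abs_mult intro!: mult_left_mono)
  then show "moving_window a \<delta> c x s = 0"
    by (intro moving_window_eq_0[OF assms(1) _ x]) linarith
qed auto

lemma flux_lipschitz:
  "\<bar>v\<bar> \<le> M \<Longrightarrow> \<bar>w\<bar> \<le> M \<Longrightarrow> \<bar>(f v - c * v) - (f w - c * w)\<bar> \<le> (K + \<bar>c\<bar>) * \<bar>v - w\<bar>"
proof -
  assume "\<bar>v\<bar> \<le> M" "\<bar>w\<bar> \<le> M"
  from f_lip[OF this] have "\<bar>f v - f w\<bar> + \<bar>c * (v - w)\<bar> \<le> (K + \<bar>c\<bar>) * \<bar>v - w\<bar>"
    by (simp add: abs_mult distrib_right)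
  moreover have "(f v - c * v) - (f w - c * w) = (f v - f w) - c * (v - w)" by (simp add: algebra_simps)
  ultimately show ?thesis by simp
qed

lemma window_flux_continuous:
  assumes "\<delta> > 0" "t > 0"
  shows "isCont (window_flux a \<delta> c) t"
proof -
  have "isCont (\<lambda>s. bump_avg (a + c * s) \<delta> (\<lambda>x. f (u x s) - c * u x s)) t"
    by (rule bump_avg_slice_continuous[OF assms _ flux_lipschitz]) (intro continuous_intros f_cont)
  moreover have "isCont (\<lambda>s. bump_avg (0 + 0 * s) 1 (\<lambda>x. f (u x s))) t"
    by (rule bump_avg_slice_continuous[OF zero_less_one assms(2) f_cont f_lip])
  ultimately show ?thesis unfolding window_flux_def[abs_def] by (intro continuous_diff) auto
qed

text \<open>The weak formulation tested with window times cutoff. The derivatives of the window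
  edges produce the flux, and the descent of the cutoff samples the mass just after \<tau>. Fubini
  then leaves an identity in time alone.\<close>

lemma window_weak_identity:
  assumes \<delta>: "\<delta> > 0" and \<tau>: "\<tau> > 0" and \<epsilon>: "\<epsilon> > 0"
  shows "(LINT t|lebesgue. indicator {0<..} t *
      (cutoff \<tau> \<epsilon> t * window_flux a \<delta> c t - bump_at \<tau> \<epsilon> t * window_mass a \<delta> c t))
    + (LINT x|lebesgue. u0 x * moving_window a \<delta> c x 0) = 0"
proof -
  define \<phi> where "\<phi> z = moving_window a \<delta> c (fst z) (snd z) * cutoff \<tau> \<epsilon> (snd z)" for z
  \<comment> \<open>\<open>A\<close> and \<open>B\<close> agree with the time and space derivatives
    of \<phi> on the open half plane, where the lower cutoff is constant, and are continuous on the
    whole plane.\<close>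
  define A where "A z = - c * bump_at (a + c * snd z) \<delta> (fst z) * cutoff \<tau> \<epsilon> (snd z)
      - moving_window a \<delta> c (fst z) (snd z) * bump_at \<tau> \<epsilon> (snd z)" for z
  define B where "B z = (bump_at (a + c * snd z) \<delta> (fst z) - bump_at 0 1 (fst z)) * cutoff \<tau> \<epsilon> (snd z)" for z
  define g where "g z = indicator half_plane z * u (fst z) (snd z) * A z
      + indicator half_plane z * f (u (fst z) (snd z)) * B z" for z
  define T where "T = \<tau> + \<epsilon>"
  define R where "R = \<bar>a\<bar> + \<bar>c\<bar> * T + \<delta> + 1"
  have cA: "continuous_on UNIV A" and cB: "continuous_on UNIV B"
    unfolding A_def[abs_def] B_def[abs_def] moving_window_def cutoff_def using \<delta> \<epsilon>
    by (intro continuous_intros; simp)+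
  have half: "half_plane \<in> sets (lebesgue :: (real \<times> real) measure)"
    by (intro sets_completionI_sets) (simp add: borel_Times)
  have zero: "A z = 0 \<and> B z = 0" if "snd z > 0" "z \<notin> {-R..R} \<times> {0..T}" for z
  proof (cases "snd z \<le> T")
    case False
    then show ?thesis using \<epsilon> by (simp add: A_def B_def cutoff_def T_def bump_at_eq_0 step_at_eq_1)
  next
    case True
    then have "\<bar>c * snd z\<bar> \<le> \<bar>c\<bar> * T" using that(1) by (auto simp: abs_mult intro!: mult_left_mono)
    then have R: "\<bar>a + c * snd z\<bar> + \<delta> + 1 \<le> R" by (simp add: R_def)
    have x: "fst z \<notin> {-R..R}" using that True by (auto simp: mem_Times_iff)
    have "fst z \<notin> {a + c * snd z..a + c * snd z + \<delta>}" "fst z \<notin> {0..0+1}"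
      using x R \<delta> by (auto simp: abs_if split: if_splits)
    then show ?thesis
      using moving_window_eq_0[OF \<delta> R x] \<delta> bump_at_eq_0[of 1 "fst z" 0]
      by (simp add: A_def B_def bump_at_eq_0)
  qed
  have um: "(\<lambda>z. indicator half_plane z * u (fst z) (snd z)) \<in> borel_measurable lebesgue"
    using u_meas half by (subst (asm) borel_measurable_restrict_space_iff) (auto simp: mult.commute)
  have fm: "(\<lambda>z. indicator half_plane z * f (u (fst z) (snd z))) \<in> borel_measurable lebesgue"
    using measurable_compose[OF u_meas borel_measurable_continuous_onI[OF f_cont]] half
    by (subst (asm) borel_measurable_restrict_space_iff) (auto simp: mult.commute)
  have gm: "g \<in> borel_measurable lebesgue"
    unfolding g_def[abs_def]
    by (intro borel_measurable_add borel_measurable_times[OF um] borel_measurable_times[OF fm]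
        measurable_completion[where f = A] measurable_completion[where f = B])
      (auto intro!: borel_measurable_continuous_onI cA cB)
  obtain F where F: "F > 0" "\<And>v. \<bar>v\<bar> \<le> M \<Longrightarrow> \<bar>f v\<bar> \<le> F" using f_bounded by blast
  have "bounded (A ` ({-R..R} \<times> {0..T}))" "bounded (B ` ({-R..R} \<times> {0..T}))"
    by (intro compact_imp_bounded compact_continuous_image compact_Times
        continuous_on_subset[OF cA] continuous_on_subset[OF cB]; simp)+
  then obtain CA CB where CA: "\<forall>z\<in>{-R..R} \<times> {0..T}. \<bar>A z\<bar> \<le> CA" and CB: "\<forall>z\<in>{-R..R} \<times> {0..T}. \<bar>B z\<bar> \<le> CB"
    unfolding bounded_iff by auto
  have g_int: "integrable lebesgue g"
  proof (rule integrable_lebesgue_bounded_support[OF gm, where S = "{-R..R} \<times> {0..T}" and B = "M * \<bar>CA\<bar> + F * \<bar>CB\<bar>"])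
    have "AE z in lebesgue. z \<in> half_plane \<longrightarrow> \<bar>u (fst z) (snd z)\<bar> \<le> M"
      using u_bdd half by (subst (asm) AE_restrict_space_iff) (auto elim!: eventually_mono)
    then show "AE z in lebesgue. \<bar>g z\<bar> \<le> M * \<bar>CA\<bar> + F * \<bar>CB\<bar>"
    proof eventually_elim
      case (elim z)
      show ?case
      proof (cases "z \<in> half_plane \<and> z \<in> {-R..R} \<times> {0..T}")
        case True
        then have u: "\<bar>u (fst z) (snd z)\<bar> \<le> M" using elim by blast
        have "\<bar>A z\<bar> \<le> \<bar>CA\<bar>" "\<bar>B z\<bar> \<le> \<bar>CB\<bar>" using bspec[OF CA, of z] bspec[OF CB, of z] True by simp_all
        then have "\<bar>u (fst z) (snd z) * A z\<bar> \<le> M * \<bar>CA\<bar>" "\<bar>f (u (fst z) (snd z)) * B z\<bar> \<le> F * \<bar>CB\<bar>"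
          unfolding abs_mult using u F M_pos by (intro mult_mono; simp)+
        then show ?thesis using True unfolding g_def by (simp add: indicator_def)
      next
        case False
        then have "g z = 0" using zero[of z] by (auto simp: g_def indicator_def mem_Times_iff)
        then show ?thesis using M_pos F by simp
      qed
    qed
    show "compact ({-R..R} \<times> {0..T})" by (intro compact_Times) auto
    show "g z = 0" if "z \<notin> {-R..R} \<times> {0..T}" for z
      using zero[of z] that by (auto simp: g_def indicator_def mem_Times_iff)
  qed
  have inner: "(LINT x|lebesgue. g (x, t)) = indicator {0<..} t *
      (cutoff \<tau> \<epsilon> t * window_flux a \<delta> c t - bump_at \<tau> \<epsilon> t * window_mass a \<delta> c t)" for t
  proof (cases "t > 0")
    case t: True
    have ub: "AE x in lebesgue. x \<in> {b..b+\<delta>'} \<longrightarrow> \<bar>u x t\<bar> \<le> M" for b \<delta>'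
      using slice_bounded[OF t] by eventually_elim auto
    have fb: "AE x in lebesgue. x \<in> {b..b+\<delta>'} \<longrightarrow> \<bar>f (u x t)\<bar> \<le> F" for b \<delta>'
      using slice_bounded[OF t] by eventually_elim (use F in auto)
    have i1: "integrable lebesgue (\<lambda>x. bump_at (a + c * t) \<delta> x * u x t)"
      by (rule integrable_bump_at_mult[OF \<delta> slice_measurable[OF t] ub])
    have i2: "integrable lebesgue (\<lambda>x. bump_at (a + c * t) \<delta> x * f (u x t))"
      by (rule integrable_bump_at_mult[OF \<delta> f_slice_measurable[OF t] fb])
    have i3: "integrable lebesgue (\<lambda>x. bump_at 0 1 x * f (u x t))"
      by (rule integrable_bump_at_mult[OF zero_less_one f_slice_measurable[OF t] fb])
    have i4: "integrable lebesgue (\<lambda>x. moving_window a \<delta> c x t * u x t)"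
    proof (rule integrable_lebesgue_bounded_support[where B = "1 * M"])
      have "moving_window a \<delta> c x t \<in> {-1..1}" for x
        using step_at_bounds[of "a + c * t" \<delta> x] step_at_bounds[of 0 1 x] by (auto simp: moving_window_def)
      then have m: "\<bar>moving_window a \<delta> c x t\<bar> \<le> 1" for x by (auto simp: abs_le_iff)
      show "AE x in lebesgue. \<bar>moving_window a \<delta> c x t * u x t\<bar> \<le> 1 * M"
        using slice_bounded[OF t] by eventually_elim (unfold abs_mult, intro mult_mono m, auto)
      show "(\<lambda>x. moving_window a \<delta> c x t * u x t) \<in> borel_measurable lebesgue"
        unfolding moving_window_def using \<delta> t slice_measurable[OF t]
        by (intro borel_measurable_times borel_measurable_diff) auto
      show "compact {-(\<bar>a + c * t\<bar> + \<delta> + 1)..\<bar>a + c * t\<bar> + \<delta> + 1}" by simp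
    qed (use moving_window_eq_0[OF \<delta> order_refl] in auto)
    have "(LINT x|lebesgue. g (x, t)) = (LINT x|lebesgue.
        cutoff \<tau> \<epsilon> t * (bump_at (a + c * t) \<delta> x * f (u x t))
      - cutoff \<tau> \<epsilon> t * c * (bump_at (a + c * t) \<delta> x * u x t)
      - cutoff \<tau> \<epsilon> t * (bump_at 0 1 x * f (u x t))
      - bump_at \<tau> \<epsilon> t * (moving_window a \<delta> c x t * u x t))"
      using t by (simp add: g_def A_def B_def indicator_def algebra_simps)
    also have "\<dots> = cutoff \<tau> \<epsilon> t * (LINT x|lebesgue. bump_at (a + c * t) \<delta> x * f (u x t))
      - cutoff \<tau> \<epsilon> t * c * (LINT x|lebesgue. bump_at (a + c * t) \<delta> x * u x t)
      - cutoff \<tau> \<epsilon> t * (LINT x|lebesgue. bump_at 0 1 x * f (u x t))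
      - bump_at \<tau> \<epsilon> t * (LINT x|lebesgue. moving_window a \<delta> c x t * u x t)"
      using i1 i2 i3 i4 by simp
    also have "\<dots> = cutoff \<tau> \<epsilon> t * window_flux a \<delta> c t - bump_at \<tau> \<epsilon> t * window_mass a \<delta> c t"
    proof -
      have "bump_avg (a + c * t) \<delta> (\<lambda>x. f (u x t) - c * u x t)
        = (LINT x|lebesgue. bump_at (a + c * t) \<delta> x * f (u x t) - c * (bump_at (a + c * t) \<delta> x * u x t))"
        unfolding bump_avg_def by (simp add: algebra_simps)
      also have "\<dots> = (LINT x|lebesgue. bump_at (a + c * t) \<delta> x * f (u x t))
          - c * (LINT x|lebesgue. bump_at (a + c * t) \<delta> x * u x t)"
        using i1 i2 by simp
      finally have avg: "bump_avg (a + c * t) \<delta> (\<lambda>x. f (u x t) - c * u x t)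
        = (LINT x|lebesgue. bump_at (a + c * t) \<delta> x * f (u x t))
          - c * (LINT x|lebesgue. bump_at (a + c * t) \<delta> x * u x t)" .
      show ?thesis
        unfolding window_flux_def window_mass_def avg by (simp add: bump_avg_def algebra_simps)
    qed
    finally show ?thesis using t by simp
  qed (simp add: g_def)
  have slice: "(\<lambda>x. g (x, t)) \<in> borel_measurable lebesgue" for t
  proof (cases "t > 0")
    case True
    have "continuous_on UNIV (\<lambda>x::real. (x, t))" by (intro continuous_intros)
    from continuous_on_compose2[OF cA this] continuous_on_compose2[OF cB this]
    have "continuous_on UNIV (\<lambda>x. A (x, t))" "continuous_on UNIV (\<lambda>x. B (x, t))" by simp_all
    then have "(\<lambda>x. u x t * A (x, t) + f (u x t) * B (x, t)) \<in> borel_measurable lebesgue"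
      using slice_measurable[OF True] f_slice_measurable[OF True]
      by (intro borel_measurable_add borel_measurable_times measurable_completion[where f = "\<lambda>x. A (x, t)"]
          measurable_completion[where f = "\<lambda>x. B (x, t)"]) (auto intro!: borel_measurable_continuous_onI)
    then show ?thesis using True by (simp add: g_def)
  qed (simp add: g_def)
  have outer: "(\<lambda>t. LINT x|lebesgue. g (x, t)) \<in> borel_measurable lebesgue"
  proof -
    have "continuous_on {0<..} (\<lambda>t. cutoff \<tau> \<epsilon> t * window_flux a \<delta> c t - bump_at \<tau> \<epsilon> t * window_mass a \<delta> c t)"
      unfolding cutoff_def using \<delta> \<epsilon> window_mass_continuous window_flux_continuous
      by (intro continuous_intros continuous_at_imp_continuous_on) auto
    then have "(\<lambda>t. indicator {0<..} t *\<^sub>R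
        (cutoff \<tau> \<epsilon> t * window_flux a \<delta> c t - bump_at \<tau> \<epsilon> t * window_mass a \<delta> c t)) \<in> borel_measurable borel"
      by (intro borel_measurable_continuous_on_indicator) auto
    then have "(\<lambda>t. indicator {0<..} t * (cutoff \<tau> \<epsilon> t * window_flux a \<delta> c t
        - bump_at \<tau> \<epsilon> t * window_mass a \<delta> c t)) \<in> borel_measurable lebesgue"
      by (intro measurable_completion) simp
    then show ?thesis by (simp only: inner)
  qed
  have tf: "test_function \<phi>"
    unfolding \<phi>_def[abs_def] by (rule test_function_window[OF \<delta> \<epsilon>])
  have "0 = (LINT z:half_plane|lebesgue. u (fst z) (snd z) * dt \<phi> z + f (u (fst z) (snd z)) * dx \<phi> z)
     + (LINT x|lebesgue. u0 x * \<phi> (x, 0))"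
    using u_weak[unfolded weak_solution_def, rule_format, OF tf] by (rule sym)
  also have "(LINT z:half_plane|lebesgue. u (fst z) (snd z) * dt \<phi> z + f (u (fst z) (snd z)) * dx \<phi> z)
     = (LINT z|lebesgue. g z)"
    unfolding set_lebesgue_integral_def
  proof (intro Bochner_Integration.integral_cong refl)
    fix z :: "real \<times> real"
    show "indicator half_plane z *\<^sub>R (u (fst z) (snd z) * dt \<phi> z + f (u (fst z) (snd z)) * dx \<phi> z) = g z"
    proof (cases "z \<in> half_plane")
      case True
      then have "dt \<phi> z = A z" "dx \<phi> z = B z"
        using dt_window[OF \<delta> \<epsilon>, of "snd z" a c \<tau> "fst z"] dx_window[OF \<delta>, of a c \<tau> \<epsilon> "fst z" "snd z"]
        by (auto simp: \<phi>_def[abs_def] A_def B_def)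
      then show ?thesis using True by (simp add: g_def)
    qed (simp add: g_def)
  qed
  also have "\<dots> = (LINT t|lebesgue. LINT x|lebesgue. g (x, t))"
    by (rule integral_lebesgue_iterated[OF g_int slice outer])
  also have "(LINT x|lebesgue. u0 x * \<phi> (x, 0)) = (LINT x|lebesgue. u0 x * moving_window a \<delta> c x 0)"
    using \<tau> \<epsilon> by (simp add: \<phi>_def cutoff_def step_at_eq_0 step_eq_1)
  finally have "0 = (LINT t|lebesgue. LINT x|lebesgue. g (x, t))
    + (LINT x|lebesgue. u0 x * moving_window a \<delta> c x 0)" .
  moreover have "(LINT t|lebesgue. LINT x|lebesgue. g (x, t)) = (LINT t|lebesgue. indicator {0<..} t *
      (cutoff \<tau> \<epsilon> t * window_flux a \<delta> c t - bump_at \<tau> \<epsilon> t * window_mass a \<delta> c t))"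
    by (rule Bochner_Integration.integral_cong[OF refl inner])
  ultimately show ?thesis by linarith
qed

lemma slice_comp_bounded:
  assumes "t > 0" "\<And>v. \<bar>v\<bar> \<le> M \<Longrightarrow> \<bar>G v\<bar> \<le> F"
  shows "AE x in lebesgue. x \<in> S \<longrightarrow> \<bar>G (u x t)\<bar> \<le> F"
  using slice_bounded[OF assms(1)] by eventually_elim (use assms(2) in auto)

lemma bump_avg_slice_abs_le:
  assumes "\<delta> > 0" "t > 0" "continuous_on UNIV G" "\<And>v. \<bar>v\<bar> \<le> M \<Longrightarrow> \<bar>G v\<bar> \<le> F"
  shows "\<bar>bump_avg b \<delta> (\<lambda>x. G (u x t))\<bar> \<le> F"
proof -
  have "(\<lambda>x. G (u x t)) \<in> borel_measurable lebesgue"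
    using measurable_compose[OF slice_measurable[OF assms(2)] borel_measurable_continuous_onI[OF assms(3)]] .
  moreover have "AE x in lebesgue. x \<in> {b..b+\<delta>} \<longrightarrow> -F \<le> G (u x t) \<and> G (u x t) \<le> F"
    by (rule eventually_mono[OF slice_comp_bounded[OF assms(2), of G F "{b..b+\<delta>}"]])
      (use assms(4) in \<open>auto simp: abs_le_iff\<close>)
  ultimately show ?thesis
    using bump_avg_bounds[OF assms(1), of "\<lambda>x. G (u x t)" b "-F" F] by (simp add: abs_le_iff)
qed

lemma flux_bounded: "\<exists>F>0. \<forall>v. \<bar>v\<bar> \<le> M \<longrightarrow> \<bar>f v - c * v\<bar> \<le> F"
proof -
  obtain F where F: "F > 0" "\<And>v. \<bar>v\<bar> \<le> M \<Longrightarrow> \<bar>f v\<bar> \<le> F" using f_bounded by blast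
  have "\<bar>f v - c * v\<bar> \<le> F + \<bar>c\<bar> * M" if "\<bar>v\<bar> \<le> M" for v
  proof -
    have "\<bar>c * v\<bar> \<le> \<bar>c\<bar> * M" using that by (simp add: abs_mult mult_left_mono)
    then show ?thesis using F(2)[OF that] by linarith
  qed
  then show ?thesis using F(1) M_pos by (intro exI[of _ "F + \<bar>c\<bar> * M"]) (auto intro!: add_pos_nonneg)
qed

text \<open>The left end point is excluded so that functions controlled at positive times only can
  be integrated from time 0.\<close>

lemma set_integrable_Ioc_continuous:
  fixes q :: "real \<Rightarrow> real"
  assumes "continuous_on {0<..} q" "\<And>s. s > 0 \<Longrightarrow> \<bar>q s\<bar> \<le> Q" and that: "0 \<le> s"
  shows "set_integrable lebesgue {s<..t} q"
  unfolding set_integrable_def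
proof (rule integrable_lebesgue_bounded_support[where S = "{s..t}" and B = "\<bar>Q\<bar>"])
  have "(\<lambda>t. indicator {0<..} t *\<^sub>R q t) \<in> borel_measurable borel"
    by (intro borel_measurable_continuous_on_indicator assms) auto
  then have "(\<lambda>t. indicator {0<..} t *\<^sub>R q t) \<in> borel_measurable lebesgue" 
    by (intro measurable_completion) simp
  then have "(\<lambda>r. indicator {s<..t} r * (indicator {0<..} r *\<^sub>R q r)) \<in> borel_measurable lebesgue"
    by (intro borel_measurable_times borel_measurable_indicator) auto
  also have "(\<lambda>r. indicator {s<..t} r * (indicator {0<..} r *\<^sub>R q r)) = (\<lambda>r. indicator {s<..t} r *\<^sub>R q r)"
    using that by (auto simp: indicator_def)
  finally show "(\<lambda>r. indicator {s<..t} r *\<^sub>R q r) \<in> borel_measurable lebesgue" .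
  show "AE r in lebesgue. \<bar>indicator {s<..t} r *\<^sub>R q r\<bar> \<le> \<bar>Q\<bar>"
  proof (rule AE_I2)
    fix r show "\<bar>indicator {s<..t} r *\<^sub>R q r\<bar> \<le> \<bar>Q\<bar>"
      using assms(2)[of r] that by (cases "r \<in> {s<..t}") auto
  qed
qed (auto simp: indicator_def)

lemma window_flux_bounded: "\<delta> > 0 \<Longrightarrow> \<exists>Q>0. \<forall>t>0. \<bar>window_flux a \<delta> c t\<bar> \<le> Q"
proof -
  assume \<delta>: "\<delta> > 0"
  obtain F where F: "F > 0" "\<And>v. \<bar>v\<bar> \<le> M \<Longrightarrow> \<bar>f v\<bar> \<le> F" using f_bounded by blast
  obtain F' where F': "F' > 0" "\<And>v. \<bar>v\<bar> \<le> M \<Longrightarrow> \<bar>f v - c * v\<bar> \<le> F'" using flux_bounded by blast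
  have flux_cont: "continuous_on UNIV (\<lambda>v. f v - c * v)" by (intro continuous_intros f_cont)
  have "\<bar>window_flux a \<delta> c t\<bar> \<le> F' + F" if t: "t > 0" for t
    unfolding window_flux_def
    using bump_avg_slice_abs_le[OF zero_less_one t f_cont F(2), of 0]
      bump_avg_slice_abs_le[OF \<delta> t flux_cont F'(2), of "a + c * t"]
    by linarith
  then show ?thesis using F(1) F'(1) by (intro exI[of _ "F' + F"]) auto
qed

text \<open>As \<epsilon> tends to 0 the cutoff becomes the indicator of times up to
  \<open>t\<close>, and the average of the mass over \<open>[t, t + \<epsilon>]\<close> tends to its
  value at \<open>t\<close> by continuity. The initial mass is the boundary term of the weak
  formulation, so no continuity of the solution at time 0 is involved.\<close>

lemma window_mass_eq:
  assumes \<delta>: "\<delta> > 0" and t: "t > 0"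
  shows "window_mass a \<delta> c t - (LINT x|lebesgue. moving_window a \<delta> c x 0 * u0 x)
    = (LINT s:{0<..t}|lebesgue. window_flux a \<delta> c s)"
proof -
  let ?p = "window_mass a \<delta> c" and ?q = "window_flux a \<delta> c"
  define p0 where "p0 = (LINT x|lebesgue. moving_window a \<delta> c x 0 * u0 x)"
  define I where "I = (LINT s:{0<..t}|lebesgue. ?q s)"
  obtain Q where Q: "Q > 0" "\<And>s. s > 0 \<Longrightarrow> \<bar>?q s\<bar> \<le> Q" using window_flux_bounded[OF \<delta>] by blast
  have qc: "continuous_on {0<..} ?q" and pc: "continuous_on {0<..} ?p"
    using window_flux_continuous[OF \<delta>] window_mass_continuous[OF \<delta>]
    by (auto intro!: continuous_at_imp_continuous_on)
  have pm: "(\<lambda>s. indicator {0<..} s *\<^sub>R ?p s) \<in> borel_measurable lebesgue"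
    using borel_measurable_continuous_on_indicator[OF _ pc] by (intro measurable_completion) simp
  have "\<bar>?p t - p0 - I\<bar> \<le> \<omega>" if "\<omega> > 0" for \<omega>
  proof -
    obtain d where d: "d > 0" "\<And>s. \<bar>s - t\<bar> < d \<Longrightarrow> \<bar>?p s - ?p t\<bar> < \<omega> / 2"
      using window_mass_continuous[OF \<delta> t, of a c] \<open>\<omega> > 0\<close>
      unfolding continuous_at_eps_delta dist_real_def by (metis half_gt_zero)
    \<comment> \<open>The first entry keeps the averaged mass within \<open>\<omega> / 2\<close> of
      the mass at \<open>t\<close>; the second does the same for the flux integrated over the
      descent of the cutoff.\<close>
    define \<epsilon> where "\<epsilon> = min (d / 2) (\<omega> / (2 * Q))"
    have \<epsilon>: "\<epsilon> > 0" "\<epsilon> < d" "\<epsilon> * Q \<le> \<omega> / 2"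
      using d(1) Q(1) that by (auto simp: \<epsilon>_def min_def field_simps)
    define E where "E = bump_avg t \<epsilon> (\<lambda>s. indicator {0<..} s *\<^sub>R ?p s)"
    have near: "AE s in lebesgue. s \<in> {t..t+\<epsilon>} \<longrightarrow>
        ?p t - \<omega> / 2 \<le> indicator {0<..} s *\<^sub>R ?p s \<and> indicator {0<..} s *\<^sub>R ?p s \<le> ?p t + \<omega> / 2"
    proof (intro AE_I2 impI)
      fix s assume "s \<in> {t..t+\<epsilon>}"
      then have "\<bar>?p s - ?p t\<bar> < \<omega> / 2" "s > 0" using d(2)[of s] \<epsilon> t by auto
      moreover from this(2) have i: "indicator {0<..} s *\<^sub>R ?p s = ?p s" by simp
      ultimately show "?p t - \<omega> / 2 \<le> indicator {0<..} s *\<^sub>R ?p s \<and> indicator {0<..} s *\<^sub>R ?p s \<le> ?p t + \<omega> / 2"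
        unfolding i by linarith
    qed
    have E: "\<bar>E - ?p t\<bar> \<le> \<omega> / 2"
      using bump_avg_bounds[OF \<epsilon>(1) pm near] unfolding E_def by linarith
    have Eint: "integrable lebesgue (\<lambda>s. bump_at t \<epsilon> s * (indicator {0<..} s *\<^sub>R ?p s))"
      by (rule integrable_bump_at_mult[OF \<epsilon>(1) pm, where B = "\<bar>?p t\<bar> + \<omega>"])
        (use near in eventually_elim, use \<open>\<omega> > 0\<close> in auto)
    define C where "C s = indicator {0<..} s * (cutoff t \<epsilon> s * ?q s)" for s
    have cut1: "cutoff t \<epsilon> s = 1" if "0 < s" "s \<le> t" for s
      using that \<epsilon>(1) by (simp add: cutoff_def step_eq_1 step_at_eq_0)
    have cut0: "cutoff t \<epsilon> s = 0" if "t + \<epsilon> < s" for s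
      using that \<epsilon>(1) by (simp add: cutoff_def step_at_eq_1)
    have cut: "\<bar>cutoff t \<epsilon> s\<bar> \<le> 1" if "0 < s" for s
      using that step_at_bounds[of t \<epsilon> s] by (simp add: cutoff_def step_eq_1)
    have Cint: "integrable lebesgue C"
    proof -
      have "set_integrable lebesgue {0<..t+\<epsilon>} (\<lambda>s. cutoff t \<epsilon> s * ?q s)"
      proof (rule set_integrable_Ioc_continuous)
        show "continuous_on {0<..} (\<lambda>s. cutoff t \<epsilon> s * ?q s)"
          unfolding cutoff_def using \<epsilon>(1) by (intro continuous_intros qc) auto
        show "\<bar>cutoff t \<epsilon> s * ?q s\<bar> \<le> 1 * Q" if "s > 0" for s
          unfolding abs_mult using cut[OF that] Q(2)[OF that] by (intro mult_mono) auto
      qed simp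
      moreover have "(\<lambda>s. indicator {0<..t+\<epsilon>} s *\<^sub>R (cutoff t \<epsilon> s * ?q s)) = C"
        using cut0 \<epsilon>(1) t by (auto simp: C_def indicator_def fun_eq_iff not_le)
      ultimately show ?thesis by (simp add: set_integrable_def)
    qed
    have Iint: "integrable lebesgue (\<lambda>s. indicator {0<..t} s *\<^sub>R ?q s)"
      using set_integrable_Ioc_continuous[OF qc Q(2), of 0 t] by (simp add: set_integrable_def)
    have "\<bar>(LINT s|lebesgue. C s) - I\<bar> = norm (LINT s|lebesgue. C s - indicator {0<..t} s *\<^sub>R ?q s)"
      using Cint Iint by (simp add: I_def set_lebesgue_integral_def)
    also have "\<dots> \<le> (LINT s|lebesgue. indicator {t..t+\<epsilon>} s * Q)"
    proof (rule order_trans[OF integral_norm_bound integral_mono_AE])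
      show "integrable lebesgue (\<lambda>s. indicator {t..t+\<epsilon>} s * Q)"
        by (intro integrable_mult_left integrable_real_indicator) (auto simp: emeasure_lborel_Icc_eq)
      show "AE s in lebesgue. norm (C s - indicator {0<..t} s *\<^sub>R ?q s) \<le> indicator {t..t+\<epsilon>} s * Q"
      proof (rule AE_I2)
        fix s
        consider "s \<le> 0" | "0 < s" "s \<le> t" | "0 < s" "t < s" "s \<le> t + \<epsilon>" | "0 < s" "t + \<epsilon> < s" using t by linarith
        then show "norm (C s - indicator {0<..t} s *\<^sub>R ?q s) \<le> indicator {t..t+\<epsilon>} s * Q"
        proof cases
          case 2
          then show ?thesis using Q(1) by (simp add: C_def cut1 indicator_def)
        next
          case 4
          then show ?thesis using t \<epsilon>(1) by (simp add: C_def cut0 indicator_def)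
        next
          case 3
          have "\<bar>cutoff t \<epsilon> s * ?q s\<bar> \<le> 1 * Q"
            unfolding abs_mult using cut[OF 3(1)] Q(2)[OF 3(1)] by (intro mult_mono) auto
          then show ?thesis using 3 by (simp add: C_def)
        qed (use t in \<open>simp add: C_def\<close>)
      qed
    qed (use Cint Iint in auto)
    also have "\<dots> = \<epsilon> * Q" using \<epsilon>(1) by simp
    finally have CI: "\<bar>(LINT s|lebesgue. C s) - I\<bar> \<le> \<omega> / 2" using \<epsilon>(3) by linarith
    have "(LINT s|lebesgue. C s) - E + p0 = 0"
    proof -
      have "(LINT s|lebesgue. C s) - E = (LINT s|lebesgue. C s - bump_at t \<epsilon> s * (indicator {0<..} s *\<^sub>R ?p s))"
        using Cint Eint by (simp add: E_def bump_avg_def)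
      also have "\<dots> = (LINT s|lebesgue. indicator {0<..} s *
          (cutoff t \<epsilon> s * ?q s - bump_at t \<epsilon> s * ?p s))"
        by (simp add: C_def algebra_simps)
      finally show ?thesis
        using window_weak_identity[OF \<delta> t \<epsilon>(1), of a c] by (simp add: p0_def mult.commute)
    qed
    then show ?thesis using E CI by linarith
  qed
  then have "\<bar>?p t - p0 - I\<bar> \<le> 0" by (rule field_le_epsilon[of _ 0, simplified])
  then show ?thesis by (simp add: p0_def I_def)
qed

end

section \<open>The potential\<close>

text \<open>A primitive of \<open>w\<close>, normalized against the reference edge of the windows so that averaging it
  with a bump produces the mass in a window.\<close>

definition prim :: "(real \<Rightarrow> real) \<Rightarrow> real \<Rightarrow> real" where
  "prim w x = (LINT z|lebesgue. (step_at 0 1 z - indicator {x..} z) * w z)"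

lemma prim_integrable:
  assumes [measurable]: "w \<in> borel_measurable lebesgue" and w: "AE z in lebesgue. \<bar>w z\<bar> \<le> M"
  shows "integrable lebesgue (\<lambda>z. (step_at 0 1 z - indicator {x..} z) * w z)"
proof (rule integrable_lebesgue_bounded_support[where S = "{-(\<bar>x\<bar> + 1)..\<bar>x\<bar> + 1}" and B = "1 * M"])
  have m: "\<bar>step_at 0 1 z - indicator {x..} z\<bar> \<le> 1" for z
    using step_at_bounds[of 0 1 z] by (auto simp: indicator_def)
  show "AE z in lebesgue. \<bar>(step_at 0 1 z - indicator {x..} z) * w z\<bar> \<le> 1 * M"
    using w by eventually_elim (unfold abs_mult, intro mult_mono m, auto)
  show "(\<lambda>z. (step_at 0 1 z - indicator {x..} z) * w z) \<in> borel_measurable lebesgue"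
    by (intro borel_measurable_times borel_measurable_diff borel_measurable_indicator) auto
  show "(step_at 0 1 z - indicator {x..} z) * w z = 0" if "z \<notin> {-(\<bar>x\<bar> + 1)..\<bar>x\<bar> + 1}" for z
  proof -
    consider "z \<le> 0" "z < x" | "z \<ge> 1" "z \<ge> x" using \<open>z \<notin> _\<close> by fastforce
    then show ?thesis by cases (auto simp: step_at_eq_0 step_at_eq_1)
  qed
qed simp

lemma set_integrable_bounded:
  fixes w :: "real \<Rightarrow> real"
  assumes [measurable]: "w \<in> borel_measurable lebesgue" and w: "AE z in lebesgue. \<bar>w z\<bar> \<le> M"
    and S: "S \<in> sets lebesgue" "S \<subseteq> {a..b}"
  shows "set_integrable lebesgue S w"
  unfolding set_integrable_def
proof (rule integrable_lebesgue_bounded_support[where S = "{a..b}" and B = "\<bar>M\<bar>"])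
  show "AE z in lebesgue. \<bar>indicator S z *\<^sub>R w z\<bar> \<le> \<bar>M\<bar>"
    using w by eventually_elim (auto simp: indicator_def)
qed (use S in \<open>auto simp: indicator_def\<close>)

lemma prim_diff:
  assumes [measurable]: "w \<in> borel_measurable lebesgue" and w: "AE z in lebesgue. \<bar>w z\<bar> \<le> M"
    and "x \<le> y"
  shows "prim w y - prim w x = (LINT z:{x..<y}|lebesgue. w z)"
proof -
  have "prim w y - prim w x
      = (LINT z|lebesgue. (step_at 0 1 z - indicator {y..} z) * w z - (step_at 0 1 z - indicator {x..} z) * w z)"
    unfolding prim_def using prim_integrable[OF assms(1,2)] by simp
  also have "\<dots> = (LINT z|lebesgue. indicator {x..<y} z *\<^sub>R w z)"
    using assms(3) by (intro Bochner_Integration.integral_cong) (auto simp: indicator_def left_diff_distrib)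
  finally show ?thesis by (simp add: set_lebesgue_integral_def)
qed

lemma set_integral_Ico_bounds:
  fixes w :: "real \<Rightarrow> real"
  assumes [measurable]: "w \<in> borel_measurable lebesgue" and w: "AE z in lebesgue. z \<in> {x..<y} \<longrightarrow> lo \<le> w z \<and> w z \<le> hi"
    and "x \<le> y"
  shows "lo * (y - x) \<le> (LINT z:{x..<y}|lebesgue. w z)" "(LINT z:{x..<y}|lebesgue. w z) \<le> hi * (y - x)"
proof -
  have i: "integrable lebesgue (\<lambda>z. indicator {x..<y} z *\<^sub>R w z)"
  proof (rule integrable_lebesgue_bounded_support[where S = "{x..y}" and B = "\<bar>lo\<bar> + \<bar>hi\<bar>"])
    show "AE z in lebesgue. \<bar>indicator {x..<y} z *\<^sub>R w z\<bar> \<le> \<bar>lo\<bar> + \<bar>hi\<bar>"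
      using w by eventually_elim (auto simp: indicator_def)
    show "(\<lambda>z. indicator {x..<y} z *\<^sub>R w z) \<in> borel_measurable lebesgue"
      unfolding real_scaleR_def by (intro borel_measurable_times borel_measurable_indicator) auto
  qed (auto simp: indicator_def)
  have c: "integrable lebesgue (\<lambda>z. indicator {x..<y} z *\<^sub>R (k::real))"
    "(LINT z|lebesgue. indicator {x..<y} z *\<^sub>R k) = k * (y - x)" for k
  proof -
    show "integrable lebesgue (\<lambda>z. indicator {x..<y} z *\<^sub>R (k::real))" unfolding real_scaleR_def
      using \<open>x \<le> y\<close> by (intro integrable_mult_left integrable_real_indicator) auto
    show "(LINT z|lebesgue. indicator {x..<y} z *\<^sub>R k) = k * (y - x)"
      using \<open>x \<le> y\<close> by simp
  qed
  show "lo * (y - x) \<le> (LINT z:{x..<y}|lebesgue. w z)"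
    unfolding set_lebesgue_integral_def c(2)[symmetric]
    by (rule integral_mono_AE[OF c(1) i]) (use w in eventually_elim, auto simp: indicator_def)
  show "(LINT z:{x..<y}|lebesgue. w z) \<le> hi * (y - x)"
    unfolding set_lebesgue_integral_def c(2)[symmetric]
    by (rule integral_mono_AE[OF i c(1)]) (use w in eventually_elim, auto simp: indicator_def)
qed

lemma prim_lipschitz:
  assumes "w \<in> borel_measurable lebesgue" and w: "AE z in lebesgue. \<bar>w z\<bar> \<le> M"
  shows "\<bar>prim w y - prim w x\<bar> \<le> M * \<bar>y - x\<bar>"
proof -
  have *: "\<bar>prim w y - prim w x\<bar> \<le> M * (y - x)" if "x \<le> y" for x y
  proof -
    have "AE z in lebesgue. z \<in> {x..<y} \<longrightarrow> -M \<le> w z \<and> w z \<le> M"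
      using w by eventually_elim auto
    from set_integral_Ico_bounds[OF assms(1) this that] show ?thesis
      unfolding prim_diff[OF assms that] by auto
  qed
  show ?thesis using *[of x y] *[of y x] by (cases "x \<le> y") (auto simp: abs_minus_commute)
qed

lemma prim_continuous:
  assumes "w \<in> borel_measurable lebesgue" and "AE z in lebesgue. \<bar>w z\<bar> \<le> M"
  shows "continuous_on UNIV (prim w)"
proof -
  have "\<bar>M\<bar>-lipschitz_on UNIV (prim w)"
  proof (rule lipschitz_onI)
    fix x y
    have "M * \<bar>x - y\<bar> \<le> \<bar>M\<bar> * \<bar>x - y\<bar>" by (intro mult_right_mono) auto
    then show "dist (prim w x) (prim w y) \<le> \<bar>M\<bar> * dist x y"
      using prim_lipschitz[OF assms, of x y] by (simp add: dist_real_def)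
  qed simp
  then show ?thesis by (rule lipschitz_on_continuous_on)
qed

text \<open>Exchange of the average in \<open>y\<close> with the integral in \<open>z\<close>. Since
  \<open>indicator {y..} z\<close> equals \<open>indicator {..z} y\<close>, the inner average
  smooths the sharp edge of the primitive into \<open>step_at b \<delta> z\<close>.\<close>

lemma bump_avg_prim:
  assumes \<delta>: "\<delta> > 0" and wm: "w \<in> borel_measurable lebesgue" and w: "AE z in lebesgue. \<bar>w z\<bar> \<le> M"
  shows "bump_avg b \<delta> (prim w) = (LINT z|lebesgue. (step_at 0 1 z - step_at b \<delta> z) * w z)"
proof -
  from completion_ex_borel_measurable_real[OF wm]
  obtain w' where w'[measurable]: "w' \<in> borel_measurable lborel" and ae: "AE z in lborel. w z = w' z" by auto
  have aeL: "AE z in lebesgue. w z = w' z" by (rule AE_completion[OF ae])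
  \<comment> \<open>A Borel representative clipped to be bounded everywhere, so that the integrand
    on the plane is measurable and bounded with no null sets to track.\<close>
  define w2 where "w2 z = max (-\<bar>M\<bar>) (min \<bar>M\<bar> (w' z))" for z
  have w2[measurable]: "w2 \<in> borel_measurable borel" using w' unfolding w2_def by simp
  have w2L: "w2 \<in> borel_measurable lebesgue" by (rule measurable_completion) simp
  have w2b: "\<bar>w2 z\<bar> \<le> \<bar>M\<bar>" for z by (auto simp: w2_def)
  have ww2: "AE z in lebesgue. w z = w2 z"
    using aeL w by eventually_elim (auto simp: w2_def)
  have bm[measurable]: "bump_at b \<delta> \<in> borel_measurable borel" "step_at 0 1 \<in> borel_measurable borel" "step_at b \<delta> \<in> borel_measurable borel"
    using continuous_bump_at[of \<delta> UNIV "\<lambda>x. x" "\<lambda>_. b"] continuous_step_at[of \<delta> UNIV "\<lambda>x. x" "\<lambda>_. b"]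
      continuous_step_at[of 1 UNIV "\<lambda>x. x" "\<lambda>_. 0"] \<delta>
    by (auto intro!: borel_measurable_continuous_onI)
  have prim_eq: "prim w y = (LINT z|lborel. (step_at 0 1 z - indicator {y..} z) * w2 z)" for y
  proof -
    have "prim w y = (LINT z|lebesgue. (step_at 0 1 z - indicator {y..} z) * w2 z)"
      unfolding prim_def
    proof (rule integral_cong_AE)
      show "AE z in lebesgue. (step_at 0 1 z - indicator {y..} z) * w z = (step_at 0 1 z - indicator {y..} z) * w2 z"
        using ww2 by eventually_elim simp
    qed (intro borel_measurable_times borel_measurable_diff borel_measurable_indicator wm w2L; simp)+
    also have "\<dots> = (LINT z|lborel. (step_at 0 1 z - indicator {y..} z) * w2 z)"
      by (rule integral_completion) measurable
    finally show ?thesis .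
  qed
  define g where "g y z = bump_at b \<delta> y * ((step_at 0 1 z - indicator {y..} z) * w2 z)" for y z
  \<comment> \<open>Joint measurability of the edge: it is the indicator of a closed half
    plane.\<close>
  have ind: "(\<lambda>p. indicator {fst p..} (snd p) :: real) = indicator {p :: real \<times> real. fst p \<le> snd p}"
    by (auto simp: indicator_def fun_eq_iff)
  have "closed {p :: real \<times> real. fst p \<le> snd p}" by (intro closed_Collect_le continuous_intros)
  then have "{p :: real \<times> real. fst p \<le> snd p} \<in> sets (borel \<Otimes>\<^sub>M borel)"
    unfolding borel_prod by (rule borel_closed)
  then have [measurable]: "(\<lambda>p :: real \<times> real. indicator {fst p..} (snd p) :: real) \<in> borel_measurable (borel \<Otimes>\<^sub>M borel)"
    unfolding ind by (rule borel_measurable_indicator)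
  have gm: "case_prod g \<in> borel_measurable (borel \<Otimes>\<^sub>M borel)"
    unfolding g_def case_prod_unfold by measurable
  define R where "R = \<bar>b\<bar> + \<delta> + 1"
  obtain C where C: "\<And>x. bump x \<le> C" using bump_bounded by blast
  have "integrable lebesgue (case_prod g)"
  proof (rule integrable_lebesgue_bounded_support[where S = "{-R..R} \<times> {-R..R}" and B = "C / \<delta> * (1 * \<bar>M\<bar>)"])
    show "case_prod g \<in> borel_measurable lebesgue"
      using gm by (intro measurable_completion) (simp add: borel_prod)
    show "compact ({-R..R} \<times> {-R..R})" by (intro compact_Times) auto
    show "AE p in lebesgue. \<bar>case_prod g p\<bar> \<le> C / \<delta> * (1 * \<bar>M\<bar>)"
    proof (rule AE_I2)
      fix p :: "real \<times> real"
      have "\<bar>bump_at b \<delta> (fst p)\<bar> \<le> C / \<delta>"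
        using C \<delta> bump_nonneg by (simp add: bump_at_def divide_right_mono)
      moreover have "\<bar>step_at 0 1 (snd p) - indicator {fst p..} (snd p)\<bar> \<le> 1"
        using step_at_bounds[of 0 1 "snd p"] by (auto simp: indicator_def)
      moreover have "C \<ge> 0" using C[of 0] by (simp add: bump_eq_0)
      ultimately show "\<bar>case_prod g p\<bar> \<le> C / \<delta> * (1 * \<bar>M\<bar>)"
        unfolding g_def case_prod_unfold abs_mult using w2b \<delta> by (intro mult_mono) auto
    qed
    show "case_prod g p = 0" if "p \<notin> {-R..R} \<times> {-R..R}" for p
    proof (cases "fst p \<in> {b..b+\<delta>}")
      case True
      then have "fst p \<in> {-R..R}" by (auto simp: R_def)
      with that have "snd p \<notin> {-R..R}" by (auto simp: mem_Times_iff)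
      with True consider "snd p \<le> 0" "snd p < fst p" | "snd p \<ge> 1" "snd p \<ge> fst p"
        using \<delta> by (fastforce simp: R_def)
      then show ?thesis by cases (auto simp: g_def case_prod_unfold step_at_eq_0 step_at_eq_1)
    qed (simp add: g_def case_prod_unfold bump_at_eq_0[OF \<delta>])
  qed
  then have g_int: "integrable (lborel \<Otimes>\<^sub>M lborel) (case_prod g)"
    using gm by (simp add: integrable_completion lborel_prod borel_prod)
  have "bump_avg b \<delta> (prim w) = (LINT y|lborel. bump_at b \<delta> y * prim w y)"
    unfolding bump_avg_def
  proof (rule integral_completion)
    have "continuous_on UNIV (\<lambda>y. bump_at b \<delta> y * prim w y)"
      using \<delta> by (intro continuous_intros prim_continuous[OF wm w])
    then show "(\<lambda>y. bump_at b \<delta> y * prim w y) \<in> borel_measurable lborel"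
      by (simp add: borel_measurable_continuous_onI)
  qed
  also have "\<dots> = (LINT y|lborel. LINT z|lborel. g y z)"
    unfolding prim_eq g_def by simp
  also have "\<dots> = (LINT z|lborel. LINT y|lborel. g y z)"
    by (rule lborel_pair.Fubini_integral[OF g_int, symmetric])
  also have "\<dots> = (LINT z|lborel. (step_at 0 1 z - step_at b \<delta> z) * w2 z)"
  proof (intro Bochner_Integration.integral_cong refl)
    fix z
    have "(LINT y|lborel. g y z) = (LINT y|lborel. step_at 0 1 z * w2 z * bump_at b \<delta> y
        - w2 z * (bump_at b \<delta> y * indicator {..z} y))"
      by (intro Bochner_Integration.integral_cong) (auto simp: g_def indicator_def algebra_simps)
    also have "\<dots> = step_at 0 1 z * w2 z - w2 z * step_at b \<delta> z"
      using has_bochner_integral_bump_at[OF \<delta>, of b] has_bochner_integral_bump_at_Iic[OF \<delta>, of b z]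
      by (simp add: has_bochner_integral_iff)
    finally show "(LINT y|lborel. g y z) = (step_at 0 1 z - step_at b \<delta> z) * w2 z"
      by (simp add: algebra_simps)
  qed
  also have "\<dots> = (LINT z|lebesgue. (step_at 0 1 z - step_at b \<delta> z) * w2 z)"
    by (rule integral_completion[symmetric]) measurable
  also have "\<dots> = (LINT z|lebesgue. (step_at 0 1 z - step_at b \<delta> z) * w z)"
  proof (rule integral_cong_AE)
    show "AE z in lebesgue. (step_at 0 1 z - step_at b \<delta> z) * w2 z = (step_at 0 1 z - step_at b \<delta> z) * w z"
      using ww2 by eventually_elim simp
  qed (use \<delta> in \<open>intro borel_measurable_times borel_measurable_diff wm w2L; simp\<close>)+
  finally show ?thesis .
qed

lemma set_integral_Ioc_bounds:
  fixes q :: "real \<Rightarrow> real"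
  assumes q: "set_integrable lebesgue {s<..t} q" and "s \<le> t"
  shows "(\<And>r. s < r \<Longrightarrow> r \<le> t \<Longrightarrow> lo \<le> q r) \<Longrightarrow> lo * (t - s) \<le> (LINT r:{s<..t}|lebesgue. q r)"
    and "(\<And>r. s < r \<Longrightarrow> r \<le> t \<Longrightarrow> q r \<le> hi) \<Longrightarrow> (LINT r:{s<..t}|lebesgue. q r) \<le> hi * (t - s)"
proof -
  have c: "integrable lebesgue (\<lambda>r. indicator {s<..t} r *\<^sub>R (k::real))"
    "(LINT r|lebesgue. indicator {s<..t} r *\<^sub>R k) = k * (t - s)" for k
  proof -
    show "integrable lebesgue (\<lambda>r. indicator {s<..t} r *\<^sub>R (k::real))" unfolding real_scaleR_def
      using \<open>s \<le> t\<close> by (intro integrable_mult_left integrable_real_indicator) auto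
    show "(LINT r|lebesgue. indicator {s<..t} r *\<^sub>R k) = k * (t - s)"
      using \<open>s \<le> t\<close> by simp
  qed
  have i: "integrable lebesgue (\<lambda>r. indicator {s<..t} r *\<^sub>R q r)" using q by (simp add: set_integrable_def)
  show "lo * (t - s) \<le> (LINT r:{s<..t}|lebesgue. q r)" if "\<And>r. s < r \<Longrightarrow> r \<le> t \<Longrightarrow> lo \<le> q r"
    unfolding set_lebesgue_integral_def c(2)[symmetric]
    by (rule integral_mono_AE[OF c(1) i]) (use that in \<open>auto simp: indicator_def\<close>)
  show "(LINT r:{s<..t}|lebesgue. q r) \<le> hi * (t - s)" if "\<And>r. s < r \<Longrightarrow> r \<le> t \<Longrightarrow> q r \<le> hi"
    unfolding set_lebesgue_integral_def c(2)[symmetric]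
    by (rule integral_mono_AE[OF i c(1)]) (use that in \<open>auto simp: indicator_def\<close>)
qed

section \<open>The potential of a weak solution\<close>

context bounded_weak_solution
begin

text \<open>At time 0 the data take the place of \<open>u x 0\<close>, a value on which the
  definition of a solution imposes nothing.\<close>

definition slice :: "real \<Rightarrow> real \<Rightarrow> real" where
  "slice t = (if t = 0 then u0 else (\<lambda>x. u x t))"

text \<open>The subtracted flux through the reference edge makes the time derivative of the potential the local flux.\<close>

definition potential :: "real \<Rightarrow> real \<Rightarrow> real" where
  "potential x t = prim (slice t) x - (LINT s:{0<..t}|lebesgue. bump_avg 0 1 (\<lambda>x. f (u x s)))"

lemma slice_props:
  assumes "t \<ge> 0"
  shows "slice t \<in> borel_measurable lebesgue" "AE x in lebesgue. \<bar>slice t x\<bar> \<le> M"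
  using assms slice_measurable[of t] slice_bounded[of t] u0_meas u0_bdd by (auto simp: slice_def)

lemma potential_diff:
  assumes "t \<ge> 0" "x \<le> y"
  shows "potential y t - potential x t = (LINT z:{x..<y}|lebesgue. slice t z)"
  using prim_diff[OF slice_props[OF assms(1)] assms(2)] by (simp add: potential_def)

lemma potential_lipschitz:
  assumes "t \<ge> 0"
  shows "\<bar>potential y t - potential x t\<bar> \<le> M * \<bar>y - x\<bar>"
  using prim_lipschitz[OF slice_props[OF assms], of y x] by (simp add: potential_def)

lemma potential_continuous:
  assumes "t \<ge> 0"
  shows "continuous_on UNIV (\<lambda>x. potential x t)"
  unfolding potential_def by (intro continuous_intros prim_continuous[OF slice_props[OF assms]])

text \<open>Turns averaged identities for the potential into pointwise ones, with an error that
  disappears as \<delta> tends to 0.\<close>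

lemma potential_bump_avg_near:
  assumes "\<delta> > 0" "t \<ge> 0"
  shows "\<bar>bump_avg b \<delta> (\<lambda>x. potential x t) - potential b t\<bar> \<le> M * \<delta>"
proof -
  have "(\<lambda>x. potential x t) \<in> borel_measurable lebesgue"
    using potential_continuous[OF assms(2)]
    by (intro measurable_completion) (simp add: borel_measurable_continuous_onI)
  moreover have "AE x in lebesgue. x \<in> {b..b+\<delta>} \<longrightarrow>
      potential b t - M * \<delta> \<le> potential x t \<and> potential x t \<le> potential b t + M * \<delta>"
  proof (intro AE_I2 impI)
    fix x assume x: "x \<in> {b..b+\<delta>}"
    then have "M * \<bar>x - b\<bar> \<le> M * \<delta>" using M_pos by (intro mult_left_mono) auto
    then show "potential b t - M * \<delta> \<le> potential x t \<and> potential x t \<le> potential b t + M * \<delta>"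
      using potential_lipschitz[OF assms(2), of x b] by linarith
  qed
  ultimately show ?thesis
    using bump_avg_bounds[OF assms(1), of "\<lambda>x. potential x t" b "potential b t - M * \<delta>" "potential b t + M * \<delta>"]
    by linarith
qed

lemma bump_avg_flux_time_integrable:
  assumes "\<delta> > 0" "0 \<le> s"
  shows "set_integrable lebesgue {s<..t} (\<lambda>r. bump_avg (a + c * r) \<delta> (\<lambda>x. f (u x r) - c * u x r))"
proof -
  obtain F where F: "F > 0" "\<And>v. \<bar>v\<bar> \<le> M \<Longrightarrow> \<bar>f v - c * v\<bar> \<le> F" using flux_bounded by blast
  have cont: "continuous_on UNIV (\<lambda>v. f v - c * v)" by (intro continuous_intros f_cont)
  show ?thesis
  proof (rule set_integrable_Ioc_continuous[OF _ bump_avg_slice_abs_le[OF assms(1) _ cont F(2)] assms(2)])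
    show "continuous_on {0<..} (\<lambda>r. bump_avg (a + c * r) \<delta> (\<lambda>x. f (u x r) - c * u x r))"
      using bump_avg_slice_continuous[OF assms(1) _ cont flux_lipschitz]
      by (auto intro!: continuous_at_imp_continuous_on)
  qed
qed

lemma bump_avg_potential:
  assumes \<delta>: "\<delta> > 0" and t: "t \<ge> 0"
  shows "bump_avg b \<delta> (\<lambda>x. potential x t) = (LINT z|lebesgue. (step_at 0 1 z - step_at b \<delta> z) * slice t z)
    - (LINT s:{0<..t}|lebesgue. bump_avg 0 1 (\<lambda>x. f (u x s)))"
proof -
  let ?k = "LINT s:{0<..t}|lebesgue. bump_avg 0 1 (\<lambda>x. f (u x s))"
  have b: "AE x in lebesgue. x \<in> {b..b+\<delta>} \<longrightarrow> \<bar>prim (slice t) x\<bar> \<le> \<bar>prim (slice t) b\<bar> + M * \<delta>"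
  proof (intro AE_I2 impI)
    fix x assume x: "x \<in> {b..b+\<delta>}"
    then have "M * \<bar>x - b\<bar> \<le> M * \<delta>" using M_pos by (intro mult_left_mono) auto
    then show "\<bar>prim (slice t) x\<bar> \<le> \<bar>prim (slice t) b\<bar> + M * \<delta>"
      using prim_lipschitz[OF slice_props[OF t], of x b] by linarith
  qed
  have m: "prim (slice t) \<in> borel_measurable lebesgue"
    using prim_continuous[OF slice_props[OF t]]
    by (intro measurable_completion) (simp add: borel_measurable_continuous_onI)
  have i1: "integrable lebesgue (\<lambda>x. bump_at b \<delta> x * prim (slice t) x)"
    by (rule integrable_bump_at_mult[OF \<delta> m b])
  have i2: "integrable lebesgue (\<lambda>x. bump_at b \<delta> x * ?k)"
    by (rule integrable_bump_at_mult[OF \<delta>, where B = "\<bar>?k\<bar>"]) auto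
  have "bump_avg b \<delta> (\<lambda>x. potential x t) = bump_avg b \<delta> (prim (slice t)) - bump_avg b \<delta> (\<lambda>x. ?k)"
    using i1 i2 by (simp add: bump_avg_def potential_def right_diff_distrib)
  then show ?thesis
    by (simp only: bump_avg_const[OF \<delta>] bump_avg_prim[OF \<delta> slice_props[OF t]])
qed

text \<open>The averaged and integrated form of \<open>U_t + c U_x = - (f u - c u)\<close> along the
  line from \<open>a\<close> with speed \<open>c\<close>. The flux through the reference edge,
  subtracted in \<open>potential\<close>, cancels the second term of
  \<open>window_flux\<close>.\<close>

lemma potential_balance:
  assumes \<delta>: "\<delta> > 0" and t: "t \<ge> 0"
  shows "bump_avg (a + c * t) \<delta> (\<lambda>x. potential x t) - bump_avg a \<delta> (\<lambda>x. potential x 0)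
    = - (LINT s:{0<..t}|lebesgue. bump_avg (a + c * s) \<delta> (\<lambda>x. f (u x s) - c * u x s))"
proof (cases "t = 0")
  case True
  then show ?thesis by (simp add: set_lebesgue_integral_def)
next
  case False
  with t have t: "t > 0" by simp
  have neg: "(LINT z|lebesgue. (step_at 0 1 z - step_at b \<delta> z) * w z) = - (LINT z|lebesgue. (step_at b \<delta> z - step_at 0 1 z) * w z)" for b w
    by (subst integral_minus[symmetric]) (simp add: algebra_simps)
  have 1: "bump_avg (a + c * t) \<delta> (\<lambda>x. potential x t) = - window_mass a \<delta> c t
    - (LINT s:{0<..t}|lebesgue. bump_avg 0 1 (\<lambda>x. f (u x s)))"
    using t by (simp add: bump_avg_potential[OF \<delta>] window_mass_def moving_window_def slice_def neg)
  have 0: "bump_avg a \<delta> (\<lambda>x. potential x 0) = - (LINT x|lebesgue. moving_window a \<delta> c x 0 * u0 x)"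
    by (simp add: bump_avg_potential[OF \<delta>] moving_window_def slice_def neg set_lebesgue_integral_def)
  have "window_mass a \<delta> c t - (LINT x|lebesgue. moving_window a \<delta> c x 0 * u0 x)
    = (LINT s:{0<..t}|lebesgue. bump_avg (a + c * s) \<delta> (\<lambda>x. f (u x s) - c * u x s))
      - (LINT s:{0<..t}|lebesgue. bump_avg 0 1 (\<lambda>x. f (u x s)))"
    unfolding window_mass_eq[OF \<delta> t] window_flux_def
    using bump_avg_flux_time_integrable[OF \<delta> order_refl, of t a c]
      bump_avg_flux_time_integrable[OF zero_less_one order_refl, of t 0 0]
    by (intro set_integral_diff(2)) auto
  then show ?thesis unfolding 0 1 by linarith
qed

text \<open>Only a lower bound of the relative flux over all admissible states is needed, since
  \<open>U\<close> falls along the line at the rate of that flux. If \<open>c\<close> is the slope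
  of a convex flux at a state, such a bound is given by the tangent there.\<close>

lemma potential_upper:
  assumes t: "t \<ge> 0" and g: "\<And>v. \<bar>v\<bar> \<le> M \<Longrightarrow> g \<le> f v - c * v"
  shows "potential (a + c * t) t \<le> potential a 0 - g * t"
proof (rule field_le_epsilon)
  fix e :: real assume e: "e > 0"
  \<comment> \<open>Averaging is undone at both ends of the line, each time at the cost
    \<open>e / 2\<close>.\<close>
  define \<delta> where "\<delta> = e / (2 * M)"
  have \<delta>: "\<delta> > 0" "M * \<delta> = e / 2" using e M_pos by (auto simp: \<delta>_def)
  obtain F where F: "F > 0" "\<And>v. \<bar>v\<bar> \<le> M \<Longrightarrow> \<bar>f v - c * v\<bar> \<le> F" using flux_bounded by blast
  have avg: "g \<le> bump_avg (a + c * s) \<delta> (\<lambda>x. f (u x s) - c * u x s)" if "s > 0" for s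
  proof (rule bump_avg_bounds(1)[OF \<delta>(1), where hi = F])
    show "AE x in lebesgue. x \<in> {a + c * s..a + c * s + \<delta>} \<longrightarrow>
        g \<le> f (u x s) - c * u x s \<and> f (u x s) - c * u x s \<le> F"
      using slice_bounded[OF that]
    proof eventually_elim
      case (elim x)
      show ?case using g[OF elim] F(2)[OF elim] by linarith
    qed
  qed (use that slice_measurable f_slice_measurable in simp)
  have "g * t \<le> (LINT s:{0<..t}|lebesgue. bump_avg (a + c * s) \<delta> (\<lambda>x. f (u x s) - c * u x s))"
    using set_integral_Ioc_bounds(1)[OF bump_avg_flux_time_integrable[OF \<delta>(1) order_refl] t, of g a c] avg
    by simp
  then show "potential (a + c * t) t \<le> potential a 0 - g * t + e"
    using potential_balance[OF \<delta>(1) t, of a c] potential_bump_avg_near[OF \<delta>(1) t, of "a + c * t"]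
      potential_bump_avg_near[OF \<delta>(1) order_refl, of a] \<delta>(2) by linarith
qed

text \<open>Two balances at speed 0 are subtracted, which also covers intervals that start at a
  positive time; the two averaged end values account for the error.\<close>

lemma potential_increment:
  assumes \<delta>: "\<delta> > 0" and s: "0 \<le> s" "s \<le> t"
  shows "\<bar>potential a t - potential a s + (LINT r:{s<..t}|lebesgue. bump_avg a \<delta> (\<lambda>x. f (u x r)))\<bar> \<le> 2 * M * \<delta>"
proof -
  let ?q = "\<lambda>r. bump_avg a \<delta> (\<lambda>x. f (u x r))"
  have int: "set_integrable lebesgue {s<..t} ?q" if "0 \<le> s" for s t
    using bump_avg_flux_time_integrable[OF \<delta> that, of t a 0] by simp
  have "{0<..t} = {0<..s} \<union> {s<..t}" using s by auto
  then have "(LINT r:{0<..t}|lebesgue. ?q r) = (LINT r:{0<..s}|lebesgue. ?q r) + (LINT r:{s<..t}|lebesgue. ?q r)"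
    using int[of 0 s] int[of s t] s by (simp add: set_integral_Un)
  moreover have "bump_avg a \<delta> (\<lambda>x. potential x t) - bump_avg a \<delta> (\<lambda>x. potential x 0) = - (LINT r:{0<..t}|lebesgue. ?q r)"
    "bump_avg a \<delta> (\<lambda>x. potential x s) - bump_avg a \<delta> (\<lambda>x. potential x 0) = - (LINT r:{0<..s}|lebesgue. ?q r)"
    using potential_balance[OF \<delta>, of t a 0] potential_balance[OF \<delta>, of s a 0] s by simp_all
  ultimately show ?thesis
    using potential_bump_avg_near[OF \<delta>, of t a] potential_bump_avg_near[OF \<delta>, of s a] s by linarith
qed

text \<open>The flux has to be controlled only on the window next to \<open>a\<close>. The price
  \<open>2 * M * \<delta>\<close> is independent of the time span, so a window much shorter than the
  time step makes it negligible.\<close>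

lemma potential_decrease:
  assumes \<delta>: "\<delta> > 0" and s: "0 \<le> s" "s \<le> t"
    and k: "\<And>r. s < r \<Longrightarrow> r \<le> t \<Longrightarrow> AE x in lebesgue. x \<in> {a..a+\<delta>} \<longrightarrow> f (u x r) \<le> k"
  shows "potential a t \<ge> potential a s - k * (t - s) - 2 * M * \<delta>"
proof -
  let ?q = "\<lambda>r. bump_avg a \<delta> (\<lambda>x. f (u x r))"
  obtain F where F: "F > 0" "\<And>v. \<bar>v\<bar> \<le> M \<Longrightarrow> \<bar>f v\<bar> \<le> F" using f_bounded by blast
  have int: "set_integrable lebesgue {s<..t} ?q"
    using bump_avg_flux_time_integrable[OF \<delta> s(1), of t a 0] by simp
  have avg: "?q r \<le> k" if r: "s < r" "r \<le> t" for r
  proof (rule bump_avg_bounds(2)[OF \<delta>, where lo = "- F"])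
    have "r > 0" using r s by simp
    show "AE x in lebesgue. x \<in> {a..a + \<delta>} \<longrightarrow> - F \<le> f (u x r) \<and> f (u x r) \<le> k"
      using k[OF r] slice_bounded[OF \<open>r > 0\<close>]
    proof eventually_elim
      case (elim x)
      then show ?case using F(2)[OF elim(2)] by auto
    qed
    show "(\<lambda>x. f (u x r)) \<in> borel_measurable lebesgue" by (rule f_slice_measurable[OF \<open>r > 0\<close>])
  qed
  have "(LINT r:{s<..t}|lebesgue. ?q r) \<le> k * (t - s)"
    using set_integral_Ioc_bounds(2)[OF int s(2), of k] avg by simp
  then show ?thesis using potential_increment[OF \<delta> s, of a] by linarith
qed

lemma potential_time_lipschitz:
  "\<exists>F>0. \<forall>a s t. 0 \<le> s \<longrightarrow> s \<le> t \<longrightarrow> \<bar>potential a t - potential a s\<bar> \<le> F * (t - s)"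
proof -
  obtain F where F: "F > 0" "\<And>v. \<bar>v\<bar> \<le> M \<Longrightarrow> \<bar>f v\<bar> \<le> F" using f_bounded by blast
  have "\<bar>potential a t - potential a s\<bar> \<le> F * (t - s)" if s: "0 \<le> s" "s \<le> t" for a s t
  proof (rule field_le_epsilon)
    fix e :: real assume e: "e > 0"
    define \<delta> where "\<delta> = e / (2 * M)"
    have \<delta>: "\<delta> > 0" "2 * M * \<delta> = e" using e M_pos by (auto simp: \<delta>_def)
    let ?q = "\<lambda>r. bump_avg a \<delta> (\<lambda>x. f (u x r))"
    have int: "set_integrable lebesgue {s<..t} ?q"
      using bump_avg_flux_time_integrable[OF \<delta>(1) s(1), of t a 0] by simp
    have "\<bar>?q r\<bar> \<le> F" if "s < r" for r
      using bump_avg_slice_abs_le[OF \<delta>(1) _ f_cont F(2), of r a] that s by simp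
    then have "- F \<le> ?q r" "?q r \<le> F" if "s < r" for r using that by (auto simp: abs_le_iff minus_le_iff)
    then have "- F * (t - s) \<le> (LINT r:{s<..t}|lebesgue. ?q r)" "(LINT r:{s<..t}|lebesgue. ?q r) \<le> F * (t - s)"
      using set_integral_Ioc_bounds[OF int s(2)] by blast+
    then show "\<bar>potential a t - potential a s\<bar> \<le> F * (t - s) + e"
      using potential_increment[OF \<delta>(1) s, of a] \<delta>(2) by linarith
  qed
  then show ?thesis using F(1) by blast
qed

end

section \<open>Semiconcavity\<close>

text \<open>Concavity in terms of increments. A chord of length \<open>d\<close> is cut into n equal
  pieces, each compared with the increment that starts at \<open>x\<close>; as n grows, the slope of
  that increment tends to the right derivative. The same \<open>D\<close> serves for
  \<open>y\<close> on either side of \<open>x\<close>.\<close>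

lemma decreasing_increments_supergradient:
  fixes \<phi> :: "real \<Rightarrow> real"
  assumes incr: "\<And>x a l. a > 0 \<Longrightarrow> l \<ge> 0 \<Longrightarrow> \<phi> (x + l + a) - \<phi> (x + l) \<le> \<phi> (x + a) - \<phi> x"
    and D: "((\<lambda>h. (\<phi> (x + h) - \<phi> x) / h) \<longlongrightarrow> D) (at_right 0)"
  shows "\<phi> y \<le> \<phi> x + D * (y - x)"
proof -
  have up: "\<phi> (x + real n * h) - \<phi> x \<le> real n * (\<phi> (x + h) - \<phi> x)" if "h > 0" for n h
  proof (induction n)
    case (Suc n)
    have "\<phi> (x + real n * h + h) - \<phi> (x + real n * h) \<le> \<phi> (x + h) - \<phi> x"
      using that by (intro incr) auto
    with Suc show ?case by (simp add: algebra_simps)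
  qed simp
  have down: "\<phi> x - \<phi> (x - real n * h) \<ge> real n * (\<phi> (x + h) - \<phi> x)" if "h > 0" for n h
  proof (induction n)
    case (Suc n)
    \<comment> \<open>The increment that starts at \<open>x\<close> is written as the one at
      \<open>x - (n+1) h\<close> shifted by \<open>l = (n+1) h\<close>, which is the form
      \<open>incr\<close> accepts.\<close>
    have "\<phi> (x - real (Suc n) * h + real (Suc n) * h + h) - \<phi> (x - real (Suc n) * h + real (Suc n) * h)
      \<le> \<phi> (x - real (Suc n) * h + h) - \<phi> (x - real (Suc n) * h)"
      using that by (intro incr) auto
    with Suc show ?case by (simp add: algebra_simps)
  qed simp
  have lim: "(\<lambda>n. (\<phi> (x + d / real (Suc n)) - \<phi> x) / (d / real (Suc n))) \<longlonglongrightarrow> D" if "d > 0" for d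
  proof (rule filterlim_compose[OF D])
    have "(\<lambda>n. d * (1 / real (Suc n))) \<longlonglongrightarrow> d * 0"
      by (intro tendsto_intros LIMSEQ_Suc[OF lim_1_over_n])
    then show "LIM n sequentially. d / real (Suc n) :> at_right 0"
      using that by (auto simp: filterlim_at intro!: eventually_sequentiallyI)
  qed
  consider "y = x" | "y > x" | "y < x" by linarith
  then show ?thesis
  proof cases
    case 2
    define d where "d = y - x"
    have d: "d > 0" using 2 by (simp add: d_def)
    have "(\<phi> y - \<phi> x) / d \<le> (\<phi> (x + d / real (Suc n)) - \<phi> x) / (d / real (Suc n))" for n
    proof -
      have "real (Suc n) * (d / real (Suc n)) = y - x" using d_def by simp
      then have "\<phi> y - \<phi> x \<le> real (Suc n) * (\<phi> (x + d / real (Suc n)) - \<phi> x)"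
        using up[of "d / real (Suc n)" "Suc n"] d by simp
      from divide_right_mono[OF this, of d] show ?thesis using d by (simp add: mult.commute)
    qed
    then have "(\<phi> y - \<phi> x) / d \<le> D" by (intro LIMSEQ_le_const[OF lim[OF d]]) auto
    then show ?thesis using d by (simp add: d_def field_simps)
  next
    case 3
    define d where "d = x - y"
    have d: "d > 0" using 3 by (simp add: d_def)
    have "(\<phi> x - \<phi> y) / d \<ge> (\<phi> (x + d / real (Suc n)) - \<phi> x) / (d / real (Suc n))" for n
    proof -
      have "real (Suc n) * (d / real (Suc n)) = x - y" using d_def by simp
      then have "real (Suc n) * (\<phi> (x + d / real (Suc n)) - \<phi> x) \<le> \<phi> x - \<phi> y"
        using down[of "d / real (Suc n)" "Suc n"] d by simp
      from divide_right_mono[OF this, of d] show ?thesis using d by (simp add: mult.commute)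
    qed
    then have "(\<phi> x - \<phi> y) / d \<ge> D" by (intro LIMSEQ_le_const2[OF lim[OF d]]) auto
    then show ?thesis using d by (simp add: d_def field_simps)
  qed simp
qed

text \<open>Subtracting \<open>k * y\<^sup>2 / 2\<close> reduces this to the concave case: the
  increments of this parabola over a length \<open>a\<close> grow by exactly
  \<open>k * a * l\<close> under a shift by \<open>l\<close>.\<close>

lemma semiconcave_supergradient:
  fixes P :: "real \<Rightarrow> real"
  assumes incr: "\<And>x a l. a > 0 \<Longrightarrow> l \<ge> 0 \<Longrightarrow> P (x + l + a) - P (x + l) \<le> P (x + a) - P x + k * a * l"
    and D: "((\<lambda>h. (P (x + h) - P x) / h) \<longlongrightarrow> D) (at_right 0)"
  shows "P y \<le> P x + D * (y - x) + k * (y - x)\<^sup>2 / 2"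
proof -
  define \<phi> where "\<phi> y = P y - k * y\<^sup>2 / 2" for y
  have "((\<lambda>h. (P (x + h) - P x) / h - k * x - k * h / 2) \<longlongrightarrow> D - k * x - k * 0 / 2) (at_right 0)"
    by (intro tendsto_intros D) simp
  moreover have "\<forall>\<^sub>F h in at_right 0. (P (x + h) - P x) / h - k * x - k * h / 2 = (\<phi> (x + h) - \<phi> x) / h"
    by (rule eventually_at_rightI[of 0 1]) (auto simp: \<phi>_def field_simps power2_eq_square)
  ultimately have "((\<lambda>h. (\<phi> (x + h) - \<phi> x) / h) \<longlongrightarrow> D - k * x - k * 0 / 2) (at_right 0)"
    by (rule Lim_transform_eventually)
  then have "((\<lambda>h. (\<phi> (x + h) - \<phi> x) / h) \<longlongrightarrow> D - k * x) (at_right 0)" by simp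
  moreover have "\<phi> (x + l + a) - \<phi> (x + l) \<le> \<phi> (x + a) - \<phi> x" if "a > 0" "l \<ge> 0" for x a l
    using incr[OF that, of x] by (simp add: \<phi>_def power2_eq_square field_simps)
  ultimately have "\<phi> y \<le> \<phi> x + (D - k * x) * (y - x)"
    by (intro decreasing_increments_supergradient)
  then show ?thesis by (simp add: \<phi>_def power2_eq_square field_simps)
qed

section \<open>Semiconcavity and the lower bound of the potential\<close>

context bounded_weak_solution
begin

text \<open>Lebesgue differentiation for the one-sided intervals from \<open>x\<close> to
  \<open>x + h\<close>, whose averages of \<open>u\<close> are the difference quotients of the
  potential.\<close>

lemma potential_right_derivative:
  assumes t: "t > 0"
  shows "AE x in lebesgue. ((\<lambda>h. (potential (x + h) t - potential x t) / h) \<longlongrightarrow> u x t) (at_right 0)"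
proof -
  have int: "set_integrable lebesgue {a..b} (\<lambda>x. u x t)" for a b
    by (rule set_integrable_bounded[OF slice_measurable[OF t] slice_bounded[OF t], where a = a and b = b]) auto
  have "(\<lambda>x. u x t) integrable_on cbox a b" for a b
    using set_lebesgue_integral_eq_integral(1)[OF int[of a b]] by simp
  then obtain Z where Z: "negligible Z"
    "\<And>x e. x \<notin> Z \<Longrightarrow> 0 < e \<Longrightarrow> \<exists>d>0. \<forall>h. 0 < h \<and> h < d \<longrightarrow>
       norm (integral (cbox x (x + h *\<^sub>R One)) (\<lambda>x. u x t) /\<^sub>R h ^ DIM(real) - u x t) < e"
    using integrable_ccontinuous_explicit[of "\<lambda>x. u x t"] by metis
  have "AE x in lebesgue. x \<notin> Z"
    using Z(1) by (auto simp: negligible_iff_null_sets intro: AE_not_in)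
  then show ?thesis
  proof eventually_elim
    case (elim x)
    have eq: "integral {x..x+h} (\<lambda>x. u x t) = potential (x + h) t - potential x t" if "h > 0" for h
    proof -
      have "potential (x + h) t - potential x t = (LINT z:{x..<x+h}|lebesgue. u z t)"
        using potential_diff[of t x "x + h"] t that by (simp add: slice_def)
      also have "\<dots> = integral {x..<x+h} (\<lambda>z. u z t)"
        by (rule set_lebesgue_integral_eq_integral(2)[OF set_integrable_bounded[OF slice_measurable[OF t] slice_bounded[OF t], where a = x and b = "x + h"]]) auto
      also have "\<dots> = integral {x..x+h} (\<lambda>z. u z t)"
      proof (rule integral_spike_set)
        show "negligible {z \<in> {x..<x+h} - {x..x+h}. u z t \<noteq> 0}" by (rule negligible_subset[of "{}"]) auto
        show "negligible {z \<in> {x..x+h} - {x..<x+h}. u z t \<noteq> 0}" by (rule negligible_subset[of "{x+h}"]) auto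
      qed
      finally show ?thesis ..
    qed
    show ?case
      unfolding tendsto_iff eventually_at_right_field dist_real_def
    proof (intro allI impI)
      fix e :: real assume "e > 0"
      from Z(2)[OF elim this] obtain d where d: "d > 0"
        "\<And>h. 0 < h \<Longrightarrow> h < d \<Longrightarrow> norm (integral (cbox x (x + h *\<^sub>R One)) (\<lambda>x. u x t) /\<^sub>R h ^ DIM(real) - u x t) < e"
        by blast
      have "\<bar>(potential (x + h) t - potential x t) / h - u x t\<bar> < e" if "0 < h" "h < d" for h
        using d(2)[OF that] eq[OF that(1)] by (simp add: divide_inverse mult.commute)
      then show "\<exists>b>0. \<forall>y>0. y < b \<longrightarrow> \<bar>(potential (x + y) t - potential x t) / y - u x t\<bar> < e"
        using d(1) by blast
    qed
  qed
qed

text \<open>The second difference of the potential is the integral of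
  \<open>u (z + a) t - u z t\<close> over an interval of length \<open>l\<close>. The null set in
  the one-sided condition depends on \<open>a\<close>, which is harmless because a single
  \<open>a\<close> is integrated at a time; the result holds at every point.\<close>

lemma potential_semiconcave:
  assumes t: "t > 0" and osl: "AE x in lebesgue. u (x + a) t - u x t \<le> k * a" and a: "a > 0" and l: "l \<ge> 0"
  shows "potential (x + l + a) t - potential (x + l) t \<le> potential (x + a) t - potential x t + k * a * l"
proof -
  have int: "set_integrable lebesgue {x..<x+l} w" if "w \<in> borel_measurable lebesgue" "AE z in lebesgue. \<bar>w z\<bar> \<le> M" for w
    by (rule set_integrable_bounded[OF that, where a = x and b = "x + l"]) auto
  have um: "(\<lambda>z. u (z + a) t) \<in> borel_measurable lebesgue"
    by (rule integral_lebesgue_translate(1)[OF slice_measurable[OF t]])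
  have ub: "AE z in lebesgue. \<bar>u (z + a) t\<bar> \<le> M"
    by (rule integral_lebesgue_translate(3)[OF slice_measurable[OF t] slice_bounded[OF t]])
  have "potential (x + a + l) t - potential (x + a) t = (LINT z:{x+a..<x+a+l}|lebesgue. u z t)"
    using potential_diff[of t "x + a" "x + a + l"] t l by (simp add: slice_def)
  also have "\<dots> = (LINT z|lebesgue. indicator {x+a..<x+a+l} (z + a) *\<^sub>R u (z + a) t)"
    unfolding set_lebesgue_integral_def
    by (rule integral_lebesgue_translate(2)[symmetric])
      (intro borel_measurable_scaleR borel_measurable_indicator slice_measurable[OF t], simp)
  also have "\<dots> = (LINT z:{x..<x+l}|lebesgue. u (z + a) t)"
    unfolding set_lebesgue_integral_def by (intro Bochner_Integration.integral_cong) (auto simp: indicator_def)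
  finally have 1: "potential (x + a + l) t - potential (x + a) t = (LINT z:{x..<x+l}|lebesgue. u (z + a) t)" .
  have 2: "potential (x + l) t - potential x t = (LINT z:{x..<x+l}|lebesgue. u z t)"
    using potential_diff[of t x "x + l"] t l by (simp add: slice_def)
  have "(LINT z:{x..<x+l}|lebesgue. u (z + a) t) - (LINT z:{x..<x+l}|lebesgue. u z t)
      = (LINT z:{x..<x+l}|lebesgue. u (z + a) t - u z t)"
    by (rule set_integral_diff(2)[symmetric, OF int[OF um ub] int[OF slice_measurable[OF t] slice_bounded[OF t]]])
  also have "\<dots> \<le> k * a * (x + l - x)"
  proof (rule set_integral_Ico_bounds(2)[where lo = "- 2 * M"])
    show "AE z in lebesgue. z \<in> {x..<x+l} \<longrightarrow> - 2 * M \<le> u (z + a) t - u z t \<and> u (z + a) t - u z t \<le> k * a"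
      using osl ub slice_bounded[OF t] by eventually_elim auto
  qed (use l in \<open>auto intro!: borel_measurable_diff um slice_measurable[OF t]\<close>)
  finally show ?thesis using 1 2 by (simp add: algebra_simps)
qed

text \<open>The exceptional set stems from the right derivative alone, so one null set serves all
  \<open>y\<close> at once.\<close>

lemma potential_supergradient:
  assumes t: "t > 0" and osl: "\<And>a. a > 0 \<Longrightarrow> AE x in lebesgue. u (x + a) t - u x t \<le> k * a"
  shows "AE x in lebesgue. \<forall>y. potential y t \<le> potential x t + u x t * (y - x) + k * (y - x)\<^sup>2 / 2"
  using potential_right_derivative[OF t]
proof eventually_elim
  case (elim x)
  then show ?case
    using semiconcave_supergradient[OF potential_semiconcave[OF t osl]] by blast
qed

text \<open>Over \<open>n\<close> steps of length \<open>T / n\<close> the errors \<open>\<tau> sqrt \<tau>\<close> add up to \<open>O(1 / sqrt n)\<close>.\<close>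

lemma potential_lower_step:
  assumes osl: "\<And>t a. t > 0 \<Longrightarrow> a > 0 \<Longrightarrow> AE x in lebesgue. u (x + a) t - u x t \<le> E / t * a"
    and E: "E > 0" and v: "\<bar>v\<bar> \<le> M" and s0: "s0 > 0"
  shows "\<exists>B. \<forall>s \<tau> \<mu>. s0 \<le> s \<longrightarrow> 0 < \<tau> \<longrightarrow> \<tau> \<le> 1 \<longrightarrow> (\<forall>x. potential x s - v * x \<ge> \<mu>) \<longrightarrow>
    (\<forall>x. potential x (s + \<tau>) - v * x \<ge> \<mu> - f v * \<tau> - B * (\<tau> * sqrt \<tau>))"
proof -
  obtain F where F: "F > 0" "\<And>a s t. 0 \<le> s \<Longrightarrow> s \<le> t \<Longrightarrow> \<bar>potential a t - potential a s\<bar> \<le> F * (t - s)"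
    using potential_time_lipschitz by blast
  \<comment> \<open>\<open>A * sqrt \<tau>\<close> will bound the distance of \<open>u\<close> from
    \<open>v\<close>: \<open>2 * F\<close> pays for moving two points in time, 1 for minimality only
    up to an error, \<open>2 * M\<close> for leaving \<open>x0\<close>, the last term for the
    parabola at times after \<open>s0\<close>. In \<open>B\<close>, \<open>K * A\<close> is the
    resulting flux error, and \<open>2 * M\<close> and 1 come from averaging and from
    near-minimality.\<close>
  define A where "A = 2 * F + 1 + 2 * M + E / (2 * s0)"
  define B where "B = K * A + 2 * M + 1"
  have A: "A > 0" using F E s0 M_pos by (auto simp: A_def intro!: add_pos_nonneg)
  have "potential x (s + \<tau>) - v * x \<ge> \<mu> - f v * \<tau> - B * (\<tau> * sqrt \<tau>)"
    if s: "s0 \<le> s" and \<tau>: "0 < \<tau>" "\<tau> \<le> 1" and \<mu>: "\<And>x. potential x s - v * x \<ge> \<mu>" for s \<tau> \<mu> x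
  proof -
    define W where "W x r = potential x r - v * x" for x r
    define m where "m = (INF x. W x (s + \<tau>))"
    have W_t: "\<bar>W x r - W x r'\<bar> \<le> F * \<bar>r - r'\<bar>" if "0 \<le> r" "0 \<le> r'" for x r r'
    proof (cases "r \<le> r'")
      case True
      then show ?thesis using F(2)[OF that(1), of r' x] by (simp add: W_def abs_minus_commute)
    next
      case False
      then show ?thesis using F(2)[OF that(2), of r x] by (simp add: W_def)
    qed
    have W_x: "\<bar>W x r - W y r\<bar> \<le> 2 * M * \<bar>x - y\<bar>" if "0 \<le> r" for x y r
    proof -
      have "\<bar>v * (x - y)\<bar> \<le> M * \<bar>x - y\<bar>" using v by (simp add: abs_mult mult_right_mono)
      moreover have "W x r - W y r = potential x r - potential y r - v * (x - y)"
        by (simp add: W_def algebra_simps)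
      ultimately show ?thesis using potential_lipschitz[OF that, of x y] by linarith
    qed
    have bdd: "bdd_below (range (\<lambda>x. W x (s + \<tau>)))"
    proof (rule bdd_belowI2)
      show "\<mu> - F * \<tau> \<le> W x (s + \<tau>)" for x
        using \<mu>[of x] W_t[of "s + \<tau>" s x] s s0 \<tau> by (simp add: W_def)
    qed
    have m: "m \<le> W x (s + \<tau>)" for x unfolding m_def by (rule cINF_lower[OF bdd]) simp
    \<comment> \<open>The infimum over the whole line need not be attained. The tolerance
      \<open>\<tau>\<^sup>2\<close> is of higher order than the error
      \<open>\<tau> * sqrt \<tau>\<close> allowed per step.\<close>
    have "\<exists>x0. W x0 (s + \<tau>) < m + \<tau>\<^sup>2"
      using cINF_less_iff[OF _ bdd, of "m + \<tau>\<^sup>2"] \<tau> by (auto simp: m_def)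
    then obtain x0 where x0: "W x0 (s + \<tau>) < m + \<tau>\<^sup>2" ..
    define \<rho> where "\<rho> = sqrt \<tau>"
    have \<rho>: "\<rho> > 0" "\<rho> \<le> 1" "\<rho> * \<rho> = \<tau>" using \<tau> by (auto simp: \<rho>_def real_sqrt_le_1_iff)
    have \<tau>2: "\<tau>\<^sup>2 \<le> \<tau>" "\<tau>\<^sup>2 \<le> \<tau> * \<rho>" "\<tau>\<^sup>2 > 0"
    proof -
      show "\<tau>\<^sup>2 > 0" using \<tau> by simp
      show "\<tau>\<^sup>2 \<le> \<tau>" using \<tau> by (simp add: power2_eq_square mult_left_le)
      have "\<tau> \<le> \<rho>" using \<rho> mult_left_le[of \<rho> \<rho>] by simp
      then show "\<tau>\<^sup>2 \<le> \<tau> * \<rho>" using \<tau> by (simp add: power2_eq_square mult_left_mono)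
    qed
    have close: "AE y0 in lebesgue. y0 \<in> {x0..x0+\<tau>\<^sup>2} \<longrightarrow> f (u y0 r) \<le> f v + K * (A * \<rho>)"
      if r: "s < r" "r \<le> s + \<tau>" for r
    proof -
      have r0: "r > 0" "r \<ge> s0" using r s s0 by auto
      have "AE x in lebesgue. \<forall>y. potential y r \<le> potential x r + u x r * (y - x) + E / r * (y - x)\<^sup>2 / 2"
        by (rule potential_supergradient[OF r0(1)]) (rule osl[OF r0(1)])
      with slice_bounded[OF r0(1)] show ?thesis
      proof eventually_elim
        case (elim y0)
        show ?case
        proof
          assume y0: "y0 \<in> {x0..x0+\<tau>\<^sup>2}"
          define \<omega> where "\<omega> = u y0 r - v"
          \<comment> \<open>A move of length \<open>sqrt \<tau>\<close> against the slope \<omega>.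
            The linear term gains \<open>\<bar>\<omega>\<bar> * sqrt \<tau>\<close>, while the
            parabola and the drift in time are both of order \<tau>. As \<open>y\<close> cannot
            undercut the infimum noticeably, \<omega> is of order
            \<open>sqrt \<tau>\<close>.\<close>
          define y where "y = y0 - sgn \<omega> * \<rho>"
          have sq: "(y - y0)\<^sup>2 \<le> \<tau>" and lin: "\<omega> * (y - y0) = - \<bar>\<omega>\<bar> * \<rho>"
            using \<rho> by (auto simp: y_def power_mult_distrib power2_eq_square sgn_if)
          have "E / r \<le> E / s0" using E r0 s0 by (intro divide_left_mono) auto
          then have "E / r * (y - y0)\<^sup>2 \<le> E / s0 * \<tau>" using sq E s0 by (intro mult_mono) auto
          moreover have "W y r \<le> W y0 r + \<omega> * (y - y0) + E / r * (y - y0)\<^sup>2 / 2"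
            using elim(2)[rule_format, of y] by (simp add: W_def \<omega>_def algebra_simps)
          ultimately have "\<bar>\<omega>\<bar> * \<rho> \<le> W y0 r - W y r + E / s0 * \<tau> / 2" unfolding lin by simp
          moreover have "W y r \<ge> W y (s + \<tau>) - F * \<tau>"
          proof -
            have "F * \<bar>r - (s + \<tau>)\<bar> \<le> F * \<tau>" using r F(1) by (intro mult_left_mono) auto
            then show ?thesis using W_t[of r "s + \<tau>" y] r0 s s0 \<tau> by linarith
          qed
          moreover have "W y0 r \<le> W x0 (s + \<tau>) + F * \<tau> + 2 * M * \<tau>\<^sup>2"
          proof -
            have "F * \<bar>r - (s + \<tau>)\<bar> \<le> F * \<tau>" using r F(1) by (intro mult_left_mono) auto
            moreover have "2 * M * \<bar>y0 - x0\<bar> \<le> 2 * M * \<tau>\<^sup>2" using y0 M_pos by (intro mult_left_mono) auto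
            ultimately show ?thesis using W_t[of r "s + \<tau>" x0] W_x[of r y0 x0] r0 s s0 \<tau> by linarith
          qed
          ultimately have "\<bar>\<omega>\<bar> * \<rho> \<le> 2 * F * \<tau> + \<tau>\<^sup>2 + 2 * M * \<tau>\<^sup>2 + E / s0 * \<tau> / 2"
            using m[of y] x0 by linarith
          also have "\<dots> \<le> 2 * F * \<tau> + \<tau> + 2 * M * \<tau> + E / s0 * \<tau> / 2"
            using \<tau>2(1) M_pos by (intro add_mono mult_left_mono order_refl) auto
          also have "\<dots> = A * \<rho> * \<rho>" by (simp add: A_def mult.assoc \<rho>(3)) (simp add: algebra_simps)
          finally have "\<bar>\<omega>\<bar> \<le> A * \<rho>" using \<rho>(1) by (simp add: mult_le_cancel_right)
          then have "K * \<bar>u y0 r - v\<bar> \<le> K * (A * \<rho>)" using K_pos by (simp add: \<omega>_def)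
          then show "f (u y0 r) \<le> f v + K * (A * \<rho>)" using f_lip[OF elim(1) v] by linarith
        qed
      qed
    qed
    \<comment> \<open>The window has length \<open>\<tau>\<^sup>2\<close>. Near-minimality at the
      end time spreads the bound from \<open>x0\<close> to all \<open>x\<close>, whereas the
      hypothesis on \<mu> is used at the starting time.\<close>
    have "potential x0 (s + \<tau>) \<ge> potential x0 s - (f v + K * (A * \<rho>)) * \<tau> - 2 * M * \<tau>\<^sup>2"
      using potential_decrease[OF \<tau>2(3) _ _ close, of s "s + \<tau>"] s s0 \<tau> by simp
    moreover have "2 * M * \<tau>\<^sup>2 \<le> 2 * M * (\<tau> * \<rho>)" using \<tau>2(2) M_pos by simp
    moreover have "W x (s + \<tau>) \<ge> W x0 (s + \<tau>) - \<tau> * \<rho>" using m[of x] x0 \<tau>2(2) by linarith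
    ultimately have "W x (s + \<tau>) \<ge> \<mu> - (f v + K * (A * \<rho>)) * \<tau> - 2 * M * (\<tau> * \<rho>) - \<tau> * \<rho>"
      using \<mu>[of x0] unfolding W_def by linarith
    then show ?thesis by (simp add: W_def B_def \<rho>_def algebra_simps)
  qed
  then show ?thesis by blast
qed

text \<open>The constant of a single step depends on \<open>s0\<close>. For fixed \<open>s0\<close>
  the steps are refined until their accumulated error vanishes; the initial stretch up to
  \<open>s0\<close> costs \<open>F * s0\<close> by the time Lipschitz bound and disappears in a
  second limit.\<close>

lemma potential_lower:
  assumes osl: "\<And>t a. t > 0 \<Longrightarrow> a > 0 \<Longrightarrow> AE x in lebesgue. u (x + a) t - u x t \<le> E / t * a"
    and E: "E > 0" and v: "\<bar>v\<bar> \<le> M" and init: "\<And>x. potential x 0 - v * x \<ge> \<mu>" and t: "t > 0"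
  shows "potential x t - v * x \<ge> \<mu> - f v * t"
proof -
  obtain F where F: "F > 0" "\<And>a s t. 0 \<le> s \<Longrightarrow> s \<le> t \<Longrightarrow> \<bar>potential a t - potential a s\<bar> \<le> F * (t - s)"
    using potential_time_lipschitz by blast
  have from_s0: "potential x t - v * x \<ge> \<mu> - F * s0 - f v * (t - s0)" if s0: "0 < s0" "s0 < t" for s0
  proof -
    obtain B where B: "\<And>s \<tau> \<mu> x. s0 \<le> s \<Longrightarrow> 0 < \<tau> \<Longrightarrow> \<tau> \<le> 1 \<Longrightarrow> (\<And>x. potential x s - v * x \<ge> \<mu>) \<Longrightarrow>
      potential x (s + \<tau>) - v * x \<ge> \<mu> - f v * \<tau> - B * (\<tau> * sqrt \<tau>)"
      using potential_lower_step[OF osl E v s0(1)] by metis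
    have start: "potential x s0 - v * x \<ge> \<mu> - F * s0" for x
      using init[of x] F(2)[of 0 s0 x] s0 by simp
    have iter: "potential x (s0 + real k * \<tau>) - v * x \<ge> \<mu> - F * s0 - f v * (real k * \<tau>) - real k * (B * (\<tau> * sqrt \<tau>))"
      if \<tau>: "0 < \<tau>" "\<tau> \<le> 1" for k \<tau> x
    proof (induction k arbitrary: x)
      case 0
      then show ?case using start by simp
    next
      case (Suc k)
      have "potential x (s0 + real k * \<tau> + \<tau>) - v * x
        \<ge> (\<mu> - F * s0 - f v * (real k * \<tau>) - real k * (B * (\<tau> * sqrt \<tau>))) - f v * \<tau> - B * (\<tau> * sqrt \<tau>)"
        using \<tau> by (intro B Suc) auto
      then show ?case by (simp add: algebra_simps)
    qed
    define T where "T = t - s0"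
    have T: "T > 0" using s0 by (simp add: T_def)
    have "\<forall>\<^sub>F n in sequentially. \<mu> - F * s0 - f v * T - T * (B * sqrt (T / real n)) \<le> potential x t - v * x"
    proof (rule eventually_sequentiallyI)
      \<comment> \<open>Enough steps to make their length \<open>T / n\<close> at most 1.\<close>
      fix n :: nat assume n: "n \<ge> max 1 (nat \<lceil>T\<rceil>)"
      then have n0: "real n > 0" "T / real n \<le> 1" "T / real n > 0"
        using T by (auto simp: divide_le_eq_1 nat_le_iff ceiling_le_iff)
      show "\<mu> - F * s0 - f v * T - T * (B * sqrt (T / real n)) \<le> potential x t - v * x"
        using iter[OF n0(3,2), of n x] n0 by (simp add: T_def mult.left_commute)
    qed
    moreover have "(\<lambda>n. \<mu> - F * s0 - f v * T - T * (B * sqrt (T / real n))) \<longlonglongrightarrow> \<mu> - F * s0 - f v * T - T * (B * sqrt 0)"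
    proof -
      have "(\<lambda>n. T * (1 / real n)) \<longlonglongrightarrow> T * 0" by (intro tendsto_intros lim_1_over_n)
      then have "(\<lambda>n. T / real n) \<longlonglongrightarrow> 0" by simp
      then show ?thesis by (intro tendsto_diff tendsto_mult tendsto_const tendsto_real_sqrt)
    qed
    ultimately have "\<mu> - F * s0 - f v * T - T * (B * sqrt 0) \<le> potential x t - v * x"
      by (intro tendsto_upperbound[where F = sequentially]) auto
    then show ?thesis by (simp add: T_def)
  qed
  have "((\<lambda>s0. \<mu> - F * s0 - f v * (t - s0)) \<longlongrightarrow> \<mu> - F * 0 - f v * (t - 0)) (at_right 0)"
    by (intro tendsto_intros)
  moreover have "\<forall>\<^sub>F s0 in at_right 0. \<mu> - F * s0 - f v * (t - s0) \<le> potential x t - v * x"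
    using from_s0 t by (intro eventually_at_rightI[of 0 t]) auto
  ultimately have "\<mu> - F * 0 - f v * (t - 0) \<le> potential x t - v * x"
    by (intro tendsto_upperbound[where F = "at_right 0"]) auto
  then show ?thesis by simp
qed

end

section \<open>Initial data and rarefaction wave\<close>

lemma Linfty_bound:
  assumes "Linfty M g"
  obtains B where "B > 0" "AE x in M. \<bar>g x\<bar> \<le> B"
proof -
  obtain r where r: "esssup M (\<lambda>z. ereal \<bar>g z\<bar>) \<le> ereal r"
    using assms unfolding Linfty_def by (metis less_ereal.simps(4) less_imp_le ereal_dense2)
  have "AE x in M. \<bar>g x\<bar> \<le> \<bar>r\<bar> + 1"
    using esssup_AE[of "\<lambda>z. ereal \<bar>g z\<bar>" M]
  proof eventually_elim
    case (elim x)
    with r have "ereal \<bar>g x\<bar> \<le> ereal r" by (rule order_trans[rotated])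
    then show ?case by simp
  qed
  then show ?thesis by (intro that[of "\<bar>r\<bar> + 1"]) auto
qed

text \<open>Periodicity makes the increments of the primitive invariant under a shift by
  \<open>p\<close>, so its change over one period is the same everywhere, and the vanishing mean
  identifies it as 0.\<close>

lemma prim_periodic:
  assumes wm: "w \<in> borel_measurable lebesgue" and w: "AE z in lebesgue. \<bar>w z\<bar> \<le> B"
    and p: "p > 0" "periodic_ae p w" and mean: "(LINT z:{0..p}|lebesgue. w z) = 0"
  shows "prim w (x + p) = prim w x"
proof -
  have shift: "prim w (y + p) - prim w (x + p) = prim w y - prim w x" if "x \<le> y" for x y
  proof -
    have "prim w (y + p) - prim w (x + p) = (LINT z:{x+p..<y+p}|lebesgue. w z)"
      using that by (intro prim_diff[OF wm w]) simp
    also have "\<dots> = (LINT z|lebesgue. indicator {x+p..<y+p} (z + p) *\<^sub>R w (z + p))"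
      unfolding set_lebesgue_integral_def
      by (rule integral_lebesgue_translate(2)[symmetric])
        (intro borel_measurable_scaleR borel_measurable_indicator wm, simp)
    also have "\<dots> = (LINT z|lebesgue. indicator {x..<y} z *\<^sub>R w z)"
    proof (rule integral_cong_AE)
      show "(\<lambda>z. indicator {x+p..<y+p} (z + p) *\<^sub>R w (z + p)) \<in> borel_measurable lebesgue"
        by (rule integral_lebesgue_translate(1)) (intro borel_measurable_scaleR borel_measurable_indicator wm, simp)
      show "(\<lambda>z. indicator {x..<y} z *\<^sub>R w z) \<in> borel_measurable lebesgue"
        by (intro borel_measurable_scaleR borel_measurable_indicator wm) simp
      show "AE z in lebesgue. indicator {x+p..<y+p} (z + p) *\<^sub>R w (z + p) = indicator {x..<y} z *\<^sub>R w z"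
        using p(2) unfolding periodic_ae_def by eventually_elim (auto simp: indicator_def)
    qed
    also have "\<dots> = prim w y - prim w x"
      using prim_diff[OF wm w that] by (simp add: set_lebesgue_integral_def)
    finally show ?thesis .
  qed
  have "prim w (0 + p) - prim w 0 = (LINT z:{0..<0+p}|lebesgue. w z)"
    using p by (intro prim_diff[OF wm w]) simp
  also have "\<dots> = (LINT z:{0..p}|lebesgue. w z)"
    unfolding set_lebesgue_integral_def
  proof (rule integral_cong_AE)
    show "AE z in lebesgue. indicator {0..<0+p} z *\<^sub>R w z = indicator {0..p} z *\<^sub>R w z"
      using AE_completion[OF AE_lborel_singleton[of p]] by eventually_elim (auto simp: indicator_def)
  qed (intro borel_measurable_scaleR borel_measurable_indicator wm, simp)+
  finally have "prim w p = prim w 0" by (simp add: mean)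
  then show ?thesis using shift[of 0 x] shift[of x 0] by (cases "x \<ge> 0") auto
qed

text \<open>The place where the mean condition takes effect: a continuous periodic function is
  bounded by its values on one period, so the perturbation shifts the potential by a bounded amount
  only.\<close>

lemma prim_periodic_bounded:
  assumes wm: "w \<in> borel_measurable lebesgue" and w: "AE z in lebesgue. \<bar>w z\<bar> \<le> B"
    and p: "p > 0" "periodic_ae p w" and mean: "(LINT z:{0..p}|lebesgue. w z) = 0"
  shows "\<exists>C. \<forall>x. \<bar>prim w x\<bar> \<le> C"
proof -
  have n: "prim w (x + real n * p) = prim w x" for n x
  proof (induction n)
    case (Suc n)
    then show ?case using prim_periodic[OF assms, of "x + real n * p"] by (simp add: algebra_simps)
  qed simp
  have k: "prim w (x + of_int k * p) = prim w x" for k x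
  proof (cases k)
    case (nonneg n)
    then show ?thesis using n by simp
  next
    case (neg n)
    then have "real_of_int k = - real (Suc n)" by simp
    then show ?thesis using n[of "x + of_int k * p" "Suc n"] by (simp del: of_nat_Suc)
  qed
  have "bounded (prim w ` {0..p})"
    by (intro compact_imp_bounded compact_continuous_image continuous_on_subset[OF prim_continuous[OF wm w]]) auto
  then obtain C where C: "\<forall>x\<in>{0..p}. \<bar>prim w x\<bar> \<le> C" by (auto simp: bounded_iff)
  have "\<bar>prim w x\<bar> \<le> C" for x
  proof -
    define y where "y = x + of_int (- \<lfloor>x / p\<rfloor>) * p"
    have "of_int \<lfloor>x / p\<rfloor> * p \<le> x" "x \<le> (of_int \<lfloor>x / p\<rfloor> + 1) * p"
      using of_int_floor_le[of "x / p", unfolded pos_le_divide_eq[OF p(1)]]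
        real_of_int_floor_add_one_ge[of "x / p", unfolded pos_divide_le_eq[OF p(1)]] by blast+
    then have "y \<in> {0..p}" by (auto simp: y_def algebra_simps)
    moreover have "prim w y = prim w x" unfolding y_def by (rule k)
    ultimately show ?thesis using C by metis
  qed
  then show ?thesis by blast
qed

lemma prim_diff_perturbed_constant:
  assumes gm: "g \<in> borel_measurable lebesgue" and g: "AE z in lebesgue. \<bar>g z\<bar> \<le> B"
    and wm: "w \<in> borel_measurable lebesgue" and w: "AE z in lebesgue. \<bar>w z\<bar> \<le> B'"
    and eq: "AE z in lebesgue. a < z \<and> z < b \<longrightarrow> g z = c + w z" and ab: "a \<le> b"
  shows "prim g b - prim g a = c * (b - a) + (prim w b - prim w a)"
proof -
  have wi: "set_integrable lebesgue {a..<b} w"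
    by (rule set_integrable_bounded[OF wm w, where a = a and b = b]) auto
  have ci: "set_integrable lebesgue {a..<b} (\<lambda>z. c)"
    by (rule set_integrable_bounded[where a = a and b = b and M = "\<bar>c\<bar>"]) auto
  have "prim g b - prim g a = (LINT z:{a..<b}|lebesgue. g z)" by (rule prim_diff[OF gm g ab])
  also have "\<dots> = (LINT z:{a..<b}|lebesgue. c + w z)"
    unfolding set_lebesgue_integral_def
  proof (rule integral_cong_AE)
    show "AE z in lebesgue. indicator {a..<b} z *\<^sub>R g z = indicator {a..<b} z *\<^sub>R (c + w z)"
      using eq AE_completion[OF AE_lborel_singleton[of a]] by eventually_elim (auto simp: indicator_def)
  qed (intro borel_measurable_scaleR borel_measurable_indicator borel_measurable_add borel_measurable_const gm wm; simp)+
  also have "\<dots> = (LINT z:{a..<b}|lebesgue. c) + (LINT z:{a..<b}|lebesgue. w z)"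
    by (rule set_integral_add(2)[OF ci wi])
  also have "(LINT z:{a..<b}|lebesgue. c) = c * (b - a)"
    using ab by (simp add: set_lebesgue_integral_def)
  finally show ?thesis by (simp add: prim_diff[OF wm w ab])
qed

text \<open>Says that the primitive of the data stays within \<open>C\<close> of the larger of
  \<open>l * x\<close> and \<open>r * x\<close>, the potential of the centred wave at time 0. The
  lower bound is stated for every slope in between because each plane wave is propagated
  separately.\<close>

lemma prim_initial_bounds:
  assumes gm: "g \<in> borel_measurable lebesgue" and g: "AE z in lebesgue. \<bar>g z\<bar> \<le> B"
    and wl: "wl \<in> borel_measurable lebesgue" "AE z in lebesgue. \<bar>wl z\<bar> \<le> Bl" "\<And>x. \<bar>prim wl x\<bar> \<le> Cl"
    and wr: "wr \<in> borel_measurable lebesgue" "AE z in lebesgue. \<bar>wr z\<bar> \<le> Br" "\<And>x. \<bar>prim wr x\<bar> \<le> Cr"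
    and gl: "AE x in lebesgue. x < - N \<longrightarrow> g x = l + wl x"
    and gr: "AE x in lebesgue. x > N \<longrightarrow> g x = r + wr x"
    and "l < r" "N > 0"
  shows "\<exists>C>0. (\<forall>v x. l \<le> v \<longrightarrow> v \<le> r \<longrightarrow> v * x - C \<le> prim g x) \<and>
     (\<forall>x\<le>0. prim g x \<le> l * x + C) \<and> (\<forall>x\<ge>0. prim g x \<le> r * x + C)"
proof -
  have "bounded (prim g ` {-N..N})"
    by (intro compact_imp_bounded compact_continuous_image continuous_on_subset[OF prim_continuous[OF gm g]]) auto
  then obtain C0 where C0: "\<forall>x\<in>{-N..N}. \<bar>prim g x\<bar> \<le> C0" by (auto simp: bounded_iff)
  define S where "S = (\<bar>l\<bar> + \<bar>r\<bar>) * N"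
  \<comment> \<open>\<open>C0\<close> covers the core \<open>{-N..N}\<close>, the terms in
    \<open>Cl\<close> and \<open>Cr\<close> cover the periodic primitives at two points each, and
    \<open>S\<close> covers the lines of slope between \<open>l\<close> and \<open>r\<close> on the
    core.\<close>
  define C where "C = C0 + 2 * \<bar>Cl\<bar> + 2 * \<bar>Cr\<bar> + S + 1"
  have C0N: "\<bar>prim g N\<bar> \<le> C0" "\<bar>prim g (-N)\<bar> \<le> C0" using C0 \<open>N > 0\<close> by auto
  have lN: "\<bar>l * N\<bar> \<le> S" "\<bar>r * N\<bar> \<le> S" "S \<ge> 0" using \<open>N > 0\<close> by (auto simp: S_def abs_mult intro!: mult_right_mono)
  have right: "\<bar>prim g x - r * x\<bar> \<le> C" if "x \<ge> N" for x
  proof -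
    have "AE z in lebesgue. N < z \<and> z < x \<longrightarrow> g z = r + wr z" using gr by eventually_elim auto
    from prim_diff_perturbed_constant[OF gm g wr(1,2) this that]
    have "prim g x - r * x = prim g N - r * N + prim wr x - prim wr N" by (simp add: algebra_simps)
    then show ?thesis using C0N lN wr(3)[of x] wr(3)[of N] unfolding C_def by linarith
  qed
  have left: "\<bar>prim g x - l * x\<bar> \<le> C" if "x \<le> -N" for x
  proof -
    have "AE z in lebesgue. x < z \<and> z < -N \<longrightarrow> g z = l + wl z" using gl by eventually_elim auto
    from prim_diff_perturbed_constant[OF gm g wl(1,2) this that]
    have "prim g x - l * x = prim g (-N) + l * N + prim wl x - prim wl (-N)" by (simp add: algebra_simps)
    then show ?thesis using C0N lN wl(3)[of x] wl(3)[of "-N"] unfolding C_def by linarith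
  qed
  have mid: "\<bar>prim g x - v * x\<bar> \<le> C" if "x \<in> {-N..N}" "l \<le> v" "v \<le> r" for x v
  proof -
    have "\<bar>v * x\<bar> \<le> S" unfolding S_def abs_mult using that \<open>N > 0\<close> by (intro mult_mono) auto
    then show ?thesis using bspec[OF C0 that(1)] unfolding C_def by linarith
  qed
  have "C > 0" using C0N lN(3) unfolding C_def by linarith
  moreover have "v * x - C \<le> prim g x" if v: "l \<le> v" "v \<le> r" for v x
  proof -
    consider "x \<ge> N" | "x \<le> -N" | "x \<in> {-N..N}" by fastforce
    then show ?thesis
    proof cases
      case 1
      then have "v * x \<le> r * x" using v \<open>N > 0\<close> by (intro mult_right_mono) auto
      then show ?thesis using right[OF 1] by linarith
    next
      case 2
      then have "v * x \<le> l * x" using v \<open>N > 0\<close> by (intro mult_right_mono_neg) auto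
      then show ?thesis using left[OF 2] by linarith
    next
      case 3
      then show ?thesis using mid[OF 3 v] by linarith
    qed
  qed
  moreover have "prim g x \<le> l * x + C" if "x \<le> 0" for x
    using left[of x] mid[of x l] that \<open>l < r\<close> \<open>N > 0\<close> by (cases "x \<le> -N") (auto simp: abs_le_iff)
  moreover have "prim g x \<le> r * x + C" if "x \<ge> 0" for x
    using right[of x] mid[of x r] that \<open>l < r\<close> \<open>N > 0\<close> by (cases "x \<ge> N") (auto simp: abs_le_iff)
  ultimately show ?thesis by blast
qed

section \<open>The rarefaction wave\<close>

lemma rarefaction_cases:
  assumes f'_cont: "continuous_on UNIV f'" and f'_mono: "strict_mono f'" and "l < r" and t: "t > 0"
  obtains (left) "x \<le> f' l * t" "rarefaction f' l r x t = l"
    | (fan) "f' l * t < x" "x \<le> f' r * t" "l \<le> rarefaction f' l r x t" "rarefaction f' l r x t \<le> r"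
      "f' (rarefaction f' l r x t) * t = x"
    | (right) "f' r * t < x" "rarefaction f' l r x t = r"
proof -
  have lr: "f' l * t < f' r * t" using strict_monoD[OF f'_mono \<open>l < r\<close>] t by simp
  consider "x \<le> f' l * t" | "f' l * t < x" "x \<le> f' r * t" | "f' r * t < x" by linarith
  then show thesis
  proof cases
    case 2
    then have "f' l \<le> x / t" "x / t \<le> f' r" using t by (auto simp: field_simps)
    \<comment> \<open>The intermediate value theorem puts \<open>x / t\<close> into the range of
      \<open>f'\<close>, so that \<open>inv\<close> is a true inverse there and the point lies on
      the characteristic issuing from the origin.\<close>
    then obtain v where v: "l \<le> v" "v \<le> r" "f' v = x / t"
      using IVT'[of f' l "x / t" r] \<open>l < r\<close> continuous_on_subset[OF f'_cont] by auto
    have "inv f' (x / t) = v"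
      using v(3) strict_mono_imp_inj_on[OF f'_mono] by (metis inv_f_f)
    then have "rarefaction f' l r x t = v" using 2 by (simp add: rarefaction_def)
    then show ?thesis using v 2 t by (intro fan) auto
  qed (use lr in \<open>auto simp: rarefaction_def intro: left right\<close>)
qed

lemma rarefaction_bounds:
  assumes "continuous_on UNIV f'" "strict_mono f'" "l < r" "t > 0"
  shows "l \<le> rarefaction f' l r x t" "rarefaction f' l r x t \<le> r"
  using assms(3) by (cases rule: rarefaction_cases[OF assms, of x, case_names left fan right]; simp)+

text \<open>Provides Borel measurability of the wave, on which the estimate of the essential
  supremum relies. Inside the fan, the order of two points is the order of their characteristic
  speeds.\<close>

lemma rarefaction_mono:
  assumes "continuous_on UNIV f'" "strict_mono f'" "l < r" "t > 0"
  shows "mono (\<lambda>x. rarefaction f' l r x t)"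
proof (rule monoI)
  fix x y :: real assume xy: "x \<le> y"
  note b = rarefaction_bounds[OF assms]
  show "rarefaction f' l r x t \<le> rarefaction f' l r y t"
  proof (cases rule: rarefaction_cases[OF assms, of x, case_names left fan right])
    case left
    then show ?thesis using b by simp
  next
    case fx: fan
    show ?thesis
    proof (cases rule: rarefaction_cases[OF assms, of y, case_names left fan right])
      case left
      then show ?thesis using fx xy by simp
    next
      case fan
      have "f' (rarefaction f' l r x t) * t \<le> f' (rarefaction f' l r y t) * t"
        using fx fan xy by simp
      then have "f' (rarefaction f' l r x t) \<le> f' (rarefaction f' l r y t)" using assms(4) by simp
      then show ?thesis using strict_mono_less_eq[OF assms(2)] by blast
    next
      case right
      then show ?thesis using b by simp
    qed
  next
    case right
    then have "f' r * t < y" using xy by simp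
    moreover have "f' l * t < f' r * t" using strict_monoD[OF assms(2,3)] assms(4) by simp
    ultimately have "rarefaction f' l r y t = r" by (simp add: rarefaction_def)
    then show ?thesis using b by simp
  qed
qed

theorem theorem2p2:
  fixes f f' f'' :: "real \<Rightarrow> real"
    and ul ur pl pr N :: real
    and w0l w0r u0 :: "real \<Rightarrow> real"
    and u :: "real \<Rightarrow> real \<Rightarrow> real"
  assumes "\<And>x. (f has_real_derivative f' x) (at x)"
    and "\<And>x. (f' has_real_derivative f'' x) (at x)"
    and "continuous_on UNIV f''"
    and "\<And>x. f'' x > 0"
    and "ul < ur"
    and "Linfty lebesgue w0l" and "Linfty lebesgue w0r"
    and "pl > 0" and "pr > 0"
    and "periodic_ae pl w0l" and "periodic_ae pr w0r"
    and "1 / pl * (LINT x:{0..pl}|lebesgue. w0l x) = 0"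
    and "1 / pr * (LINT x:{0..pr}|lebesgue. w0r x) = 0"
    and "N > 0"
    and "Linfty lebesgue u0"
    and "AE x in lebesgue. x < - N \<longrightarrow> u0 x = ul + w0l x"
    and "AE x in lebesgue. x > N \<longrightarrow> u0 x = ur + w0r x"
    and "entropy_solution f u0 u"
  shows "\<exists>C>0. \<forall>t>0.
    esssup lebesgue (\<lambda>x. ereal \<bar>u x t - rarefaction f' ul ur x t\<bar>) \<le> ereal (C / sqrt t)"
proof -
  have f'_cont: "continuous_on UNIV f'"
    using assms(2) by (meson DERIV_isCont continuous_at_imp_continuous_on)
  have f'_mono: "strict_mono f'"
    by (rule strict_monoI, rule DERIV_pos_imp_increasing) (use assms(2,4) in blast)+
  have tangent: "f v + f' v * (w - v) \<le> f w" for v w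
    using f''_imp_f'[of UNIV f f' f'' v w] assms(1,2,4) less_imp_le[OF assms(4)] by auto
  obtain Bl where Bl: "AE x in lebesgue. \<bar>w0l x\<bar> \<le> Bl" using Linfty_bound[OF assms(6)] by blast
  obtain Br where Br: "AE x in lebesgue. \<bar>w0r x\<bar> \<le> Br" using Linfty_bound[OF assms(7)] by blast
  obtain B0 where B0: "B0 > 0" "AE x in lebesgue. \<bar>u0 x\<bar> \<le> B0" using Linfty_bound[OF assms(15)] by blast
  have sol: "Linfty (lebesgue_on half_plane) (\<lambda>z. u (fst z) (snd z))" "time_continuous u"
    "weak_solution f u0 u" "oleinik_condition u"
    using assms(18) by (auto simp: entropy_solution_def)
  obtain B1 where B1: "B1 > 0" "AE z in lebesgue_on half_plane. \<bar>u (fst z) (snd z)\<bar> \<le> B1"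
    using Linfty_bound[OF sol(1)] by blast
  have meas: "w0l \<in> borel_measurable lebesgue" "w0r \<in> borel_measurable lebesgue" "u0 \<in> borel_measurable lebesgue"
    using assms(6,7,15) by (auto simp: Linfty_def)
  \<comment> \<open>The far-field constants are included so that every plane wave state between
    \<open>ul\<close> and \<open>ur\<close> lies in the range on which the flux is
    Lipschitz.\<close>
  define M where "M = B0 + B1 + \<bar>ul\<bar> + \<bar>ur\<bar>"
  \<comment> \<open>\<open>f'\<close> is increasing, so its values at the two ends bound it on the
    whole range; the summand 1 makes \<open>K\<close> positive.\<close>
  define K where "K = \<bar>f' M\<bar> + \<bar>f' (-M)\<bar> + 1"
  have M: "M > 0" using B0 B1 by (simp add: M_def)
  have lip: "\<bar>f v - f w\<bar> \<le> K * \<bar>v - w\<bar>" if "\<bar>v\<bar> \<le> M" "\<bar>w\<bar> \<le> M" for v w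
  proof -
    have "\<bar>f' x\<bar> \<le> K" if "x \<in> {-M..M}" for x
    proof -
      have "f' (-M) \<le> f' x" "f' x \<le> f' M" using strict_mono_less_eq[OF f'_mono] that by auto
      then show ?thesis unfolding K_def by linarith
    qed
    then have "norm (f v - f w) \<le> K * norm (v - w)"
      using that assms(1)
      by (intro field_differentiable_bound[of "{-M..M}" f f' K v w])
        (auto intro: has_field_derivative_at_within simp: abs_le_iff)
    then show ?thesis by simp
  qed
  interpret bounded_weak_solution f u0 u M K
  proof
    show "continuous_on UNIV f"
      using assms(1) by (meson DERIV_isCont continuous_at_imp_continuous_on)
    show "AE z in lebesgue_on half_plane. \<bar>u (fst z) (snd z)\<bar> \<le> M"
      using B1(2) by eventually_elim (use B0 in \<open>simp add: M_def\<close>)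
    show "AE x in lebesgue. \<bar>u0 x\<bar> \<le> M"
      using B0(2) by eventually_elim (use B1 in \<open>simp add: M_def\<close>)
    show "(\<lambda>z. u (fst z) (snd z)) \<in> borel_measurable (lebesgue_on half_plane)"
      using sol(1) by (simp add: Linfty_def)
  qed (use M lip meas sol K_def in auto)
  obtain E where E: "E > 0" and osl': "\<And>t a. t > 0 \<Longrightarrow> a > 0 \<Longrightarrow> AE x in lebesgue. u (x + a) t - u x t \<le> E * a / t"
    using sol(4) unfolding oleinik_condition_def by blast
  have osl: "AE x in lebesgue. u (x + a) t - u x t \<le> E / t * a" if "t > 0" "a > 0" for t a
    using osl'[OF that] by simp
  have "(LINT x:{0..pl}|lebesgue. w0l x) = 0" "(LINT x:{0..pr}|lebesgue. w0r x) = 0"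
    using assms(8,9,12,13) by auto
  then obtain Cl Cr where Cl: "\<And>x. \<bar>prim w0l x\<bar> \<le> Cl" and Cr: "\<And>x. \<bar>prim w0r x\<bar> \<le> Cr"
    using prim_periodic_bounded[OF meas(1) Bl assms(8,10)] prim_periodic_bounded[OF meas(2) Br assms(9,11)]
    by blast
  obtain C where C: "C > 0" "\<And>v x. ul \<le> v \<Longrightarrow> v \<le> ur \<Longrightarrow> v * x - C \<le> prim u0 x"
    "\<And>x. x \<le> 0 \<Longrightarrow> prim u0 x \<le> ul * x + C" "\<And>x. x \<ge> 0 \<Longrightarrow> prim u0 x \<le> ur * x + C"
    using prim_initial_bounds[OF meas(3) B0(2) meas(1) Bl Cl meas(2) Br Cr assms(16,17,5,14)] by blast
  have init: "potential x 0 = prim u0 x" for x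
    by (simp add: potential_def slice_def set_lebesgue_integral_def)
  have lower: "v * x - f v * t - C \<le> potential x t" if v: "ul \<le> v" "v \<le> ur" and t: "t > 0" for v x t
  proof -
    have "\<bar>v\<bar> \<le> M" using v B0 B1 unfolding M_def by linarith
    moreover have "potential x 0 - v * x \<ge> - C" for x using C(2)[OF v, of x] by (simp add: init)
    ultimately show ?thesis using potential_lower[OF osl E, of v "- C" t x] t by simp
  qed
  have upper: "potential x t \<le> v * x - f v * t + C"
    if t: "t > 0" and v: "v = rarefaction f' ul ur x t" for x t v
  proof -
    \<comment> \<open>By convexity the relative flux \<open>f w - f' v * w\<close> is smallest at
      \<open>w = v\<close>.\<close>
    have line: "potential x t \<le> potential (x - f' v * t) 0 - (f v - f' v * v) * t"
    proof -
      have "f v - f' v * v \<le> f w - f' v * w" for w using tangent[of v w] by (simp add: algebra_simps)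
      from potential_upper[OF less_imp_le[OF t] this, of "x - f' v * t"] show ?thesis by simp
    qed
    \<comment> \<open>The foot of the characteristic is nonpositive with \<open>v = ul\<close>, zero
      inside the fan, or positive with \<open>v = ur\<close>: in each case the upper bound of the
      initial primitive has slope \<open>v\<close>.\<close>
    have "potential (x - f' v * t) 0 \<le> v * (x - f' v * t) + C"
      unfolding init
    proof (cases rule: rarefaction_cases[OF f'_cont f'_mono assms(5) t, of x, case_names left fan right])
      case left
      then show "prim u0 (x - f' v * t) \<le> v * (x - f' v * t) + C" using C(3) v by simp
    next
      case fan
      then show "prim u0 (x - f' v * t) \<le> v * (x - f' v * t) + C" using C(3)[of 0] v by simp
    next
      case right
      then show "prim u0 (x - f' v * t) \<le> v * (x - f' v * t) + C" using C(4) v by simp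
    qed
    with line show ?thesis by (simp add: algebra_simps)
  qed
  have main: "esssup lebesgue (\<lambda>x. ereal \<bar>u x t - rarefaction f' ul ur x t\<bar>) \<le> ereal (sqrt (4 * C * E) / sqrt t)"
    if t: "t > 0" for t
  proof (rule esssup_I)
    have "(\<lambda>x. rarefaction f' ul ur x t) \<in> borel_measurable lebesgue"
      by (intro measurable_completion) (simp add: borel_measurable_mono rarefaction_mono[OF f'_cont f'_mono assms(5) t])
    then show "(\<lambda>x. ereal \<bar>u x t - rarefaction f' ul ur x t\<bar>) \<in> borel_measurable lebesgue"
      by (intro borel_measurable_ereal borel_measurable_abs borel_measurable_diff slice_measurable[OF t])
    have "AE x in lebesgue. \<forall>y. potential y t \<le> potential x t + u x t * (y - x) + E / t * (y - x)\<^sup>2 / 2"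
      by (rule potential_supergradient[OF t]) (rule osl[OF t])
    then show "AE x in lebesgue. ereal \<bar>u x t - rarefaction f' ul ur x t\<bar> \<le> ereal (sqrt (4 * C * E) / sqrt t)"
    proof eventually_elim
      case (elim x)
      define v where "v = rarefaction f' ul ur x t"
      define w where "w = u x t - v"
      \<comment> \<open>The minimizer of the quadratic
        \<open>w * (y - x) + E / t * (y - x)\<^sup>2 / 2\<close>, whose minimum is
        \<open>- w\<^sup>2 * t / (2 * E)\<close>. The error \<open>C\<close> enters twice, at
        \<open>y\<close> from below and at \<open>x\<close> from above, which yields
        \<open>4 * C * E\<close>.\<close>
      define y where "y = x - w * t / E"
      have "v * y - f v * t - C \<le> potential y t"
        using rarefaction_bounds[OF f'_cont f'_mono assms(5) t, of x] by (intro lower t) (auto simp: v_def)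
      also have "\<dots> \<le> potential x t + u x t * (y - x) + E / t * (y - x)\<^sup>2 / 2" by (rule elim[rule_format])
      also have "\<dots> \<le> v * x - f v * t + C + u x t * (y - x) + E / t * (y - x)\<^sup>2 / 2"
        using upper[OF t v_def] by simp
      finally have "0 \<le> 2 * C + w * (y - x) + E / t * (y - x)\<^sup>2 / 2" by (simp add: w_def algebra_simps)
      also have "\<dots> = 2 * C - w\<^sup>2 * t / (2 * E)"
        using t E by (simp add: y_def power2_eq_square field_simps)
      finally have "w\<^sup>2 \<le> 4 * C * E / t" using t E by (simp add: field_simps)
      then have "\<bar>w\<bar> \<le> sqrt (4 * C * E / t)" by (rule real_le_rsqrt[of "\<bar>w\<bar>", simplified])
      then show ?case by (simp add: w_def v_def real_sqrt_divide)
    qed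
  qed
  show ?thesis
    by (rule exI[of _ "sqrt (4 * C * E)"]) (use C(1) E main in simp)
qed

end
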